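(* Let $n\ge2$, $M\ge1$ be integers and let $L$ be a strongly elliptic, homogeneous, constant complex coefficient, second-order $M\times M$ system in $\mathbb{R}^n$, with Poisson kernel $P^L$ in $\mathbb{R}^n_+$. Let $\omega$ be a growth function such that, for some finite constant $C_\omega\ge1$, $$t\int_t^{\infty}\frac{\omega(s)}{s}\,\frac{ds}{s}\leq C_\omega\,\omega(t)\quad\text{for all }t\in(0,\infty).$$ Then the generalized Hölder Dirichlet problem for $L$ in $\mathbb{R}^n_+$ is well-posed: for each $f\in\dot{\mathscr{C}}^{\omega}(\mathbb{R}^{n-1},\mathbb{C}^M)$ there exists a unique function $u$ satisfying $$u\in\mathscr{C}^{\infty}(\mathbb{R}^{n}_{+},\mathbb{C}^M),\quad Lu=0\text{ in }\mathbb{R}^n_{+},\quad[u]_{\dot{\mathscr{C}}^{\omega}(\mathbb{R}^n_{+},\mathbb{C}^M)}<\infty,\quad u|^{\lim}_{\partial\mathbb{R}^n_{+}}=f\text{ on }\mathbb{R}^{n-1},$$ and it is given by $u(x',t)=(P_t^L*f)(x')$ for all $(x',t)\in\mathbb{R}^n_{+}$. In addition, $u$ extends to a function in $\dot{\mathscr{C}}^{\omega}(\overline{\mathbb{R}^n_{+}},\mathbb{C}^M)$ with $u|_{\partial\mathbb{R}^n_{+}}=f$, and there exists a finite constant $C=C(n,L,\omega)\geq1$ such that $$C^{-1}[f]_{\dot{\mathscr{C}}^{\omega}(\mathbb{R}^{n-1},\mathbb{C}^M)}\leq[u]_{\dot{\mathscr{C}}^{\omega}(\mathbb{R}^n_{+},\mathbb{C}^M)}\leq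 C[f]_{\dot{\mathscr{C}}^{\omega}(\mathbb{R}^{n-1},\mathbb{C}^M)}.$$
   Context: Notation. Points of $\mathbb{R}^n$ are written $x=(x',t)$ with $x'\in\mathbb{R}^{n-1}$; $\mathbb{R}^n_+=\{(x',t):t>0\}$, and $\partial\mathbb{R}^n_+$ is identified with $\mathbb{R}^{n-1}$. System. $L=(a_{jk}^{\alpha\beta}\partial_j\partial_k)_{1\le\alpha,\beta\le M}$ with constants $a_{jk}^{\alpha\beta}\in\mathbb{C}$ (summation over repeated indices), i.e. $(Lu)_\alpha=a_{jk}^{\alpha\beta}\partial_j\partial_k u_\beta$. Strong ellipticity: there is $\kappa_0>0$ with $\mathrm{Re}[a_{jk}^{\alpha\beta}\xi_j\xi_k\overline{\zeta_\alpha}\zeta_\beta]\ge\kappa_0|\xi|^2|\zeta|^2$ for all $\xi\in\mathbb{R}^n$, $\zeta\in\mathbb{C}^M$. Poisson kernel. $P^L:\mathbb{R}^{n-1}\to\mathbb{C}^{M\times M}$ is the (known to exist) $\mathscr{C}^\infty$ function with $|P^L(x')|\le C(1+|x'|^2)^{-n/2}$, $\int_{\mathbb{R}^{n-1}}P^L(x')\,dx'=I_{M\times M}$, and such that, with $P^L_t(x'):=t^{1-n}P^L(x'/t)$, the function $K^L(x',t):=P^L_t(x')$ is $\mathscr{C}^\infty$ on $\overline{\mathbb{R}^n_+}\setminus B(0,\varepsilon)$ for every $\varepsilon>0$ and each column of $K^L$ is annihilated by $L$ in $\mathbb{R}^n_+$. The convolution $P^L_t*f$ is in $\mathbb{R}^{n-1}$.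 A growth function is a non-decreasing $\omega:(0,\infty)\to(0,\infty)$ with $\omega(t)\to0$ as $t\to0^+$. For a set $E$ with at least two points, $[u]_{\dot{\mathscr{C}}^\omega(E,\mathbb{C}^M)}:=\sup_{x\ne y\in E}\frac{|u(x)-u(y)|}{\omega(|x-y|)}$, and $\dot{\mathscr{C}}^\omega(E,\mathbb{C}^M)$ is the set of $u:E\to\mathbb{C}^M$ for which this is finite. $u|^{\lim}_{\partial\mathbb{R}^n_+}(x'):=\lim_{\mathbb{R}^n_+\ni y\to(x',0)}u(y)$ is the unrestricted pointwise trace; $u|_{\partial\mathbb{R}^n_+}$ is the ordinary restriction to the boundary of the continuous extension of $u$ to $\overline{\mathbb{R}^n_+}$. *)

theory Defs
  imports "HOL-Analysis.Analysis"
begin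

text \<open>
  \<open>\<real>\<^sup>n\<close> is the Euclidean product space \<open>'a \<times> real\<close> with \<open>DIM('a) = n - 1\<close>, so that its points are
  pairs \<open>(x', t)\<close>. Functions on a subset are represented by total functions whose values outside
  the subset are irrelevant.
\<close>

definition upper_half_space :: "('a::euclidean_space \<times> real) set" where
  "upper_half_space = {(x', t). t > 0}"

definition partial_deriv ::
    "'a::euclidean_space \<Rightarrow> ('a \<Rightarrow> 'b::real_normed_vector) \<Rightarrow> 'a \<Rightarrow> 'b" where
  "partial_deriv e f x = frechet_derivative f (at x) e"

definition iterated_partial ::
    "'a::euclidean_space list \<Rightarrow> ('a \<Rightarrow> 'b::real_normed_vector) \<Rightarrow> 'a \<Rightarrow> 'b" where
  "iterated_partial es f = foldr partial_deriv es f"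

text \<open>
  For open \<open>S\<close> this is membership in \<open>C\<^sup>\<infinity>(S)\<close>: all iterated partial derivatives exist and are
  differentiable, hence continuous.
\<close>

definition smooth_on :: "'a::euclidean_space set \<Rightarrow> ('a \<Rightarrow> 'b::real_normed_vector) \<Rightarrow> bool" where
  "smooth_on S f \<longleftrightarrow>
     (\<forall>es. set es \<subseteq> Basis \<longrightarrow> (\<forall>x\<in>S. iterated_partial es f differentiable (at x)))"

text \<open>
  Smoothness up to the boundary, for a set contained in the closure of its interior: \<open>f\<close> is smooth
  in the interior and every iterated partial derivative extends continuously to the whole set.
  The values of \<open>f\<close> on the boundary are not used.
\<close>

definition smooth_up_to_boundary ::
    "'a::euclidean_space set \<Rightarrow> ('a \<Rightarrow> 'b::real_normed_vector) \<Rightarrow> bool" where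
  "smooth_up_to_boundary E f \<longleftrightarrow>
     smooth_on (interior E) f \<and>
     (\<forall>es. set es \<subseteq> Basis \<longrightarrow>
        (\<exists>g. continuous_on E g \<and> (\<forall>x\<in>interior E. g x = iterated_partial es f x)))"

text \<open>
  A system is given by coefficients \<open>a j k $ \<alpha> $ \<beta>\<close>, where the indices \<open>j, k\<close> run
  over the standard basis vectors; \<open>\<partial>\<^sub>j\<close> is then the derivative in direction \<open>j\<close>, and \<open>\<xi> \<bullet> j\<close> is the
  \<open>j\<close>-th coordinate of \<open>\<xi>\<close>. Values of \<open>a\<close> off the basis are never used.
\<close>

type_synonym ('a, 'M) system = "'a \<Rightarrow> 'a \<Rightarrow> complex^'M^'M"

definition apply_system ::
    "('a::euclidean_space, 'M::finite) system \<Rightarrow> ('a \<Rightarrow> complex^'M) \<Rightarrow> 'a \<Rightarrow> complex^'M" where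
  "apply_system a u x =
     (\<chi> \<alpha>. \<Sum>\<beta>\<in>UNIV. \<Sum>j\<in>Basis. \<Sum>k\<in>Basis.
        a j k $ \<alpha> $ \<beta> * partial_deriv j (partial_deriv k u) x $ \<beta>)"

definition strongly_elliptic :: "('a::euclidean_space, 'M::finite) system \<Rightarrow> bool" where
  "strongly_elliptic a \<longleftrightarrow>
     (\<exists>\<kappa>\<^sub>0>0. \<forall>(\<xi>::'a) (\<zeta>::complex^'M).
        Re (\<Sum>\<alpha>\<in>UNIV. \<Sum>\<beta>\<in>UNIV. \<Sum>j\<in>Basis. \<Sum>k\<in>Basis.
              a j k $ \<alpha> $ \<beta> * of_real (\<xi> \<bullet> j) * of_real (\<xi> \<bullet> k) * cnj (\<zeta> $ \<alpha>) * \<zeta> $ \<beta>)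
        \<ge> \<kappa>\<^sub>0 * (norm \<xi>)\<^sup>2 * (norm \<zeta>)\<^sup>2)"

text \<open>\<open>P\<^sub>t(x') = t\<^bsup>1-n\<^esup> P(x'/t)\<close>, where \<open>n - 1 = DIM('a)\<close>.\<close>

definition kernel_dilate ::
    "('a::euclidean_space \<Rightarrow> complex^'M::finite^'M) \<Rightarrow> real \<Rightarrow> 'a \<Rightarrow> complex^'M^'M" where
  "kernel_dilate P t x' = (1 / t ^ DIM('a)) *\<^sub>R P ((1 / t) *\<^sub>R x')"

definition kernel_extension ::
    "('a::euclidean_space \<Rightarrow> complex^'M::finite^'M) \<Rightarrow> 'a \<times> real \<Rightarrow> complex^'M^'M" where
  "kernel_extension P = (\<lambda>(x', t). kernel_dilate P t x')"

definition is_poisson_kernel ::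
    "('a::euclidean_space \<times> real, 'M::finite) system \<Rightarrow> ('a \<Rightarrow> complex^'M^'M) \<Rightarrow> bool" where
  "is_poisson_kernel a P \<longleftrightarrow>
     smooth_on UNIV P \<and>
     (\<exists>C. \<forall>x'. norm (P x') \<le> C * (1 + (norm x')\<^sup>2) powr (- real DIM('a \<times> real) / 2)) \<and>
     has_bochner_integral lborel P (mat 1) \<and>
     (\<forall>\<epsilon>>0. smooth_up_to_boundary (closure upper_half_space - ball 0 \<epsilon>) (kernel_extension P)) \<and>
     (\<forall>\<beta>. \<forall>x\<in>upper_half_space. apply_system a (\<lambda>y. column \<beta> (kernel_extension P y)) x = 0)"

definition matrix_convolution ::
    "('a::euclidean_space \<Rightarrow> complex^'M::finite^'M) \<Rightarrow> ('a \<Rightarrow> complex^'M) \<Rightarrow> 'a \<Rightarrow> complex^'M" where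
  "matrix_convolution Q f x = (\<integral>y. Q (x - y) *v f y \<partial>lborel)"

definition growth_function :: "(real \<Rightarrow> real) \<Rightarrow> bool" where
  "growth_function \<omega> \<longleftrightarrow>
     (\<forall>t>0. \<omega> t > 0) \<and> mono_on {0<..} \<omega> \<and> (\<omega> \<longlongrightarrow> 0) (at_right 0)"

definition holder_seminorm ::
    "(real \<Rightarrow> real) \<Rightarrow> 'a::metric_space set \<Rightarrow> ('a \<Rightarrow> 'b::metric_space) \<Rightarrow> ennreal" where
  "holder_seminorm \<omega> E u =
     (SUP (x, y) \<in> {(x, y). x \<in> E \<and> y \<in> E \<and> x \<noteq> y}. ennreal (dist (u x) (u y) / \<omega> (dist x y)))"

definition holder_space ::
    "(real \<Rightarrow> real) \<Rightarrow> 'a::metric_space set \<Rightarrow> ('a \<Rightarrow> 'b::metric_space) set" where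
  "holder_space \<omega> E = {u. holder_seminorm \<omega> E u < \<infinity>}"

definition solves_holder_dirichlet ::
    "('a::euclidean_space \<times> real, 'M::finite) system \<Rightarrow> (real \<Rightarrow> real) \<Rightarrow>
     ('a \<Rightarrow> complex^'M) \<Rightarrow> ('a \<times> real \<Rightarrow> complex^'M) \<Rightarrow> bool" where
  "solves_holder_dirichlet a \<omega> f u \<longleftrightarrow>
     smooth_on upper_half_space u \<and>
     (\<forall>x\<in>upper_half_space. apply_system a u x = 0) \<and>
     holder_seminorm \<omega> upper_half_space u < \<infinity> \<and>
     (\<forall>x'. (u \<longlongrightarrow> f x') (at (x', 0) within upper_half_space))"

end

theory Submission
  imports Defs "HOL-Probability.Probability"
begin

text \<open>
  Existence. The kernel \<open>K(x', t) = P\<^sub>t(x')\<close> is homogeneous of degree \<open>1 - n\<close> and smooth up to the boundary away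
  from the origin, so each of its derivatives is bounded by a power of the distance to the origin. With
  the tail condition on \<open>\<omega>\<close>, and since \<open>K(\<cdot>, t)\<close> integrates to the identity, this gives
  \<open>|u(x', t) - f(x')| \<le> c [f] \<omega>(t)\<close> and \<open>|\<nabla>u(x', t)| \<le> c [f] \<omega>(t) / t\<close> for the Poisson integral \<open>u\<close> of \<open>f\<close>, and hence
  the Hoelder estimate up to the boundary.

  Uniqueness. Let \<open>v\<close> be a solution with zero trace. The function
  \<open>V(x', t) = v(x', t + \<delta>) - (P\<^sub>t * v(\<cdot>, \<delta>))(x')\<close> is a solution of sublinear growth in \<open>t\<close> which is
  locally \<open>O(t\<^bsup>3/4\<^esup>)\<close> at the boundary. Garding's inequality (through the Fourier transform) yields a Caccioppoli
  inequality up to the boundary, and its iteration on tangential differences shows that \<open>V\<close> does not depend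
  on \<open>x'\<close>. Then \<open>V\<close> is affine in \<open>t\<close>, hence zero. Therefore \<open>|v(x', t + \<delta>)| \<le> c \<omega>(\<delta>)\<close>, and \<open>\<delta>\<close> tends to \<open>0\<close>.
\<close>

section \<open>Iterated partial derivatives\<close>

text \<open>Strong ellipticity is the Legendre-Hadamard condition: it gives no pointwise coercivity
  in the gradient and no maximum principle, only an integrated inequality for compactly supported
  functions. Uniqueness therefore has to be an energy argument. The cutoff in it must also vanish
  near t = 0; its slope 1/s on the layer s <= t <= 2 s costs energy of order sup |V|^2 / s, so V has
  to be o(t^(1/2)) there. The modulus \<omega> may be far weaker, which is why the argument is not
  run on v itself: the slice v(., delta) is smooth, and subtracting its Poisson integral from the
  shifted solution yields a difference that vanishes fast enough. For this the Poisson estimates are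
  needed with s^(3/4) in place of \<omega>. At infinity the energy of V on a ball of radius R is
  O(R^(n+2)) and each tangential difference gains R^(-2), so that differences of order n + 2 vanish;
  boundedness of V at fixed height then brings the order down to one. Multiples of t survive all
  this and are excluded because the tail condition forces \<omega>(t)/t to tend to 0.\<close>

lemma open_upper_half_space: "open (upper_half_space :: ('a::euclidean_space \<times> real) set)"
proof -
  have "upper_half_space = (UNIV :: 'a set) \<times> {0<..}" by (auto simp: upper_half_space_def)
  moreover have "open \<dots>" by (intro open_Times) auto
  ultimately show ?thesis by simp
qed

lemma mem_upper_half_space [simp]: "(y, t) \<in> upper_half_space \<longleftrightarrow> 0 < t"
  by (simp add: upper_half_space_def)

lemma upper_half_space_iff: "x \<in> upper_half_space \<longleftrightarrow> 0 < snd x"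
  by (cases x) simp

lemma closure_upper_half_space:
  "closure upper_half_space = {x :: 'a::euclidean_space \<times> real. 0 \<le> snd x}"
proof -
  have "upper_half_space = (UNIV :: 'a set) \<times> {0<..}" by (auto simp: upper_half_space_def)
  then have "closure upper_half_space = closure ((UNIV :: 'a set) \<times> {0::real<..})" by (rule arg_cong)
  also have "\<dots> = closure UNIV \<times> closure {0<..}" by (rule closure_Times)
  also have "\<dots> = {x. 0 \<le> snd x}" by (simp add: set_eq_iff mem_Times_iff)
  finally show ?thesis .
qed

lemma partial_deriv_eq: "(f has_derivative D) (at x) \<Longrightarrow> partial_deriv e f x = D e"
  unfolding partial_deriv_def by (drule frechet_derivative_at) simp

text \<open>The equality holds also at points of non-differentiability: near a point of an open set
  both functions have the same candidate derivatives, so the choice behind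
  \<open>frechet_derivative\<close> returns the same value for both.\<close>

lemma partial_deriv_cong:
  assumes "open S" "x \<in> S" "\<And>y. y \<in> S \<Longrightarrow> f y = g y"
  shows "partial_deriv e f x = partial_deriv e g x"
proof -
  have "(f has_derivative D) (at x) \<longleftrightarrow> (g has_derivative D) (at x)" for D
    by (rule iffI; erule has_derivative_transform_within_open[OF _ assms(1,2)]; simp add: assms(3))
  then show ?thesis by (simp add: partial_deriv_def frechet_derivative_def)
qed

lemma differentiable_cong:
  assumes "open S" "x \<in> S" "\<And>y. y \<in> S \<Longrightarrow> f y = g y" "f differentiable at x"
  shows "g differentiable at x"
  using assms unfolding differentiable_def by (metis has_derivative_transform_within_open)

lemma frechet_derivative_sum_partial:
  assumes "f differentiable at x"
  shows "frechet_derivative f (at x) h = (\<Sum>b\<in>Basis. (h \<bullet> b) *\<^sub>R partial_deriv b f x)"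
proof -
  have lin: "linear (frechet_derivative f (at x))"
    using assms by (rule linear_frechet_derivative)
  have "frechet_derivative f (at x) h = frechet_derivative f (at x) (\<Sum>b\<in>Basis. (h \<bullet> b) *\<^sub>R b)"
    by (simp add: euclidean_representation)
  also have "\<dots> = (\<Sum>b\<in>Basis. (h \<bullet> b) *\<^sub>R frechet_derivative f (at x) b)"
    using lin by (simp add: linear_sum linear_scale)
  finally show ?thesis by (simp add: partial_deriv_def)
qed

lemma has_derivative_frechet: "f differentiable at x \<Longrightarrow> (f has_derivative frechet_derivative f (at x)) (at x)"
  by (simp add: frechet_derivative_works)

lemma has_derivative_sum_partial:
  assumes "f differentiable at x"
  shows "(f has_derivative (\<lambda>h. \<Sum>b\<in>Basis. (h \<bullet> b) *\<^sub>R partial_deriv b f x)) (at x)"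
  by (rule has_derivative_eq_rhs[OF has_derivative_frechet[OF assms]])
     (simp add: fun_eq_iff frechet_derivative_sum_partial[OF assms])

text \<open>Each coordinate of a vector is at most its norm, whence the factor
  \<open>DIM('a)\<close>. With \<open>B = 0\<close> this becomes the constancy criterion used in the
  Liouville theorem.\<close>

lemma mean_value_partial:
  fixes f :: "'a::euclidean_space \<Rightarrow> 'b::real_normed_vector"
  assumes "convex S" "\<And>z. z \<in> S \<Longrightarrow> f differentiable at z"
    and "\<And>z b. z \<in> S \<Longrightarrow> b \<in> Basis \<Longrightarrow> norm (partial_deriv b f z) \<le> B"
    and "x \<in> S" "y \<in> S"
  shows "norm (f x - f y) \<le> real DIM('a) * B * norm (x - y)"
proof -
  have *: "onorm (\<lambda>h. \<Sum>b\<in>Basis. (h \<bullet> b) *\<^sub>R partial_deriv b f z) \<le> real DIM('a) * B" if "z \<in> S" for z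
  proof (rule onorm_le)
    fix h :: 'a
    have "norm (\<Sum>b\<in>Basis. (h \<bullet> b) *\<^sub>R partial_deriv b f z) \<le> (\<Sum>b\<in>(Basis::'a set). norm h * B)"
    proof (rule order_trans[OF norm_sum sum_mono])
      fix b :: 'a assume b: "b \<in> Basis"
      show "norm ((h \<bullet> b) *\<^sub>R partial_deriv b f z) \<le> norm h * B"
        using Basis_le_norm[OF b, of h] assms(3)[OF that b]
        by (simp add: mult_mono)
    qed
    then show "norm (\<Sum>b\<in>Basis. (h \<bullet> b) *\<^sub>R partial_deriv b f z) \<le> real DIM('a) * B * norm h"
      by (simp add: mult_ac)
  qed
  show ?thesis
    by (rule differentiable_bound[OF assms(1) _ * assms(4,5)])
       (rule has_derivative_at_withinI, rule has_derivative_sum_partial, rule assms(2))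
qed

lemma iterated_partial_Nil [simp]: "iterated_partial [] f = f"
  by (simp add: iterated_partial_def)

lemma iterated_partial_Cons [simp]:
  "iterated_partial (e # es) f = partial_deriv e (iterated_partial es f)"
  by (simp add: iterated_partial_def)

lemma iterated_partial_append: "iterated_partial (es @ fs) f = iterated_partial es (iterated_partial fs f)"
  by (simp add: iterated_partial_def)

lemma iterated_partial_cong:
  assumes "open S" "\<And>y. y \<in> S \<Longrightarrow> f y = g y" "x \<in> S"
  shows "iterated_partial es f x = iterated_partial es g x"
  using assms(3)
proof (induction es arbitrary: x)
  case (Cons e es)
  then show ?case unfolding iterated_partial_Cons by (intro partial_deriv_cong[OF assms(1)])
qed (simp add: assms(2))

lemma smooth_onD: "smooth_on S f \<Longrightarrow> set es \<subseteq> Basis \<Longrightarrow> x \<in> S \<Longrightarrow> iterated_partial es f differentiable at x"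
  unfolding smooth_on_def by blast

lemma smooth_on_differentiable: "smooth_on S f \<Longrightarrow> x \<in> S \<Longrightarrow> f differentiable at x"
  using smooth_onD[of S f "[]"] by simp

lemma smooth_on_iterated_partial:
  "smooth_on S f \<Longrightarrow> set es \<subseteq> Basis \<Longrightarrow> smooth_on S (iterated_partial es f)"
  unfolding smooth_on_def by (simp add: iterated_partial_append[symmetric])

lemma smooth_on_partial_deriv:
  "smooth_on S f \<Longrightarrow> e \<in> Basis \<Longrightarrow> smooth_on S (partial_deriv e f)"
  using smooth_on_iterated_partial[of S f "[e]"] by simp

lemma smooth_on_continuous_on: "smooth_on S f \<Longrightarrow> continuous_on S f"
  by (intro continuous_at_imp_continuous_on ballI differentiable_imp_continuous_within)
     (rule smooth_on_differentiable)

lemma has_derivative_translate_iff: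
  "((\<lambda>x. f (x + h)) has_derivative D) (at x) \<longleftrightarrow> (f has_derivative D) (at (x + h))"
proof
  assume *: "((\<lambda>x. f (x + h)) has_derivative D) (at x)"
  have "((\<lambda>y. y - h) has_derivative (\<lambda>y. y)) (at (x + h))"
    by (auto intro!: derivative_eq_intros)
  from has_derivative_compose[OF this, of "\<lambda>x. f (x + h)" D] * show "(f has_derivative D) (at (x + h))"
    by simp
next
  assume *: "(f has_derivative D) (at (x + h))"
  have "((\<lambda>y. y + h) has_derivative (\<lambda>y. y)) (at x)"
    by (auto intro!: derivative_eq_intros)
  from has_derivative_compose[OF this, of f D] * show "((\<lambda>x. f (x + h)) has_derivative D) (at x)"
    by simp
qed

text \<open>As in \<open>partial_deriv_cong\<close>, the candidate derivatives on both sides are the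
  same, so the equality extends to points where f is not differentiable.\<close>

lemma partial_deriv_translate: "partial_deriv e (\<lambda>x. f (x + h)) x = partial_deriv e f (x + h)"
  unfolding partial_deriv_def frechet_derivative_def
  by (subst has_derivative_translate_iff) (rule refl)

lemma iterated_partial_translate:
  "iterated_partial es (\<lambda>x. f (x + h)) = (\<lambda>x. iterated_partial es f (x + h))"
  by (induction es) (auto simp: partial_deriv_translate)

lemma smooth_on_translate:
  assumes "smooth_on S f" "\<And>x. x \<in> T \<Longrightarrow> x + h \<in> S"
  shows "smooth_on T (\<lambda>x. f (x + h))"
  unfolding smooth_on_def iterated_partial_translate
proof (intro allI impI ballI)
  fix es :: "'a list" and x assume "set es \<subseteq> Basis" "x \<in> T"
  then have "iterated_partial es f differentiable at (x + h)"
    using assms unfolding smooth_on_def by blast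
  from has_derivative_frechet[OF this] show "(\<lambda>x. iterated_partial es f (x + h)) differentiable at x"
    by (rule differentiableI[OF has_derivative_translate_iff[THEN iffD2]])
qed

lemma apply_system_translate: "apply_system a (\<lambda>x. u (x + h)) x = apply_system a u (x + h)"
  using iterated_partial_translate[of "[_, _]" u h] by (simp add: apply_system_def fun_eq_iff)

lemma iterated_partial_linear_comp:
  assumes "open S" "bounded_linear L" "smooth_on S f" "set es \<subseteq> Basis" "x \<in> S"
  shows "iterated_partial es (\<lambda>x. L (f x)) x = L (iterated_partial es f x)"
  using assms(4,5)
proof (induction es arbitrary: x)
  case (Cons e es)
  have "partial_deriv e (iterated_partial es (\<lambda>x. L (f x))) x
      = partial_deriv e (\<lambda>x. L (iterated_partial es f x)) x"
    by (rule partial_deriv_cong[OF assms(1)]) (use Cons in auto)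
  also have "\<dots> = L (partial_deriv e (iterated_partial es f) x)"
  proof (rule partial_deriv_eq[THEN trans])
    show "((\<lambda>x. L (iterated_partial es f x)) has_derivative
       (\<lambda>h. L (frechet_derivative (iterated_partial es f) (at x) h))) (at x)"
      by (rule bounded_linear.has_derivative[OF assms(2)])
         (rule has_derivative_frechet, rule smooth_onD[OF assms(3)], use Cons.prems in auto)
  qed (simp add: partial_deriv_def)
  finally show ?case by simp
qed simp

lemma iterated_partial_diff:
  assumes "open S" "smooth_on S f" "smooth_on S g" "set es \<subseteq> Basis" "x \<in> S"
  shows "iterated_partial es (\<lambda>x. f x - g x) x = iterated_partial es f x - iterated_partial es g x"
  using assms(4,5)
proof (induction es arbitrary: x)
  case (Cons e es)
  have "partial_deriv e (iterated_partial es (\<lambda>x. f x - g x)) x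
      = partial_deriv e (\<lambda>x. iterated_partial es f x - iterated_partial es g x) x"
    by (rule partial_deriv_cong[OF assms(1)]) (use Cons in auto)
  also have "\<dots> = partial_deriv e (iterated_partial es f) x - partial_deriv e (iterated_partial es g) x"
  proof (rule partial_deriv_eq[THEN trans])
    show "((\<lambda>x. iterated_partial es f x - iterated_partial es g x) has_derivative
       (\<lambda>h. frechet_derivative (iterated_partial es f) (at x) h
            - frechet_derivative (iterated_partial es g) (at x) h)) (at x)"
      by (intro has_derivative_diff has_derivative_frechet smooth_onD[OF assms(2)] smooth_onD[OF assms(3)])
         (use Cons.prems in auto)
  qed (simp add: partial_deriv_def)
  finally show ?case by simp
qed simp

lemma smooth_on_diff:
  assumes "open S" "smooth_on S f" "smooth_on S g"
  shows "smooth_on S (\<lambda>x. f x - g x)"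
  unfolding smooth_on_def
proof (intro allI impI ballI)
  fix es :: "'a list" and x assume *: "set es \<subseteq> Basis" "x \<in> S"
  have "(\<lambda>x. iterated_partial es f x - iterated_partial es g x) differentiable at x"
    using smooth_onD[OF assms(2) *] smooth_onD[OF assms(3) *] by simp
  then show "iterated_partial es (\<lambda>x. f x - g x) differentiable at x"
    by (rule differentiable_cong[OF assms(1) \<open>x \<in> S\<close>, rotated])
       (simp add: iterated_partial_diff[OF assms] *)
qed

lemma apply_system_diff:
  assumes "open S" "smooth_on S u" "smooth_on S v" "x \<in> S"
  shows "apply_system a (\<lambda>x. u x - v x) x = apply_system a u x - apply_system a v x"
proof -
  have "partial_deriv j (partial_deriv k (\<lambda>x. u x - v x)) x
      = partial_deriv j (partial_deriv k u) x - partial_deriv j (partial_deriv k v) x"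
    if "j \<in> Basis" "k \<in> Basis" for j k
    using iterated_partial_diff[OF assms(1-3) _ assms(4), of "[j, k]"] that by simp
  then show ?thesis
    by (simp add: apply_system_def vec_eq_iff right_diff_distrib sum_subtractf)
qed

lemma partial_deriv_scale:
  assumes "f differentiable at (c *\<^sub>R x)"
  shows "partial_deriv e (\<lambda>x. f (c *\<^sub>R x)) x = c *\<^sub>R partial_deriv e f (c *\<^sub>R x)"
proof -
  have "((\<lambda>x. f (c *\<^sub>R x)) has_derivative (\<lambda>h. frechet_derivative f (at (c *\<^sub>R x)) (c *\<^sub>R h))) (at x)"
    by (rule has_derivative_compose[of "\<lambda>x. c *\<^sub>R x"])
       (rule has_derivative_scaleR_right has_derivative_ident has_derivative_frechet assms)+
  from partial_deriv_eq[OF this] show ?thesis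
    using linear_frechet_derivative[OF assms] by (simp add: partial_deriv_def linear_scale)
qed

text \<open>The homogeneity relation is differentiated: the chain rule produces a factor c on the
  left, and dividing by it lowers the degree by one for each derivative.\<close>

lemma iterated_partial_homogeneous:
  fixes f :: "'a::euclidean_space \<Rightarrow> 'b::real_normed_vector"
  assumes "open S" "smooth_on S f" and cone: "\<And>x. x \<in> S \<Longrightarrow> c *\<^sub>R x \<in> S"
    and hom: "\<And>x. x \<in> S \<Longrightarrow> f (c *\<^sub>R x) = (1 / c ^ d) *\<^sub>R f x" and "c > 0"
    and es: "set es \<subseteq> Basis" and "x \<in> S"
  shows "iterated_partial es f (c *\<^sub>R x) = (1 / c ^ (d + length es)) *\<^sub>R iterated_partial es f x"
  using es \<open>x \<in> S\<close>
proof (induction es arbitrary: x)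
  case Nil then show ?case by (simp add: hom)
next
  case (Cons e es)
  let ?g = "iterated_partial es f"
  have es: "set es \<subseteq> Basis" using Cons by auto
  have "c *\<^sub>R partial_deriv e ?g (c *\<^sub>R x) = partial_deriv e (\<lambda>x. ?g (c *\<^sub>R x)) x"
    by (rule partial_deriv_scale[symmetric]) (use smooth_onD[OF assms(2) es] Cons cone in auto)
  also have "\<dots> = partial_deriv e (\<lambda>x. (1 / c ^ (d + length es)) *\<^sub>R ?g x) x"
    by (rule partial_deriv_cong[OF assms(1)]) (use Cons es in auto)
  also have "\<dots> = (1 / c ^ (d + length es)) *\<^sub>R partial_deriv e ?g x"
  proof (rule partial_deriv_eq[THEN trans])
    show "((\<lambda>x. (1 / c ^ (d + length es)) *\<^sub>R ?g x) has_derivative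
       (\<lambda>h. (1 / c ^ (d + length es)) *\<^sub>R frechet_derivative ?g (at x) h)) (at x)"
      by (intro has_derivative_scaleR_right has_derivative_frechet smooth_onD[OF assms(2) es])
         (use Cons.prems in auto)
  qed (simp add: partial_deriv_def)
  finally have "(1/c) *\<^sub>R (c *\<^sub>R partial_deriv e ?g (c *\<^sub>R x))
     = (1/c) *\<^sub>R ((1 / c ^ (d + length es)) *\<^sub>R partial_deriv e ?g x)" by simp
  then show ?case using \<open>c > 0\<close> by simp
qed

section \<open>Integrals of growth functions\<close>

text \<open>The case k = 0 evaluates the weight of the tail condition. The case k =
  \<open>DIM('a)\<close> writes the decay of the kernel as an integral over tails, which later turns
  radial weights into volumes of balls.\<close>

lemma nn_integral_inverse_power_tail:
  assumes "r > 0"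
  shows "(\<integral>\<^sup>+s\<in>{r<..}. ennreal (real (Suc k) / s ^ Suc (Suc k)) \<partial>lborel) = ennreal (1 / r ^ Suc k)"
proof -
  have "(\<integral>\<^sup>+s. ennreal (real (Suc k) / s ^ Suc (Suc k)) * indicator {r..} s \<partial>lborel)
      = ennreal (0 - (- 1 / r ^ Suc k))"
  proof (rule nn_integral_FTC_atLeast)
    fix x :: real assume "r \<le> x"
    then have "x > 0" using assms by simp
    have "((\<lambda>s. - ((inverse s) ^ Suc k)) has_real_derivative
      - (real (Suc k) * (inverse x) ^ k * (- (inverse x ^ Suc (Suc 0))))) (at x)"
      by (rule derivative_eq_intros refl | use \<open>x > 0\<close> in simp)+
    moreover have "- (real (Suc k) * (inverse x) ^ k * (- (inverse x ^ Suc (Suc 0)))) = real (Suc k) / x ^ Suc (Suc k)"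
      using \<open>x > 0\<close> by (simp add: field_simps)
    ultimately show "((\<lambda>s. - 1 / s ^ Suc k) has_real_derivative real (Suc k) / x ^ Suc (Suc k)) (at x)"
      by (simp add: power_inverse divide_inverse mult_ac)
    show "0 \<le> real (Suc k) / x ^ Suc (Suc k)" using \<open>x > 0\<close> by simp
  next
    have "((\<lambda>s. - ((inverse s) ^ Suc k)) \<longlongrightarrow> - (0 ^ Suc k)) (at_top :: real filter)"
      by (intro tendsto_intros tendsto_inverse_0_at_top filterlim_ident)
    then show "((\<lambda>s::real. - 1 / s ^ Suc k) \<longlongrightarrow> 0) at_top"
      by (simp add: power_inverse divide_inverse)
  qed measurable
  also have "(\<integral>\<^sup>+s. ennreal (real (Suc k) / s ^ Suc (Suc k)) * indicator {r..} s \<partial>lborel)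
      = (\<integral>\<^sup>+s\<in>{r<..}. ennreal (real (Suc k) / s ^ Suc (Suc k)) \<partial>lborel)"
    by (intro nn_integral_cong_AE eventually_mono[OF AE_lborel_singleton[of r]])
       (auto split: split_indicator)
  finally show ?thesis by simp
qed

lemma emeasure_norm_less:
  assumes "r \<ge> 0"
  shows "emeasure lborel {y :: 'a::euclidean_space. norm y < r} = ennreal (unit_ball_vol (real DIM('a)) * r ^ DIM('a))"
proof -
  have "{y :: 'a. norm y < r} = ball 0 r" by (auto simp: dist_norm)
  then show ?thesis using emeasure_ball[OF assms, of "0 :: 'a"] by simp
qed

text \<open>The Poisson estimates are needed for two moduli: the given \<omega>, and s^(3/4),
  against which the boundary decay of the auxiliary solution in the uniqueness proof is
  measured.\<close>

locale controlled_growth =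
  fixes \<omega> :: "real \<Rightarrow> real" and C :: real
  assumes pos: "t > 0 \<Longrightarrow> \<omega> t > 0"
    and mono: "mono_on {0<..} \<omega>"
    and tail: "t > 0 \<Longrightarrow> ennreal t * (\<integral>\<^sup>+s\<in>{t<..}. ennreal (\<omega> s / s * (1 / s)) \<partial>lborel) \<le> ennreal (C * \<omega> t)"
begin

lemma monoD: "0 < s \<Longrightarrow> s \<le> t \<Longrightarrow> \<omega> s \<le> \<omega> t"
  using mono by (auto simp: mono_on_def)

text \<open>Nothing is known about \<omega> outside the positive reals, so measurability, which
  comes from monotonicity, is stated for the truncated function.\<close>

lemma borel_measurable_restricted [measurable]: "(\<lambda>s. indicator {0<..} s * \<omega> s) \<in> borel_measurable borel"
  using borel_measurable_mono_on_fnc[OF mono]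
  by (subst (asm) borel_measurable_restrict_space_iff) auto

lemma borel_measurable_shifted [measurable]:
  "t > 0 \<Longrightarrow> (\<lambda>y :: 'a::euclidean_space. \<omega> (t + norm y)) \<in> borel_measurable borel"
proof -
  assume "t > 0"
  then have eq: "indicator {0<..} (t + norm y) * \<omega> (t + norm y) = \<omega> (t + norm y)" for y :: 'a
    by (simp add: indicator_def add_pos_nonneg)
  have "(\<lambda>y :: 'a. indicator {0<..} (t + norm y) * \<omega> (t + norm y)) \<in> borel_measurable borel"
    by (rule measurable_compose[OF _ borel_measurable_restricted]) measurable
  then show ?thesis unfolding eq .
qed

text \<open>On the tail \<omega>(s) is at least \<omega>(t), and 1/s^2 integrates to 1/t
  there.\<close>

lemma quotient_le_tail:
  assumes "t > 0"
  shows "ennreal (\<omega> t / t) \<le> (\<integral>\<^sup>+s\<in>{t<..}. ennreal (\<omega> s / s * (1 / s)) \<partial>lborel)"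
proof -
  have "ennreal (\<omega> t / t) = ennreal (\<omega> t) * (\<integral>\<^sup>+s\<in>{t<..}. ennreal (1 / s ^ 2) \<partial>lborel)"
    using nn_integral_inverse_power_tail[OF assms, of 0] pos[OF assms] assms
    by (simp add: ennreal_mult[symmetric] power2_eq_square)
  also have "\<dots> = (\<integral>\<^sup>+s\<in>{t<..}. ennreal (\<omega> t) * ennreal (1 / s ^ 2) \<partial>lborel)"
    by (subst nn_integral_cmult[symmetric]) (auto simp: mult.assoc)
  also have "\<dots> \<le> (\<integral>\<^sup>+s\<in>{t<..}. ennreal (\<omega> s / s * (1 / s)) \<partial>lborel)"
  proof (rule nn_integral_mono)
    fix s :: real
    show "ennreal (\<omega> t) * ennreal (1 / s ^ 2) * indicator {t<..} s
        \<le> ennreal (\<omega> s / s * (1 / s)) * indicator {t<..} s"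
    proof (cases "t < s")
      case True
      then have "\<omega> t * (1 / s ^ 2) \<le> \<omega> s * (1 / s ^ 2)"
        using assms monoD[of t s] by (intro mult_right_mono) auto
      then show ?thesis using True pos[OF assms] assms
        by (simp add: ennreal_mult[symmetric] power2_eq_square ennreal_leI)
    qed simp
  qed
  finally show ?thesis .
qed

text \<open>A negative C would turn the right-hand side of \<open>tail\<close> into 0, since
  \<open>ennreal\<close> truncates, while the left-hand side is positive by
  \<open>quotient_le_tail\<close>.\<close>

lemma constant_nonneg: "C \<ge> 0"
proof (rule ccontr)
  assume "\<not> C \<ge> 0"
  then have "C * \<omega> 1 < 0" using pos[of 1] by (simp add: mult_less_0_iff)
  then have "ennreal 1 * (\<integral>\<^sup>+s\<in>{1<..}. ennreal (\<omega> s / s * (1 / s)) \<partial>lborel) \<le> 0"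
    using tail[of 1] by (simp add: ennreal_neg)
  moreover have "ennreal (\<omega> 1 / 1) \<le> (\<integral>\<^sup>+s\<in>{1<..}. ennreal (\<omega> s / s * (1 / s)) \<partial>lborel)"
    by (rule quotient_le_tail) simp
  ultimately have "ennreal (\<omega> 1) \<le> 0" by simp
  then show False using pos[of 1] by (simp add: ennreal_eq_0_iff)
qed

lemma tail_mono:
  assumes "r \<le> t"
  shows "(\<integral>\<^sup>+s\<in>{t<..}. ennreal (\<omega> s / s * (1 / s)) \<partial>lborel) \<le> (\<integral>\<^sup>+s\<in>{r<..}. ennreal (\<omega> s / s * (1 / s)) \<partial>lborel)"
  by (rule nn_integral_mono) (use assms in \<open>auto split: split_indicator\<close>)

text \<open>Almost monotonicity of \<omega>(t)/t: the tail integral beyond r contains the one beyond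
  t, and the latter dominates \<omega>(t)/t. Taking t = 2 r gives the doubling property, taking t =
  r gives C >= 1.\<close>

lemma quotient_le:
  assumes "0 < r" "r \<le> t"
  shows "\<omega> t / t \<le> C * \<omega> r / r"
proof -
  have "ennreal (r * (\<omega> t / t)) = ennreal r * ennreal (\<omega> t / t)"
    using assms by (intro ennreal_mult') simp
  also have "\<dots> \<le> ennreal r * (\<integral>\<^sup>+s\<in>{r<..}. ennreal (\<omega> s / s * (1 / s)) \<partial>lborel)"
    using quotient_le_tail[of t] tail_mono[OF assms(2)] assms
    by (intro mult_left_mono) (auto intro: order_trans)
  also have "\<dots> \<le> ennreal (C * \<omega> r)" using assms by (intro tail) simp
  finally have "r * (\<omega> t / t) \<le> C * \<omega> r"
    using assms pos[of r] constant_nonneg by (subst (asm) ennreal_le_iff) auto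
  then show ?thesis using assms by (simp add: field_simps)
qed

lemma double_le: "t > 0 \<Longrightarrow> \<omega> (2 * t) \<le> 2 * C * \<omega> t"
  using quotient_le[of t "2 * t"] by (simp add: field_simps)

lemma constant_ge_1: "C \<ge> 1"
  using quotient_le[of 1 1] pos[of 1] by simp

text \<open>The tail integral is finite, so its remainders tend to 0, and \<omega>(t)/t lies below
  them. This is what excludes non-zero multiples of t in the Liouville argument.\<close>

lemma sublinear: "((\<lambda>t. \<omega> t / t) \<longlongrightarrow> 0) at_top"
proof -
  define T where "T r = (\<integral>\<^sup>+s\<in>{r<..}. ennreal (\<omega> s / s * (1 / s)) \<partial>lborel)" for r
  define g where "g s = ennreal ((indicator {0<..} s * \<omega> s) / s * (1 / s))" for s
  have g[measurable]: "g \<in> borel_measurable borel" unfolding g_def by measurable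
  have T_eq: "T r = (\<integral>\<^sup>+s. g s * indicator {r<..} s \<partial>lborel)" if "r > 0" for r
    unfolding T_def g_def by (rule nn_integral_cong) (use that in \<open>auto split: split_indicator\<close>)
  have "(\<lambda>k. \<integral>\<^sup>+s. g s * indicator {real (Suc k)<..} s \<partial>lborel) \<longlonglongrightarrow> (\<integral>\<^sup>+s. 0 \<partial>(lborel :: real measure))"
  proof (rule nn_integral_dominated_convergence[where w = "\<lambda>s. g s * indicator {1<..} s"
      and u = "\<lambda>k s. g s * indicator {real (Suc k)<..} s" and u' = "\<lambda>_. 0"])
    show "(\<integral>\<^sup>+ s. g s * indicator {1<..} s \<partial>lborel) < \<infinity>"
      using tail[of 1] T_eq[of 1] le_less_trans[OF _ ennreal_less_top] by (simp add: T_def)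
    show "AE s in lborel. (\<lambda>k. g s * indicator {real (Suc k)<..} s) \<longlonglongrightarrow> 0"
    proof (rule AE_I2, rule tendsto_eventually)
      fix s :: real
      obtain N where "s < real N" using reals_Archimedean2 by blast
      then show "\<forall>\<^sub>F k in sequentially. g s * indicator {real (Suc k)<..} s = 0"
        unfolding eventually_sequentially by (intro exI[of _ N]) (auto split: split_indicator)
    qed
  qed (auto split: split_indicator)
  then have lim: "(\<lambda>k. T (real (Suc k))) \<longlonglongrightarrow> 0" by (simp add: T_eq)
  show ?thesis
  proof (rule tendstoI)
    fix e :: real assume "e > 0"
    then have "\<forall>\<^sub>F k in sequentially. T (real (Suc k)) < ennreal e"
      using order_tendstoD(2)[OF lim, of "ennreal e"] by simp
    then obtain k where k: "T (real (Suc k)) < ennreal e" by (auto simp: eventually_sequentially)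
    have "dist (\<omega> t / t) 0 < e" if "t \<ge> real (Suc k)" for t
    proof -
      have "t > 0" using that by linarith
      then have "ennreal (\<omega> t / t) \<le> T (real (Suc k))"
        using quotient_le_tail[of t] tail_mono[OF that] unfolding T_def by (meson order_trans)
      then have "ennreal (\<omega> t / t) < ennreal e" using k by simp
      then show ?thesis using pos[OF \<open>t > 0\<close>] \<open>t > 0\<close> by (simp add: ennreal_less_iff)
    qed
    then show "\<forall>\<^sub>F t in at_top. dist (\<omega> t / t) 0 < e"
      unfolding eventually_at_top_linorder by blast
  qed
qed

lemma le_linear: "t > 0 \<Longrightarrow> \<omega> t \<le> C * \<omega> 1 * (1 + t)"
proof (cases "t \<le> 1")
  case True
  moreover assume "t > 0"
  ultimately have "\<omega> t \<le> 1 * (\<omega> 1 * 1)" using monoD[of t 1] by simp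
  also have "\<dots> \<le> C * (\<omega> 1 * (1 + t))"
    using constant_ge_1 pos[of 1] \<open>t > 0\<close> by (intro mult_mono) auto
  finally show ?thesis by (simp add: mult_ac)
next
  case False
  moreover assume "t > 0"
  ultimately have "\<omega> t \<le> C * \<omega> 1 * t" using quotient_le[of 1 t] by (simp add: field_simps)
  also have "\<dots> \<le> C * \<omega> 1 * (1 + t)"
    using constant_ge_1 pos[of 1] by (intro mult_left_mono) auto
  finally show ?thesis .
qed

text \<open>Since \<open>\<omega>\<close> is monotone, \<open>\<omega>(r) r\<^bsup>-d-1\<^esup>\<close> is at most \<open>(d+1) \<integral>\<^sub>r\<^sup>\<infinity> \<omega>(s) s\<^bsup>-d-2\<^esup> ds\<close>; exchanging the order of
  integration leaves the volume of a ball and avoids polar coordinates.\<close>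

lemma nn_integral_shifted_le:
  assumes "t > 0"
  shows "(\<integral>\<^sup>+y. ennreal (\<omega> (t + norm y) / (t + norm y) ^ Suc DIM('a)) \<partial>(lborel :: 'a::euclidean_space measure))
    \<le> ennreal (real (Suc DIM('a)) * unit_ball_vol (real DIM('a)) * C * (\<omega> t / t))"
proof -
  define d where "d = DIM('a)"
  define g where "g s = ennreal (indicator {0<..} s * \<omega> s * (real (Suc d) / s ^ Suc (Suc d)))" for s
  have g[measurable]: "g \<in> borel_measurable borel" unfolding g_def by measurable
  have *: "ennreal (\<omega> r / r ^ Suc d) \<le> (\<integral>\<^sup>+s. g s * indicator {r<..} s \<partial>lborel)" if "r > 0" for r
  proof -
    have "ennreal (\<omega> r / r ^ Suc d) = ennreal (\<omega> r) * (\<integral>\<^sup>+s\<in>{r<..}. ennreal (real (Suc d) / s ^ Suc (Suc d)) \<partial>lborel)"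
      unfolding nn_integral_inverse_power_tail[OF that]
      using that pos[OF that] by (simp add: ennreal_mult[symmetric] del: power_Suc)
    also have "\<dots> = (\<integral>\<^sup>+s. ennreal (\<omega> r) * (ennreal (real (Suc d) / s ^ Suc (Suc d)) * indicator {r<..} s) \<partial>lborel)"
      by (subst nn_integral_cmult) auto
    also have "\<dots> \<le> (\<integral>\<^sup>+s. g s * indicator {r<..} s \<partial>lborel)"
    proof (rule nn_integral_mono)
      fix s :: real
      show "ennreal (\<omega> r) * (ennreal (real (Suc d) / s ^ Suc (Suc d)) * indicator {r<..} s) \<le> g s * indicator {r<..} s"
      proof (cases "r < s")
        case True
        then have "\<omega> r * (real (Suc d) / s ^ Suc (Suc d)) \<le> \<omega> s * (real (Suc d) / s ^ Suc (Suc d))"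
          using that monoD[of r s] by (intro mult_right_mono) auto
        then show ?thesis using True pos[OF that] that
          by (simp add: g_def ennreal_mult'[symmetric] ennreal_leI del: power_Suc)
      qed simp
    qed
    finally show ?thesis .
  qed
  have "(\<integral>\<^sup>+y. ennreal (\<omega> (t + norm y) / (t + norm y) ^ Suc d) \<partial>(lborel :: 'a measure))
      \<le> (\<integral>\<^sup>+y. \<integral>\<^sup>+s. g s * indicator {t + norm y<..} s \<partial>lborel \<partial>(lborel :: 'a measure))"
    by (intro nn_integral_mono *) (use assms in \<open>simp add: add_pos_nonneg\<close>)
  also have "\<dots> = (\<integral>\<^sup>+s. \<integral>\<^sup>+y. g s * indicator {t + norm y<..} s \<partial>(lborel :: 'a measure) \<partial>lborel)"
  proof (rule lborel_pair.Fubini'[symmetric])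
    have [measurable]: "{p :: 'a \<times> real. t + norm (fst p) < snd p} \<in> sets borel"
      by (intro borel_open open_Collect_less continuous_intros)
    have "(\<lambda>p :: 'a \<times> real. g (snd p)) \<in> borel_measurable borel"
      by (rule measurable_compose[OF _ g]) (intro borel_measurable_continuous_onI continuous_intros)
    then have "(\<lambda>p :: 'a \<times> real. g (snd p) * indicator {p. t + norm (fst p) < snd p} p) \<in> borel_measurable borel"
      by (rule borel_measurable_times_ennreal) measurable
    moreover have "(\<lambda>(y :: 'a, s). g s * indicator {t + norm y<..} s)
        = (\<lambda>p. g (snd p) * indicator {p. t + norm (fst p) < snd p} p)"
      by (auto simp: fun_eq_iff split: split_indicator)
    ultimately show "(\<lambda>(y :: 'a, s). g s * indicator {t + norm y<..} s) \<in> borel_measurable (lborel \<Otimes>\<^sub>M lborel)"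
      by (simp add: lborel_prod)
  qed
  also have "\<dots> \<le> (\<integral>\<^sup>+s. ennreal (real (Suc d) * unit_ball_vol (real d)) * (ennreal (\<omega> s / s * (1 / s)) * indicator {t<..} s) \<partial>lborel)"
  proof (rule nn_integral_mono)
    fix s :: real
    show "(\<integral>\<^sup>+y. g s * indicator {t + norm y<..} s \<partial>(lborel :: 'a measure))
      \<le> ennreal (real (Suc d) * unit_ball_vol (real d)) * (ennreal (\<omega> s / s * (1 / s)) * indicator {t<..} s)"
    proof (cases "t < s")
      case True
      have "(\<integral>\<^sup>+y. g s * indicator {t + norm y<..} s \<partial>(lborel :: 'a measure))
        = (\<integral>\<^sup>+y. g s * indicator {y. norm y < s - t} y \<partial>(lborel :: 'a measure))"
        by (rule nn_integral_cong) (auto split: split_indicator)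
      also have "\<dots> = g s * ennreal (unit_ball_vol (real d) * (s - t) ^ d)"
        using True by (subst nn_integral_cmult_indicator) (auto simp: emeasure_norm_less d_def)
      \<comment> \<open>Bounding the radius s - t by s leaves s^d, which reduces s^(-d-2) to the
        weight s^(-2) of the tail condition.\<close>
      also have "\<dots> \<le> g s * ennreal (unit_ball_vol (real d) * s ^ d)"
        using True assms by (intro mult_left_mono ennreal_leI) (auto intro!: power_mono)
      also have "\<dots> = ennreal (\<omega> s * (real (Suc d) / s ^ Suc (Suc d)) * (unit_ball_vol (real d) * s ^ d))"
        using True assms pos[of s] by (simp add: g_def ennreal_mult[symmetric] del: power_Suc)
      also have "\<omega> s * (real (Suc d) / s ^ Suc (Suc d)) * (unit_ball_vol (real d) * s ^ d)
          = (real (Suc d) * unit_ball_vol (real d)) * (\<omega> s / s * (1 / s))"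
        using True assms by (simp add: field_simps)
      also have "ennreal \<dots> = ennreal (real (Suc d) * unit_ball_vol (real d)) * (ennreal (\<omega> s / s * (1 / s)) * indicator {t<..} s)"
        using True assms pos[of s] by (subst ennreal_mult) auto
      finally show ?thesis .
    next
      case False
      then have "indicator {t + norm y<..} s = (0 :: ennreal)" for y :: 'a
        using False add_increasing2[of "norm y" s t] by (simp add: indicator_def not_less)
      then show ?thesis by simp
    qed
  qed
  also have "\<dots> = ennreal (real (Suc d) * unit_ball_vol (real d)) * (\<integral>\<^sup>+s\<in>{t<..}. ennreal (\<omega> s / s * (1 / s)) \<partial>lborel)"
  proof -
    have "(\<lambda>s. ennreal (\<omega> s / s * (1 / s)) * indicator {t<..} s)
       = (\<lambda>s. ennreal (indicator {0<..} s * \<omega> s / s * (1 / s)) * indicator {t<..} s)"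
      using assms by (auto simp: fun_eq_iff split: split_indicator)
    also have "\<dots> \<in> borel_measurable lborel" by measurable
    finally show ?thesis by (rule nn_integral_cmult)
  qed
  also have "\<dots> \<le> ennreal (real (Suc d) * unit_ball_vol (real d)) * ennreal (C * \<omega> t / t)"
  proof (rule mult_left_mono)
    have "(\<integral>\<^sup>+s\<in>{t<..}. ennreal (\<omega> s / s * (1 / s)) \<partial>lborel)
      = ennreal (1 / t) * (ennreal t * (\<integral>\<^sup>+s\<in>{t<..}. ennreal (\<omega> s / s * (1 / s)) \<partial>lborel))"
      using assms by (simp add: mult.assoc[symmetric] ennreal_mult[symmetric])
    also have "\<dots> \<le> ennreal (1 / t) * ennreal (C * \<omega> t)"
      by (intro mult_left_mono tail assms) simp
    also have "\<dots> = ennreal (C * \<omega> t / t)"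
      using assms pos[OF assms] constant_nonneg by (simp add: ennreal_mult[symmetric])
    finally show "(\<integral>\<^sup>+s\<in>{t<..}. ennreal (\<omega> s / s * (1 / s)) \<partial>lborel) \<le> ennreal (C * \<omega> t / t)" .
  qed simp
  also have "\<dots> = ennreal (real (Suc d) * unit_ball_vol (real d) * C * (\<omega> t / t))"
    using assms pos[OF assms] constant_nonneg by (simp add: ennreal_mult[symmetric] mult_ac)
  finally show ?thesis by (simp add: d_def)
qed

end

text \<open>The constant 4 comes from the integral of s^(-5/4) over s > t, which is 4 t^(-1/4); it
  converges because the exponent 3/4 is below 1.\<close>

lemma controlled_growth_powr: "controlled_growth (\<lambda>s. s powr (3/4)) 4"
proof
  show "mono_on {0<..} (\<lambda>s::real. s powr (3/4))"
    by (auto simp: mono_on_def intro!: powr_mono2)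
  fix t :: real assume t: "t > 0"
  then show "t powr (3/4) > 0" by simp
  have "(\<integral>\<^sup>+s\<in>{t<..}. ennreal (s powr (3/4) / s * (1 / s)) \<partial>lborel)
      = (\<integral>\<^sup>+s. ennreal (s powr (- 5/4)) * indicator {t..} s \<partial>lborel)"
  proof (intro nn_integral_cong_AE eventually_mono[OF AE_lborel_singleton[of t]])
    fix s :: real assume "s \<noteq> t"
    have "s powr (3/4) / s * (1 / s) = s powr (- 5/4)" if "s > t"
    proof -
      have "s powr (-5/4) = s powr (3/4 - 1 - 1)" by simp
      also have "\<dots> = s powr (3/4) / s * (1/s)"
        unfolding powr_diff using t that by simp
      finally show ?thesis ..
    qed
    then show "ennreal (s powr (3/4) / s * (1 / s)) * indicator {t<..} s
        = ennreal (s powr (- 5/4)) * indicator {t..} s"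
      using \<open>s \<noteq> t\<close> by (auto split: split_indicator)
  qed
  also have "\<dots> = ennreal (0 - (-4 * t powr (-1/4)))"
  proof (rule nn_integral_FTC_atLeast)
    fix x assume "t \<le> x"
    then have "x > 0" using t by simp
    then show "((\<lambda>s. -4 * s powr (-1/4)) has_real_derivative x powr (- 5/4)) (at x)"
      by (auto intro!: derivative_eq_intros simp: powr_diff[symmetric])
  next
    have "((\<lambda>s::real. s powr (-1/4)) \<longlongrightarrow> 0) at_top"
      by (rule tendsto_neg_powr) (auto simp: filterlim_ident)
    then show "((\<lambda>s::real. -4 * s powr (-1/4)) \<longlongrightarrow> 0) at_top"
      using tendsto_mult_right_zero by fastforce
  qed auto
  finally have "ennreal t * (\<integral>\<^sup>+s\<in>{t<..}. ennreal (s powr (3/4) / s * (1 / s)) \<partial>lborel)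
     = ennreal (t * (4 * t powr (-1/4)))"
    using t by (simp add: ennreal_mult)
  moreover have "t * t powr (-1/4) = t powr (3/4)"
    using powr_add[of t 1 "-1/4"] t by simp
  ultimately show "ennreal t * (\<integral>\<^sup>+s\<in>{t<..}. ennreal (s powr (3/4) / s * (1 / s)) \<partial>lborel)
     \<le> ennreal (4 * t powr (3/4))"
    by (simp add: mult_ac)
qed

section \<open>Bounds for the Poisson kernel\<close>

text \<open>The norm of a matrix as a nested vector is the Frobenius norm: Cauchy-Schwarz is used in
  each row, and the row norms are then combined.\<close>

lemma norm_matrix_vector_mult_le:
  fixes A :: "complex^'n::finite^'m::finite"
  shows "norm (A *v x) \<le> norm A * norm x"
proof -
  have *: "norm ((A *v x) $ i) \<le> norm (A $ i) * norm x" for i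
  proof -
    have "norm ((A *v x) $ i) \<le> (\<Sum>j\<in>UNIV. norm (A $ i $ j) * norm (x $ j))"
      unfolding matrix_vector_mult_def by (simp add: norm_mult[symmetric] norm_sum)
    also have "\<dots> \<le> L2_set (\<lambda>j. norm (A $ i $ j)) UNIV * L2_set (\<lambda>j. norm (x $ j)) UNIV"
      using L2_set_mult_ineq[of "\<lambda>j. norm (A $ i $ j)" "\<lambda>j. norm (x $ j)" UNIV] by simp
    finally show ?thesis by (simp add: norm_vec_def)
  qed
  have "norm (A *v x) \<le> L2_set (\<lambda>i. norm (A $ i) * norm x) UNIV"
    unfolding norm_vec_def[of "A *v x"] using * by (intro L2_set_mono) auto
  also have "\<dots> = norm A * norm x"
    by (simp add: norm_vec_def[of A] L2_set_left_distrib)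
  finally show ?thesis .
qed

lemma bounded_linear_matrix_vector_left:
  "bounded_linear (\<lambda>A :: complex^'n::finite^'m::finite. A *v x)"
  by (rule bounded_linear_intro[where K = "norm x"])
     (simp_all add: matrix_vector_mult_add_rdistrib norm_matrix_vector_mult_le,
      simp add: matrix_vector_mult_def vec_eq_iff scaleR_sum_right)

lemma scaleR_matrix_vector_mult:
  "(c *\<^sub>R A) *v x = c *\<^sub>R ((A :: complex^'n::finite^'m::finite) *v x)"
  by (rule linear_scale[OF bounded_linear.linear[OF bounded_linear_matrix_vector_left]])

lemma continuous_on_matrix_vector_mult [continuous_intros]:
  fixes A :: "'a::topological_space \<Rightarrow> complex^'n::finite^'m::finite"
  assumes "continuous_on S A" "continuous_on S x"
  shows "continuous_on S (\<lambda>z. A z *v x z)"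
  unfolding matrix_vector_mult_def
  by (intro continuous_on_vec_lambda continuous_intros assms)

lemma has_bochner_integral_lborel_affine:
  fixes f :: "'a::euclidean_space \<Rightarrow> 'b::{banach, second_countable_topology}"
  assumes "c \<noteq> 0" "f \<in> borel_measurable borel" "has_bochner_integral lborel (\<lambda>z. f (t + c *\<^sub>R z)) I"
  shows "has_bochner_integral lborel f (\<bar>c\<bar> ^ DIM('a) *\<^sub>R I)"
proof -
  have "has_bochner_integral lborel (\<lambda>z. \<bar>c\<bar> ^ DIM('a) *\<^sub>R f (t + c *\<^sub>R z)) (\<bar>c\<bar> ^ DIM('a) *\<^sub>R I)"
    using assms(3) by (rule has_bochner_integral_scaleR_right)
  then have "has_bochner_integral (distr lborel borel (\<lambda>x. t + c *\<^sub>R x)) (\<lambda>z. \<bar>c\<bar> ^ DIM('a) *\<^sub>R f z) (\<bar>c\<bar> ^ DIM('a) *\<^sub>R I)"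
    by (subst has_bochner_integral_distr) (use assms(2) in auto)
  then have "has_bochner_integral (density (distr lborel borel (\<lambda>x. t + c *\<^sub>R x)) (\<lambda>_. ennreal (\<bar>c\<bar> ^ DIM('a)))) f (\<bar>c\<bar> ^ DIM('a) *\<^sub>R I)"
    by (intro has_bochner_integral_density) (use assms(2) in auto)
  then show ?thesis using lborel_affine[OF assms(1), of t] by simp
qed

lemma nn_integral_lborel_reflect:
  fixes g :: "'a::euclidean_space \<Rightarrow> ennreal"
  assumes "g \<in> borel_measurable borel"
  shows "(\<integral>\<^sup>+y. g (x - y) \<partial>lborel) = (\<integral>\<^sup>+y. g y \<partial>lborel)"
proof -
  have "(\<integral>\<^sup>+y. g y \<partial>lborel)
      = (\<integral>\<^sup>+y. g y \<partial>density (distr lborel borel (\<lambda>y :: 'a. x + (-1) *\<^sub>R y)) (\<lambda>_. ennreal (\<bar>-1\<bar> ^ DIM('a))))"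
    using lborel_affine[of "-1" x] by simp
  also have "\<dots> = (\<integral>\<^sup>+y. g (x - y) \<partial>lborel)"
    using assms by (subst nn_integral_density) (auto simp: nn_integral_distr)
  finally show ?thesis ..
qed

locale poisson_kernel =
  fixes a :: "('a::euclidean_space \<times> real, 'M::finite) system" and P :: "'a \<Rightarrow> complex^'M^'M"
  assumes kernel: "is_poisson_kernel a P"
begin

abbreviation "K \<equiv> kernel_extension P"

lemma mem_interior_punctured:
  fixes x :: "'a \<times> real"
  assumes "x \<in> upper_half_space" "\<epsilon> < norm x"
  shows "x \<in> interior (closure upper_half_space - ball 0 \<epsilon>)"
proof (rule interiorI)
  show "open (upper_half_space - cball (0 :: 'a \<times> real) \<epsilon>)"
    by (intro open_Diff open_upper_half_space closed_cball)
  show "upper_half_space - cball (0 :: 'a \<times> real) \<epsilon> \<subseteq> closure upper_half_space - ball 0 \<epsilon>"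
    using closure_subset by auto
qed (use assms in \<open>auto simp: dist_norm\<close>)

lemma kernel_smooth: "smooth_on upper_half_space K"
  unfolding smooth_on_def
proof (intro allI impI ballI)
  fix es :: "('a \<times> real) list" and x :: "'a \<times> real" assume *: "set es \<subseteq> Basis" "x \<in> upper_half_space"
  then have "x \<noteq> 0" by (auto simp: upper_half_space_def zero_prod_def)
  \<comment> \<open>The removed ball has half the norm of x as radius, so that x is interior to what
    remains.\<close>
  then have "smooth_up_to_boundary (closure upper_half_space - ball 0 (norm x / 2)) K"
    using kernel by (auto simp: is_poisson_kernel_def)
  moreover have "x \<in> interior (closure upper_half_space - ball 0 (norm x / 2))"
    using mem_interior_punctured[OF *(2)] \<open>x \<noteq> 0\<close> by simp
  ultimately show "iterated_partial es K differentiable at x"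
    using * by (auto simp: smooth_up_to_boundary_def smooth_on_def)
qed

lemma kernel_homogeneous: "c > 0 \<Longrightarrow> K (c *\<^sub>R x) = (1 / c ^ DIM('a)) *\<^sub>R K x"
  by (cases x) (simp add: kernel_extension_def kernel_dilate_def power_mult_distrib)

text \<open>By homogeneity it suffices to bound the derivative on the unit half-sphere. Only the
  closed half-sphere is compact, and on its rim the derivative is represented by the continuous
  extension \<open>g\<close>, which is therefore the function that gets bounded. The factor 2^k pays
  for replacing the norm of (y, t) by t + |y|.\<close>

lemma iterated_partial_kernel_bound:
  assumes es: "set es \<subseteq> Basis"
  shows "\<exists>B\<ge>0. \<forall>y t. t > 0 \<longrightarrow> norm (iterated_partial es K (y, t)) \<le> B / (t + norm y) ^ (DIM('a) + length es)"
proof -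
  define E where "E = closure upper_half_space - ball (0 :: 'a \<times> real) (1/2)"
  define k where "k = DIM('a) + length es"
  have "smooth_up_to_boundary E K"
    unfolding E_def using kernel by (auto simp: is_poisson_kernel_def)
  then obtain g where g: "continuous_on E g" "\<forall>x\<in>interior E. g x = iterated_partial es K x"
    using es by (auto simp: smooth_up_to_boundary_def)
  define S where "S = closure upper_half_space \<inter> sphere (0 :: 'a \<times> real) 1"
  have "compact S" unfolding S_def by (intro closed_Int_compact) auto
  moreover have "S \<subseteq> E" by (auto simp: S_def E_def)
  ultimately have "compact (g ` S)"
    using g(1) by (intro compact_continuous_image) (auto intro: continuous_on_subset)
  then obtain B where B: "\<And>x. x \<in> S \<Longrightarrow> norm (g x) \<le> B" "B > 0"
    using compact_imp_bounded bounded_pos by (metis image_eqI)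
  have "norm (iterated_partial es K (y, t)) \<le> (B * 2 ^ k) / (t + norm y) ^ k" if "t > 0" for y t
  proof -
    define x where "x = (y, t)"
    define r where "r = norm x"
    have x: "x \<in> upper_half_space" using that by (simp add: x_def)
    have "r > 0" using that by (auto simp: r_def x_def zero_prod_def)
    define z where "z = (1 / r) *\<^sub>R x"
    have z: "z \<in> upper_half_space" "norm z = 1" "x = r *\<^sub>R z"
      using x \<open>r > 0\<close> by (auto simp: z_def upper_half_space_iff r_def)
    then have "z \<in> S" using closure_subset by (auto simp: S_def)
    have "z \<in> interior E" unfolding E_def using z by (intro mem_interior_punctured) auto
    have "iterated_partial es K x = (1 / r ^ k) *\<^sub>R iterated_partial es K z"
      unfolding z(3) k_def
      by (rule iterated_partial_homogeneous[OF open_upper_half_space kernel_smooth])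
         (use z es \<open>r > 0\<close> in \<open>auto simp: kernel_homogeneous upper_half_space_iff\<close>)
    then have "norm (iterated_partial es K x) = norm (g z) / r ^ k"
      using g(2) \<open>z \<in> interior E\<close> \<open>r > 0\<close> by simp
    also have "\<dots> \<le> B / r ^ k" using B(1)[OF \<open>z \<in> S\<close>] \<open>r > 0\<close> by (simp add: divide_right_mono)
    also have "\<dots> \<le> B / ((t + norm y) / 2) ^ k"
    proof (intro divide_left_mono power_mono mult_pos_pos zero_less_power)
      show "(t + norm y) / 2 \<le> r"
        using norm_fst_le[of y t] norm_snd_le[of t y] that by (simp add: r_def x_def)
    qed (use that \<open>r > 0\<close> B(2) in \<open>auto simp: add_pos_nonneg\<close>)
    finally show ?thesis by (simp add: x_def power_divide)
  qed
  then show ?thesis using B(2) unfolding k_def[symmetric]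
    by (intro exI[of _ "B * 2 ^ k"]) simp
qed

text \<open>Better than homogeneity alone by the factor t / (t + |y|). It comes from the decay of P,
  whose exponent is \<open>DIM('a) + 1\<close>. The extra power makes the kernel integrable against
  \<omega>, and the factor t turns the resulting \<omega>(t)/t into \<omega>(t).\<close>

lemma kernel_bound:
  "\<exists>B\<ge>0. \<forall>y t. t > 0 \<longrightarrow> norm (K (y, t)) \<le> B * t / (t + norm y) ^ Suc DIM('a)"
proof -
  define n where "n = Suc DIM('a)"
  have DIM: "real DIM('a \<times> real) = real n" by (simp add: n_def)
  obtain B where B: "\<And>x. norm (P x) \<le> B * (1 + (norm x)\<^sup>2) powr (- real n / 2)"
    using kernel unfolding is_poisson_kernel_def DIM by blast
  have P: "norm (P x) \<le> \<bar>B\<bar> * 2 ^ n / (1 + norm x) ^ n" for x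
  proof -
    have pos: "0 < 1 + norm x" "1 + norm x \<noteq> 0" using norm_ge_zero[of x] by linarith+
    \<comment> \<open>The exponent -n/2 is negative, so a lower bound for 1 + |x|^2 in terms of 1 +
      |x| is wanted.\<close>
    have "0 \<le> (1 - norm x)\<^sup>2" by simp
    then have "((1 + norm x) / 2)\<^sup>2 \<le> 1 + (norm x)\<^sup>2"
      using zero_le_square[of "norm x"] unfolding power2_eq_square by argo
    then have "(1 + (norm x)\<^sup>2) powr (- real n / 2) \<le> (((1 + norm x) / 2)\<^sup>2) powr (- real n / 2)"
      by (intro powr_mono2') (use pos in auto)
    also have "((1 + norm x) / 2)\<^sup>2 = ((1 + norm x) / 2) powr 2"
      using pos by simp
    also have "\<dots> powr (- real n / 2) = 1 / ((1 + norm x) / 2) ^ n"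
      unfolding powr_powr using pos by (simp add: powr_minus_divide powr_realpow add_pos_nonneg)
    also have "\<dots> = 2 ^ n / (1 + norm x) ^ n" by (simp add: power_divide)
    finally have le: "(1 + (norm x)\<^sup>2) powr (- real n / 2) \<le> 2 ^ n / (1 + norm x) ^ n" .
    have "norm (P x) \<le> \<bar>B\<bar> * (1 + (norm x)\<^sup>2) powr (- real n / 2)"
      by (rule order_trans[OF B mult_right_mono]) auto
    also have "\<dots> \<le> \<bar>B\<bar> * (2 ^ n / (1 + norm x) ^ n)" by (intro mult_left_mono le) simp
    finally show ?thesis by simp
  qed
  have "norm (K (y, t)) \<le> (\<bar>B\<bar> * 2 ^ n) * t / (t + norm y) ^ n" if "t > 0" for y t
  proof -
    have "norm (K (y, t)) = norm (P ((1 / t) *\<^sub>R y)) / t ^ DIM('a)"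
      using that by (simp add: kernel_extension_def kernel_dilate_def)
    also have "\<dots> \<le> \<bar>B\<bar> * 2 ^ n / (1 + norm ((1 / t) *\<^sub>R y)) ^ n / t ^ DIM('a)"
      using that by (intro divide_right_mono P) auto
    also have "(1 + norm ((1 / t) *\<^sub>R y)) = (t + norm y) / t"
      using that by (simp add: field_simps)
    also have "\<bar>B\<bar> * 2 ^ n / ((t + norm y) / t) ^ n / t ^ DIM('a) = (\<bar>B\<bar> * 2 ^ n) * t / (t + norm y) ^ n"
      using that by (simp add: power_divide n_def)
    finally show ?thesis .
  qed
  then show ?thesis unfolding n_def[symmetric] by (intro exI[of _ "\<bar>B\<bar> * 2 ^ n"]) auto
qed

lemma kernel_continuous_slice:
  assumes "set es \<subseteq> Basis" "t > 0"
  shows "continuous_on UNIV (\<lambda>y. iterated_partial es K (x - y, t))"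
proof -
  have "continuous_on upper_half_space (iterated_partial es K)"
    by (intro smooth_on_continuous_on smooth_on_iterated_partial kernel_smooth assms)
  then show ?thesis
    by (rule continuous_on_compose2) (use assms in \<open>auto intro!: continuous_intros\<close>)
qed

lemma has_bochner_integral_kernel:
  assumes "t > 0"
  shows "has_bochner_integral lborel (\<lambda>y. K (x - y, t)) (mat 1)"
proof -
  have "has_bochner_integral lborel (\<lambda>y. K (x - y, t)) (\<bar>-t\<bar> ^ DIM('a) *\<^sub>R (1 / t ^ DIM('a)) *\<^sub>R mat 1)"
  proof (rule has_bochner_integral_lborel_affine)
    show "(\<lambda>y. K (x - y, t)) \<in> borel_measurable borel"
      using kernel_continuous_slice[of "[]", OF _ assms] by (intro borel_measurable_continuous_onI) simp
    \<comment> \<open>The substitution y = x - t z turns the slice into P up to a power of t, which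
      the Jacobian cancels.\<close>
    have "K (x - (x + (- t) *\<^sub>R z), t) = (1 / t ^ DIM('a)) *\<^sub>R P z" for z
      using assms by (simp add: kernel_extension_def kernel_dilate_def)
    then show "has_bochner_integral lborel (\<lambda>z. K (x - (x + (- t) *\<^sub>R z), t)) ((1 / t ^ DIM('a)) *\<^sub>R mat 1)"
      using kernel by (simp only: is_poisson_kernel_def) (intro has_bochner_integral_scaleR_right, auto)
  qed (use assms in simp)
  then show ?thesis using assms by simp
qed

end

section \<open>Differentiation under the Poisson integral\<close>

lemma norm_fst_le_norm: "norm (fst v) \<le> norm v"
  using norm_fst_le[of "fst v" "snd v"] by simp

lemma norm_snd_le_norm: "norm (snd v) \<le> norm v"
  using norm_snd_le[of "snd v" "fst v"] by simp

context controlled_growth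
begin

text \<open>The constant of \<open>nn_integral_shifted_le\<close>; d is going to be
  \<open>DIM('a)\<close>.\<close>

definition "tail_const d = real (Suc d) * unit_ball_vol (real d) * C"

lemma tail_const_nonneg: "0 \<le> tail_const d"
  using constant_nonneg by (simp add: tail_const_def)

text \<open>The weight is the product of the growth allowed for the data and the decay of the
  kernel. It dominates the convolution integrals below, and the value of its integral determines the
  size of the Poisson estimates.\<close>

lemma weight_integral:
  fixes x :: "'a::euclidean_space"
  assumes "T > 0"
  defines "W \<equiv> \<lambda>y. \<omega> (T + norm (x - y)) / (T + norm (x - y)) ^ Suc DIM('a)"
  shows "integrable lborel W" and "integral\<^sup>L lborel W \<le> tail_const DIM('a) * (\<omega> T / T)"
proof -
  have m: "(\<lambda>y :: 'a. \<omega> (T + norm y) / (T + norm y) ^ Suc DIM('a)) \<in> borel_measurable borel"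
    by (intro borel_measurable_divide borel_measurable_shifted assms(1) borel_measurable_continuous_onI continuous_intros)
  have meas: "W \<in> borel_measurable lborel" unfolding W_def
    by (rule measurable_compose[OF _ m]) simp
  have nonneg: "0 \<le> W y" for y
    unfolding W_def using assms(1) pos[of "T + norm (x - y)"] by (simp add: add_pos_nonneg)
  have "(\<integral>\<^sup>+y. ennreal (W y) \<partial>lborel)
      = (\<integral>\<^sup>+y. ennreal (\<omega> (T + norm y) / (T + norm y) ^ Suc DIM('a)) \<partial>(lborel :: 'a measure))"
    unfolding W_def
    by (rule nn_integral_lborel_reflect[of "\<lambda>y. ennreal (\<omega> (T + norm y) / (T + norm y) ^ Suc DIM('a))"])
       (rule measurable_compose[OF m measurable_ennreal])
  also have "\<dots> \<le> ennreal (tail_const DIM('a) * (\<omega> T / T))"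
    unfolding tail_const_def by (rule nn_integral_shifted_le[OF assms(1)])
  finally have le: "(\<integral>\<^sup>+y. ennreal (W y) \<partial>lborel) \<le> ennreal (tail_const DIM('a) * (\<omega> T / T))" .
  show int: "integrable lborel W"
    by (rule integrableI_nonneg[OF meas]) (use nonneg le le_less_trans[OF le] in auto)
  have "ennreal (integral\<^sup>L lborel W) \<le> ennreal (tail_const DIM('a) * (\<omega> T / T))"
    using le nn_integral_eq_integral[OF int] nonneg by simp
  then show "integral\<^sup>L lborel W \<le> tail_const DIM('a) * (\<omega> T / T)"
    using tail_const_nonneg pos[OF assms(1)] assms(1) by (subst (asm) ennreal_le_iff) auto
qed

lemma dominated_product:
  fixes x :: "'a::euclidean_space" and f :: "'a \<Rightarrow> 'b::real_normed_vector"
  assumes "t > 0" "\<And>y. norm (f y) \<le> B * \<omega> (1 + norm y)"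
  shows "\<exists>W. integrable lborel W \<and> (\<forall>y. norm (f y) / (t + norm (x - y)) ^ Suc DIM('a) \<le> W y)"
proof -
  \<comment> \<open>This T satisfies 1 + |y| <= T + |x - y|, which recentres the growth of f at x;
    and since T >= t, replacing t by T in the denominator costs at most a power of T / t.\<close>
  define T where "T = 1 + norm x + t"
  have T: "T > 0" "T \<ge> t" using assms(1) norm_ge_zero[of x] unfolding T_def by linarith+
  define c where "c = \<bar>B\<bar> * (T / t) ^ Suc DIM('a)"
  have "norm (f y) / (t + norm (x - y)) ^ Suc DIM('a)
      \<le> c * (\<omega> (T + norm (x - y)) / (T + norm (x - y)) ^ Suc DIM('a))" for y
  proof -
    have le: "1 + norm y \<le> T + norm (x - y)"
      unfolding T_def using norm_triangle_ineq2[of y x] assms(1) by (simp add: norm_minus_commute)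
    have p: "0 < t + norm (x - y)" "0 < T + norm (x - y)"
      using assms(1) T norm_ge_zero[of "x - y"] by linarith+
    have "norm (f y) \<le> \<bar>B\<bar> * \<omega> (1 + norm y)"
      using pos[of "1 + norm y"] by (intro order_trans[OF assms(2)] mult_right_mono) (auto simp: add_pos_nonneg less_imp_le)
    also have "\<dots> \<le> \<bar>B\<bar> * \<omega> (T + norm (x - y))"
      by (intro mult_left_mono monoD le) (auto simp: add_pos_nonneg)
    finally have 1: "norm (f y) \<le> \<bar>B\<bar> * \<omega> (T + norm (x - y))" .
    have "t * norm (x - y) \<le> T * norm (x - y)" using T by (intro mult_right_mono) auto
    then have "(T + norm (x - y)) / (T / t) \<le> t + norm (x - y)"
      using T assms(1) by (simp add: field_simps)
    then have "((T + norm (x - y)) / (T / t)) ^ Suc DIM('a) \<le> (t + norm (x - y)) ^ Suc DIM('a)"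
      using p T assms(1) by (intro power_mono) auto
    then have "norm (f y) / (t + norm (x - y)) ^ Suc DIM('a)
       \<le> \<bar>B\<bar> * \<omega> (T + norm (x - y)) / ((T + norm (x - y)) / (T / t)) ^ Suc DIM('a)"
      using 1 p T assms(1) by (intro frac_le) (auto intro!: zero_less_power divide_pos_pos order_trans[OF norm_ge_zero 1])
    also have "\<dots> = c * (\<omega> (T + norm (x - y)) / (T + norm (x - y)) ^ Suc DIM('a))"
      unfolding c_def power_divide by (simp del: power_Suc add: mult_ac)
    finally show ?thesis .
  qed
  moreover have "integrable lborel (\<lambda>y. c * (\<omega> (T + norm (x - y)) / (T + norm (x - y)) ^ Suc DIM('a)))"
    by (intro integrable_mult_right weight_integral T)
  ultimately show ?thesis by blast
qed

lemma integrable_kernel_mult: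
  fixes x :: "'a::euclidean_space" and f :: "'a \<Rightarrow> complex^'n::finite" and k :: "'a \<Rightarrow> complex^'n^'m::finite"
  assumes "t > 0" "continuous_on UNIV f" "\<And>y. norm (f y) \<le> B * \<omega> (1 + norm y)"
    and "continuous_on UNIV k" "\<And>y. norm (k y) \<le> D / (t + norm (x - y)) ^ Suc DIM('a)"
  shows "integrable lborel (\<lambda>y. k y *v f y)"
proof -
  obtain W where W: "integrable lborel W" "\<And>y. norm (f y) / (t + norm (x - y)) ^ Suc DIM('a) \<le> W y"
    using dominated_product[OF assms(1,3), of x] by blast
  have "integrable lborel (\<lambda>y. \<bar>D\<bar> * W y)" using W(1) by simp
  then show ?thesis
  proof (rule Bochner_Integration.integrable_bound)
    show "(\<lambda>y. k y *v f y) \<in> borel_measurable lborel"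
      using assms by (simp, intro borel_measurable_continuous_onI continuous_on_matrix_vector_mult)
    show "AE y in lborel. norm (k y *v f y) \<le> norm (\<bar>D\<bar> * W y)"
    proof (rule AE_I2)
      fix y
      have p: "0 < t + norm (x - y)" using assms(1) norm_ge_zero[of "x - y"] by linarith
      have "norm (k y *v f y) \<le> norm (k y) * norm (f y)" by (rule norm_matrix_vector_mult_le)
      also have "\<dots> \<le> \<bar>D\<bar> / (t + norm (x - y)) ^ Suc DIM('a) * norm (f y)"
        using p by (intro mult_right_mono order_trans[OF assms(5)] divide_right_mono) auto
      also have "\<dots> = \<bar>D\<bar> * (norm (f y) / (t + norm (x - y)) ^ Suc DIM('a))" by simp
      also have "\<dots> \<le> \<bar>D\<bar> * W y" using W(2)[of y] by (intro mult_left_mono) auto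
      finally show "norm (k y *v f y) \<le> norm (\<bar>D\<bar> * W y)" by simp
    qed
  qed
qed

text \<open>Dominated convergence is applied to the Frechet remainder divided by |h|. Integrating k
  itself requires decay on single slices (\<open>k0\<close>), whereas the remainder is estimated by
  the mean value inequality on a ball, so the bound on the derivatives has to be uniform over
  heights t >= \<tau> (\<open>k1\<close>).\<close>

lemma has_derivative_kernel_integral:
  fixes k :: "'a::euclidean_space \<times> real \<Rightarrow> complex^'n::finite^'m::finite" and f :: "'a \<Rightarrow> complex^'n"
  assumes k: "smooth_on upper_half_space k"
    and k0: "\<And>t. t > 0 \<Longrightarrow> \<exists>D. \<forall>y. norm (k (y, t)) \<le> D / (t + norm y) ^ Suc DIM('a)"
    and k1: "\<And>b \<tau>. b \<in> Basis \<Longrightarrow> \<tau> > 0 \<Longrightarrow>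
      \<exists>D. \<forall>y t. \<tau> \<le> t \<longrightarrow> norm (partial_deriv b k (y, t)) \<le> D / (t + norm y) ^ Suc DIM('a)"
    and f: "continuous_on UNIV f" "\<And>y. norm (f y) \<le> B * \<omega> (1 + norm y)"
    and x: "x \<in> upper_half_space"
  shows "((\<lambda>z. \<integral>y. k (fst z - y, snd z) *v f y \<partial>lborel) has_derivative
     (\<lambda>h. \<Sum>b\<in>Basis. (h \<bullet> b) *\<^sub>R (\<integral>y. partial_deriv b k (fst x - y, snd x) *v f y \<partial>lborel))) (at x)"
proof -
  define t where "t = snd x"
  have t: "t > 0" using x by (simp add: t_def upper_half_space_iff)
  define n where "n = Suc DIM('a)"
  define p where "p y = (fst x - y, snd x)" for y
  have shift: "(fst (x + h) - y, snd (x + h)) = p y + h" for h y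
    by (simp add: p_def prod_eq_iff)
  have p_mem: "p y \<in> upper_half_space" for y using t by (simp add: p_def t_def)
  have kc: "continuous_on upper_half_space k" by (rule smooth_on_continuous_on[OF k])
  have kbc: "continuous_on upper_half_space (partial_deriv b k)" if "b \<in> Basis" for b
    by (rule smooth_on_continuous_on[OF smooth_on_partial_deriv[OF k that]])
  have "\<forall>b\<in>Basis. \<exists>D. \<forall>y s. t / 2 \<le> s \<longrightarrow> norm (partial_deriv b k (y, s)) \<le> D / (s + norm y) ^ n"
    unfolding n_def by (intro ballI k1) (use t in simp_all)
  from bchoice[OF this] obtain D' where D': "\<And>b y s. b \<in> Basis \<Longrightarrow> t / 2 \<le> s \<Longrightarrow> norm (partial_deriv b k (y, s)) \<le> D' b / (s + norm y) ^ n"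
    by blast
  define D where "D = (\<Sum>b\<in>Basis. \<bar>D' b\<bar>)"
  have "D \<ge> 0" by (simp add: D_def sum_nonneg)
  have D: "norm (partial_deriv b k (y, s)) \<le> D / (s + norm y) ^ n" if "b \<in> Basis" "t / 2 \<le> s" for b y s
  proof -
    have "D' b \<le> D" unfolding D_def
      using member_le_sum[of b Basis "\<lambda>b. \<bar>D' b\<bar>"] that by simp
    moreover have "0 < s + norm y" using that t norm_ge_zero[of y] by linarith
    ultimately show ?thesis
      by (intro order_trans[OF D'[OF that]] divide_right_mono) auto
  qed
  obtain W where W: "integrable lborel W" "\<And>y. norm (f y) / (t + norm (fst x - y)) ^ n \<le> W y"
    using dominated_product[OF t f(2), of "fst x"] unfolding n_def by blast
  define N where "N = real DIM('a \<times> real)"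
  define r where "r h y = k (p y + h) - k (p y) - (\<Sum>b\<in>Basis. (h \<bullet> b) *\<^sub>R partial_deriv b k (p y))" for h y
  \<comment> \<open>The first summand bounds the increment, the second its linear part. In the ball
    of radius t/2 around \<open>p y\<close> height plus tangential norm is at least (t + |fst x -
    y|) / 4, which is the origin of 4^n.\<close>
  define c where "c = N * D * 4 ^ n + N * D"
  have r_bound: "norm (r h y) \<le> c / (t + norm (fst x - y)) ^ n * norm h" if h: "norm h < t / 2" for h y
  proof -
    define \<rho> where "\<rho> = norm (fst x - y)"
    have "\<rho> \<ge> 0" by (simp add: \<rho>_def)
    have "norm (k (p y + h) - k (p y)) \<le> N * (D / ((t + \<rho>) / 4) ^ n) * norm ((p y + h) - p y)"
      unfolding N_def
    proof (rule mean_value_partial[where S = "ball (p y) (t / 2)"])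
      fix z assume "z \<in> ball (p y) (t / 2)"
      then have z: "norm (z - p y) < t / 2" by (simp add: dist_norm norm_minus_commute)
      have "norm (fst (z - p y)) < t / 2" "norm (snd (z - p y)) < t / 2"
        by (rule le_less_trans[OF norm_fst_le_norm z] le_less_trans[OF norm_snd_le_norm z])+
      then have 1: "norm (fst z - (fst x - y)) < t / 2" and 2: "\<bar>snd z - t\<bar> < t / 2"
        by (simp_all add: p_def t_def)
      from 2 have s: "t / 2 < snd z" by linarith
      have fz: "\<rho> - t / 2 < norm (fst z)"
        using 1 norm_triangle_ineq2[of "fst x - y" "fst z"] unfolding \<rho>_def
          norm_minus_commute[of "fst x - y" "fst z"] by linarith
      show "k differentiable at z"
        by (rule smooth_on_differentiable[OF k]) (use s t in \<open>simp add: upper_half_space_iff\<close>)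
      fix b :: "'a \<times> real" assume b: "b \<in> Basis"
      have "t / 2 \<le> snd z + norm (fst z)" using s norm_ge_zero[of "fst z"] by linarith
      moreover have "\<rho> \<le> snd z + norm (fst z)" using s fz by linarith
      ultimately have le: "(t + \<rho>) / 4 \<le> snd z + norm (fst z)" using \<open>\<rho> \<ge> 0\<close> by argo
      have "norm (partial_deriv b k z) \<le> D / (snd z + norm (fst z)) ^ n"
        using D[OF b, of "snd z" "fst z"] s by simp
      also have "D / (snd z + norm (fst z)) ^ n \<le> D / ((t + \<rho>) / 4) ^ n"
        using le t \<open>\<rho> \<ge> 0\<close> \<open>D \<ge> 0\<close> s norm_ge_zero[of "fst z"]
        by (intro divide_left_mono power_mono mult_pos_pos zero_less_power) auto
      finally show "norm (partial_deriv b k z) \<le> D / ((t + \<rho>) / 4) ^ n" .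
    qed (use h t in \<open>auto simp: dist_norm\<close>)
    then have 1: "norm (k (p y + h) - k (p y)) \<le> N * D * 4 ^ n / (t + \<rho>) ^ n * norm h"
      by (simp add: power_divide)
    have "norm (\<Sum>b\<in>Basis. (h \<bullet> b) *\<^sub>R partial_deriv b k (p y)) \<le> (\<Sum>b\<in>(Basis :: ('a \<times> real) set). norm h * (D / (t + \<rho>) ^ n))"
    proof (rule order_trans[OF norm_sum sum_mono])
      fix b :: "'a \<times> real" assume b: "b \<in> Basis"
      show "norm ((h \<bullet> b) *\<^sub>R partial_deriv b k (p y)) \<le> norm h * (D / (t + \<rho>) ^ n)"
        unfolding norm_scaleR real_norm_def
        using Basis_le_norm[OF b, of h] D[OF b, of t "fst x - y"] t
        by (intro mult_mono) (auto simp: p_def t_def \<rho>_def)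
    qed
    then have 2: "norm (\<Sum>b\<in>Basis. (h \<bullet> b) *\<^sub>R partial_deriv b k (p y)) \<le> N * D / (t + \<rho>) ^ n * norm h"
      by (simp add: N_def mult_ac)
    have "norm (r h y) \<le> N * D * 4 ^ n / (t + \<rho>) ^ n * norm h + N * D / (t + \<rho>) ^ n * norm h"
      unfolding r_def by (rule order_trans[OF norm_triangle_ineq4 add_mono[OF 1 2]])
    then show ?thesis by (simp add: c_def \<rho>_def add_divide_distrib distrib_right)
  qed
  have int_k: "integrable lborel (\<lambda>y. k (p y + h) *v f y)" if "norm h < t / 2" for h
  proof -
    have s: "snd (x + h) > 0"
      using that norm_snd_le[of "snd h" "fst h"] t by (auto simp: t_def)
    obtain E where E: "\<And>y. norm (k (y, snd (x + h))) \<le> E / (snd (x + h) + norm y) ^ Suc DIM('a)"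
      using k0[OF s] by blast
    have "continuous_on UNIV (\<lambda>y. k (fst (x + h) - y, snd (x + h)))"
      by (rule continuous_on_compose2[OF kc]) (use s in \<open>auto intro!: continuous_intros\<close>)
    from integrable_kernel_mult[OF s f this E] show ?thesis unfolding shift .
  qed
  have int_kb: "integrable lborel (\<lambda>y. partial_deriv b k (p y) *v f y)" if b: "b \<in> Basis" for b
  proof -
    have "continuous_on UNIV (\<lambda>y. partial_deriv b k (p y))"
      by (rule continuous_on_compose2[OF kbc[OF b]]) (use p_mem in \<open>auto simp: p_def intro!: continuous_intros\<close>)
    from integrable_kernel_mult[OF t f this, of D "fst x"] D[OF b, of t] t show ?thesis
      by (auto simp: p_def t_def n_def)
  qed
  have int_sum: "integrable lborel (\<lambda>y. (\<Sum>b\<in>Basis. (h \<bullet> b) *\<^sub>R partial_deriv b k (p y)) *v f y)"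
    and integral_sum: "(\<integral>y. (\<Sum>b\<in>Basis. (h \<bullet> b) *\<^sub>R partial_deriv b k (p y)) *v f y \<partial>lborel)
      = (\<Sum>b\<in>Basis. (h \<bullet> b) *\<^sub>R (\<integral>y. partial_deriv b k (p y) *v f y \<partial>lborel))" for h
  proof -
    have eq: "(\<Sum>b\<in>Basis. (h \<bullet> b) *\<^sub>R partial_deriv b k (p y)) *v f y
      = (\<Sum>b\<in>Basis. (h \<bullet> b) *\<^sub>R (partial_deriv b k (p y) *v f y))" for y
      by (simp add: linear_sum[OF bounded_linear.linear[OF bounded_linear_matrix_vector_left]]
          scaleR_matrix_vector_mult)
    show "integrable lborel (\<lambda>y. (\<Sum>b\<in>Basis. (h \<bullet> b) *\<^sub>R partial_deriv b k (p y)) *v f y)"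
      unfolding eq by (intro Bochner_Integration.integrable_sum integrable_scaleR_right int_kb)
    show "(\<integral>y. (\<Sum>b\<in>Basis. (h \<bullet> b) *\<^sub>R partial_deriv b k (p y)) *v f y \<partial>lborel)
      = (\<Sum>b\<in>Basis. (h \<bullet> b) *\<^sub>R (\<integral>y. partial_deriv b k (p y) *v f y \<partial>lborel))"
      unfolding eq
      by (subst Bochner_Integration.integral_sum) (auto intro!: integrable_scaleR_right int_kb)
  qed
  have r_eq: "r h y *v f y = k (p y + h) *v f y - k (p y) *v f y
      - (\<Sum>b\<in>Basis. (h \<bullet> b) *\<^sub>R partial_deriv b k (p y)) *v f y" for h y
    by (simp add: r_def matrix_vector_mult_diff_rdistrib)
  have int_r: "integrable lborel (\<lambda>y. r h y *v f y)" if "norm h < t / 2" for h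
    unfolding r_eq using int_k[OF that] int_k[of 0] t
    by (intro Bochner_Integration.integrable_diff int_sum) auto
  have integral_r: "(\<integral>y. r h y *v f y \<partial>lborel) = (\<integral>y. k (p y + h) *v f y \<partial>lborel) - (\<integral>y. k (p y) *v f y \<partial>lborel)
      - (\<Sum>b\<in>Basis. (h \<bullet> b) *\<^sub>R (\<integral>y. partial_deriv b k (p y) *v f y \<partial>lborel))" if "norm h < t / 2" for h
    unfolding r_eq using int_k[OF that] int_k[of 0] t int_sum[of h]
    by (simp add: integral_sum)
  \<comment> \<open>The limit is taken inside the ball where \<open>r_bound\<close> holds, and along
    sequences so that dominated convergence applies; \<open>at_within_open\<close> removes the
    restriction afterwards.\<close>
  have "((\<lambda>h. norm (\<integral>y. r h y *v f y \<partial>lborel) / norm h) \<longlongrightarrow> 0) (at 0 within ball 0 (t / 2))"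
    unfolding tendsto_at_iff_sequentially
  proof (intro allI impI)
    fix X :: "nat \<Rightarrow> 'a \<times> real"
    assume X: "\<forall>i. X i \<in> ball 0 (t / 2) - {0}" and lim: "X \<longlonglongrightarrow> 0"
    have Xn: "norm (X i) < t / 2" "X i \<noteq> 0" for i using X by auto
    have "(\<lambda>i. \<integral>y. norm (r (X i) y *v f y) / norm (X i) \<partial>lborel) \<longlonglongrightarrow> (\<integral>y. 0 \<partial>(lborel :: 'a measure))"
    proof (rule integral_dominated_convergence[where w = "\<lambda>y. \<bar>c\<bar> * W y"])
      show "AE y in lborel. (\<lambda>i. norm (r (X i) y *v f y) / norm (X i)) \<longlonglongrightarrow> 0"
      proof (rule AE_I2)
        fix y
        have "(k has_derivative (\<lambda>h. \<Sum>b\<in>Basis. (h \<bullet> b) *\<^sub>R partial_deriv b k (p y))) (at (p y))"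
          by (rule has_derivative_sum_partial[OF smooth_on_differentiable[OF k p_mem]])
        then have "((\<lambda>h. norm (r h y) / norm h) \<longlongrightarrow> 0) (at 0)"
          unfolding has_derivative_at r_def by simp
        then have "(\<lambda>i. norm (r (X i) y) / norm (X i)) \<longlonglongrightarrow> 0"
          using lim Xn unfolding tendsto_at_iff_sequentially comp_def by blast
        then have *: "(\<lambda>i. norm (r (X i) y) / norm (X i) * norm (f y)) \<longlonglongrightarrow> 0"
          by (rule tendsto_mult_left_zero)
        show "(\<lambda>i. norm (r (X i) y *v f y) / norm (X i)) \<longlonglongrightarrow> 0"
        proof (rule Lim_null_comparison[OF always_eventually *], rule allI)
          fix i
          show "norm (norm (r (X i) y *v f y) / norm (X i)) \<le> norm (r (X i) y) / norm (X i) * norm (f y)"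
            using norm_matrix_vector_mult_le[of "r (X i) y" "f y"] by (simp add: divide_right_mono)
        qed
      qed
      show "AE y in lborel. norm (norm (r (X i) y *v f y) / norm (X i)) \<le> \<bar>c\<bar> * W y" for i
      proof (rule AE_I2)
        fix y
        have q: "0 < t + norm (fst x - y)" using t norm_ge_zero[of "fst x - y"] by linarith
        have "norm (r (X i) y *v f y) \<le> norm (r (X i) y) * norm (f y)" by (rule norm_matrix_vector_mult_le)
        also have "\<dots> \<le> (c / (t + norm (fst x - y)) ^ n * norm (X i)) * norm (f y)"
          by (intro mult_right_mono r_bound Xn) auto
        also have "\<dots> \<le> (\<bar>c\<bar> / (t + norm (fst x - y)) ^ n * norm (X i)) * norm (f y)"
          using q by (intro mult_right_mono divide_right_mono) auto
        finally have "norm (r (X i) y *v f y) / norm (X i) \<le> \<bar>c\<bar> * (norm (f y) / (t + norm (fst x - y)) ^ n)"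
          using Xn(2)[of i] by (simp add: field_simps)
        also have "\<dots> \<le> \<bar>c\<bar> * W y" by (intro mult_left_mono W) simp
        finally show "norm (norm (r (X i) y *v f y) / norm (X i)) \<le> \<bar>c\<bar> * W y" by simp
      qed
      show "(\<lambda>y. norm (r (X i) y *v f y) / norm (X i)) \<in> borel_measurable lborel" for i
        using borel_measurable_integrable[OF int_r[OF Xn(1)[of i]]] by measurable
      show "integrable lborel (\<lambda>y. \<bar>c\<bar> * W y)" using W(1) by simp
    qed simp
    then have lim': "(\<lambda>i. \<integral>y. norm (r (X i) y *v f y) / norm (X i) \<partial>lborel) \<longlonglongrightarrow> 0" by simp
    show "((\<lambda>h. norm (\<integral>y. r h y *v f y \<partial>lborel) / norm h) \<circ> X) \<longlonglongrightarrow> 0"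
    proof (rule Lim_null_comparison[OF always_eventually lim'], rule allI)
      fix i
      have "norm (\<integral>y. r (X i) y *v f y \<partial>lborel) \<le> (\<integral>y. norm (r (X i) y *v f y) \<partial>lborel)"
        by (rule integral_norm_bound)
      then show "norm (((\<lambda>h. norm (\<integral>y. r h y *v f y \<partial>lborel) / norm h) \<circ> X) i)
          \<le> (\<integral>y. norm (r (X i) y *v f y) / norm (X i) \<partial>lborel)"
        by (simp add: divide_right_mono)
    qed
  qed
  then have "((\<lambda>h. norm (\<integral>y. r h y *v f y \<partial>lborel) / norm h) \<longlongrightarrow> 0) (at 0)"
    using t by (subst (asm) at_within_open) auto
  moreover have "\<forall>\<^sub>F h in at 0. norm (\<integral>y. r h y *v f y \<partial>lborel) / norm h
     = norm ((\<integral>y. k (p y + h) *v f y \<partial>lborel) - (\<integral>y. k (p y) *v f y \<partial>lborel)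
        - (\<Sum>b\<in>Basis. (h \<bullet> b) *\<^sub>R (\<integral>y. partial_deriv b k (p y) *v f y \<partial>lborel))) / norm h"
    unfolding eventually_at
    by (rule exI[of _ "t / 2"]) (use t in \<open>auto simp: integral_r dist_norm\<close>)
  ultimately have "((\<lambda>h. norm ((\<integral>y. k (p y + h) *v f y \<partial>lborel) - (\<integral>y. k (p y) *v f y \<partial>lborel)
        - (\<Sum>b\<in>Basis. (h \<bullet> b) *\<^sub>R (\<integral>y. partial_deriv b k (p y) *v f y \<partial>lborel))) / norm h) \<longlongrightarrow> 0) (at 0)"
    by (rule Lim_transform_eventually)
  moreover have "bounded_linear (\<lambda>h. \<Sum>b\<in>Basis. (h \<bullet> b) *\<^sub>R (\<integral>y. partial_deriv b k (p y) *v f y \<partial>lborel))"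
    by (intro bounded_linear_sum bounded_linear_scaleR_const bounded_linear_inner_left)
  ultimately show ?thesis unfolding has_derivative_at shift p_def[symmetric] by blast
qed

end

section \<open>Poisson integrals of Hoelder continuous data\<close>

lemma column_linear: "bounded_linear (column j :: complex^'n::finite^'m::finite \<Rightarrow> complex^'m)"
  unfolding linear_conv_bounded_linear[symmetric] by (rule linearI) (simp_all add: column_def vec_eq_iff)

definition poisson_integral ::
    "('a::euclidean_space \<Rightarrow> complex^'M::finite^'M) \<Rightarrow> ('a \<Rightarrow> complex^'M) \<Rightarrow> 'a \<times> real \<Rightarrow> complex^'M" where
  "poisson_integral P f x = matrix_convolution (kernel_dilate P (snd x)) f (fst x)"

lemma poisson_integral_eq:
  "poisson_integral P f x = (\<integral>y. kernel_extension P (fst x - y, snd x) *v f y \<partial>lborel)"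
  by (simp add: poisson_integral_def matrix_convolution_def kernel_extension_def)

lemma divide_power_add_le:
  fixes B s \<tau> :: real
  assumes "0 < \<tau>" "\<tau> \<le> s" "0 \<le> B"
  shows "B / s ^ (n + m) \<le> (B / \<tau> ^ m) / s ^ n"
proof -
  have "B / s ^ (n + m) = B / s ^ m / s ^ n" by (simp add: power_add)
  also have "\<dots> \<le> (B / \<tau> ^ m) / s ^ n"
    using assms by (intro divide_right_mono divide_left_mono power_mono mult_pos_pos zero_less_power) auto
  finally show ?thesis .
qed

locale holder_poisson = poisson_kernel a P + controlled_growth \<omega> C
  for a :: "('a::euclidean_space \<times> real, 'M::finite) system" and P \<omega> C
begin

text \<open>Homogeneity gives the exponent \<open>DIM('a) + length es\<close>, which is large enough
  as soon as one derivative is taken. For the kernel itself the missing power is supplied by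
  \<open>kernel_bound\<close>.\<close>

lemma kernel_decay_slice:
  assumes "set es \<subseteq> Basis" "t > 0"
  shows "\<exists>D. \<forall>y. norm (iterated_partial es K (y, t)) \<le> D / (t + norm y) ^ Suc DIM('a)"
proof (cases es)
  case Nil
  obtain B where "\<forall>y t. t > 0 \<longrightarrow> norm (K (y, t)) \<le> B * t / (t + norm y) ^ Suc DIM('a)"
    using kernel_bound by blast
  then show ?thesis using assms Nil by (intro exI[of _ "B * t"]) simp
next
  case (Cons b bs)
  obtain B where B: "B \<ge> 0" "\<forall>y t. t > 0 \<longrightarrow> norm (iterated_partial es K (y, t)) \<le> B / (t + norm y) ^ (DIM('a) + length es)"
    using iterated_partial_kernel_bound[OF assms(1)] by blast
  have "norm (iterated_partial es K (y, t)) \<le> (B / t ^ length bs) / (t + norm y) ^ Suc DIM('a)" for y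
    using divide_power_add_le[of t "t + norm y" B "Suc DIM('a)" "length bs"] B assms(2) Cons
    by (auto intro: order_trans simp del: iterated_partial_Cons)
  then show ?thesis by blast
qed

lemma kernel_decay_partial:
  assumes "set es \<subseteq> Basis" "b \<in> Basis" "\<tau> > 0"
  shows "\<exists>D. \<forall>y t. \<tau> \<le> t \<longrightarrow> norm (partial_deriv b (iterated_partial es K) (y, t)) \<le> D / (t + norm y) ^ Suc DIM('a)"
proof -
  obtain B where B: "B \<ge> 0" "\<forall>y t. t > 0 \<longrightarrow> norm (iterated_partial (b # es) K (y, t)) \<le> B / (t + norm y) ^ (DIM('a) + length (b # es))"
    using iterated_partial_kernel_bound[of "b # es"] assms by auto
  have "norm (iterated_partial (b # es) K (y, t)) \<le> (B / \<tau> ^ length es) / (t + norm y) ^ Suc DIM('a)"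
    if "\<tau> \<le> t" for y t
  proof -
    have "norm (iterated_partial (b # es) K (y, t)) \<le> B / (t + norm y) ^ (Suc DIM('a) + length es)"
      using B(2) that assms(3) by (simp del: iterated_partial_Cons)
    also have "\<dots> \<le> (B / \<tau> ^ length es) / (t + norm y) ^ Suc DIM('a)"
      by (rule divide_power_add_le) (use that assms(3) B(1) in \<open>auto intro: add_increasing2\<close>)
    finally show ?thesis .
  qed
  then show ?thesis unfolding iterated_partial_Cons by blast
qed

section \<open>Poisson integrals of continuous data growing no faster than \<omega>\<close>

context
  fixes f :: "'a \<Rightarrow> complex^'M" and B :: real
  assumes f: "continuous_on UNIV f" "\<And>y. norm (f y) \<le> B * \<omega> (1 + norm y)"
begin

lemma integrable_kernel_partial:
  assumes "set es \<subseteq> Basis" "t > 0"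
  shows "integrable lborel (\<lambda>y. iterated_partial es K (x - y, t) *v f y)"
proof -
  obtain D where "\<And>y. norm (iterated_partial es K (y, t)) \<le> D / (t + norm y) ^ Suc DIM('a)"
    using kernel_decay_slice[OF assms] by blast
  then show ?thesis
    by (intro integrable_kernel_mult[OF assms(2) f kernel_continuous_slice[OF assms], where D = D and x = x])
qed

lemma has_derivative_kernel_partial:
  assumes "set es \<subseteq> Basis" "x \<in> upper_half_space"
  shows "((\<lambda>z. \<integral>y. iterated_partial es K (fst z - y, snd z) *v f y \<partial>lborel) has_derivative
     (\<lambda>h. \<Sum>b\<in>Basis. (h \<bullet> b) *\<^sub>R (\<integral>y. iterated_partial (b # es) K (fst x - y, snd x) *v f y \<partial>lborel))) (at x)"
  unfolding iterated_partial_Cons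
  by (rule has_derivative_kernel_integral[OF smooth_on_iterated_partial[OF kernel_smooth assms(1)]
      kernel_decay_slice[OF assms(1)] kernel_decay_partial[OF assms(1)] f assms(2)])

lemma iterated_partial_poisson_integral:
  assumes "set es \<subseteq> Basis" "x \<in> upper_half_space"
  shows "iterated_partial es (poisson_integral P f) x = (\<integral>y. iterated_partial es K (fst x - y, snd x) *v f y \<partial>lborel)"
  using assms
proof (induction es arbitrary: x)
  case Nil then show ?case by (simp add: poisson_integral_eq)
next
  case (Cons e es)
  have es: "set es \<subseteq> Basis" and e: "e \<in> Basis" using Cons by auto
  have "partial_deriv e (iterated_partial es (poisson_integral P f)) x
      = partial_deriv e (\<lambda>z. \<integral>y. iterated_partial es K (fst z - y, snd z) *v f y \<partial>lborel) x"
    by (rule partial_deriv_cong[OF open_upper_half_space]) (use Cons es in auto)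
  also have "\<dots> = (\<Sum>b\<in>Basis. (e \<bullet> b) *\<^sub>R (\<integral>y. iterated_partial (b # es) K (fst x - y, snd x) *v f y \<partial>lborel))"
    by (rule partial_deriv_eq[OF has_derivative_kernel_partial[OF es Cons.prems(2)]])
  also have "\<dots> = (\<Sum>b\<in>Basis. if b = e then (\<integral>y. iterated_partial (b # es) K (fst x - y, snd x) *v f y \<partial>lborel) else 0)"
    by (rule sum.cong) (use e in \<open>auto simp: inner_Basis\<close>)
  also have "\<dots> = (\<integral>y. iterated_partial (e # es) K (fst x - y, snd x) *v f y \<partial>lborel)"
    using e by (simp del: iterated_partial_Cons)
  finally show ?case by simp
qed

lemma smooth_on_poisson_integral: "smooth_on upper_half_space (poisson_integral P f)"
  unfolding smooth_on_def
proof (intro allI impI ballI)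
  fix es :: "('a \<times> real) list" and x :: "'a \<times> real"
  assume es: "set es \<subseteq> Basis" and x: "x \<in> upper_half_space"
  have "(\<lambda>z. \<integral>y. iterated_partial es K (fst z - y, snd z) *v f y \<partial>lborel) differentiable at x"
    using has_derivative_kernel_partial[OF es x] by (rule differentiableI)
  then show "iterated_partial es (poisson_integral P f) differentiable at x"
    by (rule differentiable_cong[OF open_upper_half_space x, rotated])
       (rule iterated_partial_poisson_integral[OF es, symmetric])
qed

lemma apply_system_kernel:
  assumes "z \<in> upper_half_space"
  shows "(\<Sum>\<beta>\<in>UNIV. \<Sum>j\<in>Basis. \<Sum>k\<in>Basis. a j k $ \<alpha> $ \<beta> * iterated_partial [j, k] K z $ \<beta> $ \<gamma>) = 0"
proof -
  have "apply_system a (\<lambda>y. column \<gamma> (K y)) z $ \<alpha> = 0"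
    using kernel assms by (simp add: is_poisson_kernel_def)
  moreover have "partial_deriv j (partial_deriv k (\<lambda>y. column \<gamma> (K y))) z = column \<gamma> (iterated_partial [j, k] K z)"
    if "j \<in> Basis" "k \<in> Basis" for j k
    using iterated_partial_linear_comp[OF open_upper_half_space column_linear kernel_smooth _ assms, of "[j, k]"] that
    by simp
  ultimately show ?thesis by (simp add: apply_system_def column_def)
qed

text \<open>After differentiation under the integral the system acts on K alone. The product of K
  with f is a combination of the columns of K with the components of f as coefficients, and every
  column is annihilated.\<close>

lemma apply_system_poisson_integral:
  assumes x: "x \<in> upper_half_space"
  shows "apply_system a (poisson_integral P f) x = 0"
proof -
  define H where "H j k y = iterated_partial [j, k] K (fst x - y, snd x)" for j k y
  have t: "snd x > 0" using x by (simp add: upper_half_space_iff)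
  have int: "integrable lborel (\<lambda>y. (H j k y *v f y) $ \<beta>)" if "j \<in> Basis" "k \<in> Basis" for j k \<beta>
    unfolding H_def
    by (rule integrable_bounded_linear[OF bounded_linear_vec_nth integrable_kernel_partial[OF _ t]])
       (use that in auto)
  have eq: "partial_deriv j (partial_deriv k (poisson_integral P f)) x $ \<beta> = (\<integral>y. (H j k y *v f y) $ \<beta> \<partial>lborel)"
    if "j \<in> Basis" "k \<in> Basis" for j k \<beta>
  proof -
    have "partial_deriv j (partial_deriv k (poisson_integral P f)) x = (\<integral>y. H j k y *v f y \<partial>lborel)"
      using iterated_partial_poisson_integral[of "[j, k]" x] x that by (simp add: H_def)
    then show ?thesis unfolding H_def
      by (simp only:) (rule integral_bounded_linear[OF bounded_linear_vec_nth integrable_kernel_partial[OF _ t], symmetric],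
        use that in auto)
  qed
  have "apply_system a (poisson_integral P f) x $ \<alpha> = 0" for \<alpha>
  proof -
    have "apply_system a (poisson_integral P f) x $ \<alpha> = (\<Sum>\<beta>\<in>UNIV. \<Sum>j\<in>Basis. \<Sum>k\<in>Basis. a j k $ \<alpha> $ \<beta> * (\<integral>y. (H j k y *v f y) $ \<beta> \<partial>lborel))"
      by (simp add: apply_system_def eq)
    also have "\<dots> = (\<integral>y. (\<Sum>\<beta>\<in>UNIV. \<Sum>j\<in>Basis. \<Sum>k\<in>Basis. a j k $ \<alpha> $ \<beta> * (H j k y *v f y) $ \<beta>) \<partial>lborel)"
      by (simp add: Bochner_Integration.integral_sum Bochner_Integration.integrable_sum int)
    also have "\<dots> = (\<integral>y. 0 \<partial>(lborel :: 'a measure))"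
    proof (rule Bochner_Integration.integral_cong[OF refl])
      fix y
      have z: "(fst x - y, snd x) \<in> upper_half_space" using t by simp
      \<comment> \<open>The column index \<gamma> is moved to the outside, so that the inner triple
        sum becomes the system applied to column \<gamma>.\<close>
      have "(\<Sum>\<beta>\<in>UNIV. \<Sum>j\<in>Basis. \<Sum>k\<in>Basis. a j k $ \<alpha> $ \<beta> * (H j k y *v f y) $ \<beta>)
        = (\<Sum>\<beta>\<in>UNIV. \<Sum>j\<in>Basis. \<Sum>k\<in>Basis. \<Sum>\<gamma>\<in>UNIV. a j k $ \<alpha> $ \<beta> * H j k y $ \<beta> $ \<gamma> * f y $ \<gamma>)"
        by (simp add: matrix_vector_mult_def sum_distrib_left mult.assoc)
      also have "\<dots> = (\<Sum>\<beta>\<in>UNIV. \<Sum>j\<in>Basis. \<Sum>\<gamma>\<in>UNIV. \<Sum>k\<in>Basis. a j k $ \<alpha> $ \<beta> * H j k y $ \<beta> $ \<gamma> * f y $ \<gamma>)"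
        by (intro sum.cong refl sum.swap)
      also have "\<dots> = (\<Sum>\<beta>\<in>UNIV. \<Sum>\<gamma>\<in>UNIV. \<Sum>j\<in>Basis. \<Sum>k\<in>Basis. a j k $ \<alpha> $ \<beta> * H j k y $ \<beta> $ \<gamma> * f y $ \<gamma>)"
        by (intro sum.cong refl sum.swap)
      also have "\<dots> = (\<Sum>\<gamma>\<in>UNIV. \<Sum>\<beta>\<in>UNIV. \<Sum>j\<in>Basis. \<Sum>k\<in>Basis. a j k $ \<alpha> $ \<beta> * H j k y $ \<beta> $ \<gamma> * f y $ \<gamma>)"
        by (rule sum.swap)
      also have "\<dots> = (\<Sum>\<gamma>\<in>UNIV. (\<Sum>\<beta>\<in>UNIV. \<Sum>j\<in>Basis. \<Sum>k\<in>Basis. a j k $ \<alpha> $ \<beta> * H j k y $ \<beta> $ \<gamma>) * f y $ \<gamma>)"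
        by (simp add: sum_distrib_right)
      also have "\<dots> = 0"
        unfolding H_def apply_system_kernel[OF z] by simp
      finally show "(\<Sum>\<beta>\<in>UNIV. \<Sum>j\<in>Basis. \<Sum>k\<in>Basis. a j k $ \<alpha> $ \<beta> * (H j k y *v f y) $ \<beta>) = 0" .
    qed
    finally show ?thesis by simp
  qed
  then show ?thesis by (simp add: vec_eq_iff)
qed

end

lemma const_dominated: "norm (c :: 'b::real_normed_vector) \<le> (norm c / \<omega> 1) * \<omega> (1 + norm (y :: 'a))"
proof -
  have "norm c / \<omega> 1 * \<omega> 1 \<le> norm c / \<omega> 1 * \<omega> (1 + norm y)"
    using pos[of 1] by (intro mult_left_mono monoD) auto
  then show ?thesis using pos[of 1] by simp
qed

lemma poisson_integral_const:
  assumes "x \<in> upper_half_space"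
  shows "poisson_integral P (\<lambda>_. c) x = c"
proof -
  have "has_bochner_integral lborel (\<lambda>y. K (fst x - y, snd x) *v c) (mat 1 *v c)"
    using assms by (intro has_bochner_integral_bounded_linear[OF bounded_linear_matrix_vector_left]
        has_bochner_integral_kernel) (simp add: upper_half_space_iff)
  then show ?thesis
    by (simp add: poisson_integral_eq has_bochner_integral_integral_eq)
qed

text \<open>Constants are their own Poisson integrals, so their derivatives vanish. This
  cancellation allows f y to be replaced by f y - f x in the formula for the gradient.\<close>

lemma integral_kernel_partial_const:
  assumes "x \<in> upper_half_space" "b \<in> Basis"
  shows "(\<integral>y. partial_deriv b K (fst x - y, snd x) *v c \<partial>lborel) = 0"
proof -
  have "(\<integral>y. partial_deriv b K (fst x - y, snd x) *v c \<partial>lborel) = partial_deriv b (poisson_integral P (\<lambda>_. c)) x"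
    using iterated_partial_poisson_integral[OF continuous_on_const const_dominated, of "[b]" x] assms by simp
  also have "\<dots> = partial_deriv b (\<lambda>_. c) x"
    by (rule partial_deriv_cong[OF open_upper_half_space assms(1)]) (rule poisson_integral_const)
  also have "\<dots> = 0" by (rule partial_deriv_eq[OF has_derivative_const])
  finally show ?thesis .
qed

lemma norm_integral_weight_le:
  fixes k :: "'a \<Rightarrow> complex^'M^'M" and g :: "'a \<Rightarrow> complex^'M"
  assumes t: "t > 0" and A: "A \<ge> 0" "D \<ge> 0"
    and k: "\<And>y. norm (k y) \<le> D / (t + norm (x - y)) ^ Suc DIM('a)"
    and g: "\<And>y. norm (g y) \<le> A * \<omega> (t + norm (x - y))"
  shows "norm (\<integral>y. k y *v g y \<partial>lborel) \<le> D * A * tail_const DIM('a) * (\<omega> t / t)"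
proof -
  define W where "W y = \<omega> (t + norm (x - y)) / (t + norm (x - y)) ^ Suc DIM('a)" for y :: 'a
  have W: "integrable lborel W" "integral\<^sup>L lborel W \<le> tail_const DIM('a) * (\<omega> t / t)"
    unfolding W_def[abs_def] using weight_integral[OF t] by auto
  have *: "norm (k y *v g y) \<le> D * A * W y" for y
  proof -
    have p: "0 < t + norm (x - y)" using t norm_ge_zero[of "x - y"] by linarith
    have "norm (k y *v g y) \<le> norm (k y) * norm (g y)" by (rule norm_matrix_vector_mult_le)
    also have "\<dots> \<le> D / (t + norm (x - y)) ^ Suc DIM('a) * (A * \<omega> (t + norm (x - y)))"
      using p A by (intro mult_mono k g) auto
    finally show ?thesis by (simp add: W_def mult_ac)
  qed
  have "norm (\<integral>y. k y *v g y \<partial>lborel) \<le> (\<integral>y. D * A * W y \<partial>lborel)"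
  proof (cases "integrable lborel (\<lambda>y. k y *v g y)")
    case True
    then show ?thesis using W(1) *
      by (intro order_trans[OF integral_norm_bound] integral_mono) auto
  next
    \<comment> \<open>A non-integrable function has Bochner integral 0 by convention, and the
      right-hand side is non-negative.\<close>
    case False
    have "0 \<le> (\<integral>y. D * A * W y \<partial>lborel)"
      by (intro integral_nonneg_AE AE_I2 order_trans[OF norm_ge_zero *])
    then show ?thesis using False by (simp add: not_integrable_integral_eq)
  qed
  also have "\<dots> = D * A * integral\<^sup>L lborel W" by simp
  also have "\<dots> \<le> D * A * (tail_const DIM('a) * (\<omega> t / t))"
    by (intro mult_left_mono W mult_nonneg_nonneg A)
  finally show ?thesis by (simp add: mult_ac)
qed

text \<open>Both bounds come from integrating f y - f x against K and its derivatives. The constant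
  c is chosen before the data; B only secures integrability. A measures the oscillation of f around
  the single point x, so it may be adapted to the region in which x lies, as
  \<open>shifted_difference_vanishes\<close> does.\<close>

lemma poisson_integral_estimates:
  "\<exists>c\<ge>0. \<forall>f A B t x. continuous_on UNIV f \<longrightarrow> (\<forall>y. norm (f y) \<le> B * \<omega> (1 + norm y)) \<longrightarrow> A \<ge> 0 \<longrightarrow> t > 0 \<longrightarrow>
      (\<forall>y. norm (f y - f x) \<le> A * \<omega> (t + norm (x - y))) \<longrightarrow>
      norm (poisson_integral P f (x, t) - f x) \<le> c * A * \<omega> t \<and>
      (\<forall>b\<in>Basis. norm (partial_deriv b (poisson_integral P f) (x, t)) \<le> c * A * (\<omega> t / t))"
proof -
  obtain D0 where D0: "D0 \<ge> 0" "\<And>y t. t > 0 \<Longrightarrow> norm (K (y, t)) \<le> D0 * t / (t + norm y) ^ Suc DIM('a)"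
    using kernel_bound by blast
  have "\<forall>b\<in>Basis. \<exists>D\<ge>0. \<forall>y t. t > 0 \<longrightarrow> norm (partial_deriv b K (y, t)) \<le> D / (t + norm y) ^ Suc DIM('a)"
    using iterated_partial_kernel_bound[of "[_]"] by simp
  from bchoice[OF this] obtain D1 where D1: "\<And>b. b \<in> Basis \<Longrightarrow> D1 b \<ge> 0"
      "\<And>b y t. b \<in> Basis \<Longrightarrow> t > 0 \<Longrightarrow> norm (partial_deriv b K (y, t)) \<le> D1 b / (t + norm y) ^ Suc DIM('a)"
    by blast
  define D where "D = D0 + (\<Sum>b\<in>Basis. D1 b)"
  have D: "D0 \<le> D" "D \<ge> 0" "b \<in> Basis \<Longrightarrow> D1 b \<le> D" for b
    unfolding D_def using D0(1) D1(1) sum_nonneg[of Basis D1] member_le_sum[of b Basis D1] by simp_all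
  define c where "c = D * tail_const DIM('a)"
  have c: "c \<ge> 0" using D tail_const_nonneg by (simp add: c_def)
  have "norm (poisson_integral P f (x, t) - f x) \<le> c * A * \<omega> t \<and>
      (\<forall>b\<in>Basis. norm (partial_deriv b (poisson_integral P f) (x, t)) \<le> c * A * (\<omega> t / t))"
    if f: "continuous_on UNIV f" "\<forall>y. norm (f y) \<le> B * \<omega> (1 + norm y)" and "A \<ge> 0" and t: "t > 0"
      and g: "\<forall>y. norm (f y - f x) \<le> A * \<omega> (t + norm (x - y))" for f A B t x
  proof (intro conjI ballI)
    have x: "(x, t) \<in> upper_half_space" using t by simp
    have f': "norm (f y) \<le> B * \<omega> (1 + norm y)" for y using f(2) by blast
    have split: "(\<integral>y. iterated_partial es K (x - y, t) *v (f y - f x) \<partial>lborel)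
       = (\<integral>y. iterated_partial es K (x - y, t) *v f y \<partial>lborel) - (\<integral>y. iterated_partial es K (x - y, t) *v f x \<partial>lborel)"
      if "set es \<subseteq> Basis" for es
      unfolding matrix_vector_mult_diff_distrib
      by (intro Bochner_Integration.integral_diff integrable_kernel_partial[OF f(1) f' that t]
          integrable_kernel_partial[OF continuous_on_const const_dominated that t])
    have "poisson_integral P f (x, t) - f x = (\<integral>y. K (x - y, t) *v (f y - f x) \<partial>lborel)"
      using split[of "[]"] poisson_integral_const[OF x, of "f x"] by (simp add: poisson_integral_eq)
    also have "norm \<dots> \<le> (D * t) * A * tail_const DIM('a) * (\<omega> t / t)"
    proof (rule norm_integral_weight_le[where x = x])
      fix y
      have "0 < t + norm (x - y)" using t norm_ge_zero[of "x - y"] by linarith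
      then show "norm (K (x - y, t)) \<le> (D * t) / (t + norm (x - y)) ^ Suc DIM('a)"
        using t D by (intro order_trans[OF D0(2)[OF t]] divide_right_mono mult_right_mono) auto
    qed (use g t D \<open>A \<ge> 0\<close> in auto)
    also have "\<dots> = c * A * \<omega> t" using t by (simp add: c_def)
    finally show "norm (poisson_integral P f (x, t) - f x) \<le> c * A * \<omega> t" .
    fix b :: "'a \<times> real" assume b: "b \<in> Basis"
    have "partial_deriv b (poisson_integral P f) (x, t) = (\<integral>y. partial_deriv b K (x - y, t) *v (f y - f x) \<partial>lborel)"
      using split[of "[b]"] integral_kernel_partial_const[OF x b, of "f x"] b
        iterated_partial_poisson_integral[OF f(1) f', of "[b]" "(x, t)"] x by simp
    also have "norm \<dots> \<le> D * A * tail_const DIM('a) * (\<omega> t / t)"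
    proof (rule norm_integral_weight_le[where x = x])
      fix y
      have "0 < t + norm (x - y)" using t norm_ge_zero[of "x - y"] by linarith
      then show "norm (partial_deriv b K (x - y, t)) \<le> D / (t + norm (x - y)) ^ Suc DIM('a)"
        using t D(3)[OF b] by (intro order_trans[OF D1(2)[OF b t]] divide_right_mono) auto
    qed (use g t D \<open>A \<ge> 0\<close> in auto)
    finally show "norm (partial_deriv b (poisson_integral P f) (x, t)) \<le> c * A * (\<omega> t / t)"
      by (simp add: c_def mult_ac)
  qed
  with c show ?thesis by blast
qed

text \<open>The modulus is only a device here: S is written as (S / \<omega>(t)) \<omega>(t), and
  \<omega>(t) cancels in the end, so that the constant is free of t.\<close>

lemma poisson_integral_bounded:
  "\<exists>c\<ge>0. \<forall>f S. \<forall>x\<in>upper_half_space. S \<ge> 0 \<longrightarrow> (\<forall>y. norm (f y) \<le> S) \<longrightarrow> norm (poisson_integral P f x) \<le> c * S"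
proof -
  obtain D where D: "D \<ge> 0" "\<And>y t. t > 0 \<Longrightarrow> norm (K (y, t)) \<le> D * t / (t + norm y) ^ Suc DIM('a)"
    using kernel_bound by blast
  have "norm (poisson_integral P f x) \<le> (D * tail_const DIM('a)) * S"
    if x: "x \<in> upper_half_space" and S: "S \<ge> 0" "\<forall>y. norm (f y) \<le> S" for f S x
  proof -
    define t where "t = snd x"
    have t: "t > 0" using x by (simp add: t_def upper_half_space_iff)
    have "norm (\<integral>y. K (fst x - y, t) *v f y \<partial>lborel) \<le> (D * t) * (S / \<omega> t) * tail_const DIM('a) * (\<omega> t / t)"
    proof (rule norm_integral_weight_le[where x = "fst x"])
      fix y
      show "norm (K (fst x - y, t)) \<le> D * t / (t + norm (fst x - y)) ^ Suc DIM('a)" by (rule D(2)[OF t])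
      have "S / \<omega> t * \<omega> t \<le> S / \<omega> t * \<omega> (t + norm (fst x - y))"
        using pos[OF t] S t by (intro mult_left_mono monoD) auto
      then show "norm (f y) \<le> S / \<omega> t * \<omega> (t + norm (fst x - y))"
        using pos[OF t] S(2) by (simp) (meson order_trans)
    qed (use D t S pos[OF t] in auto)
    also have "\<dots> = (D * tail_const DIM('a)) * S" using t pos[OF t] by simp
    finally show ?thesis by (simp add: poisson_integral_eq t_def)
  qed
  moreover have "0 \<le> D * tail_const DIM('a)" using D tail_const_nonneg by simp
  ultimately show ?thesis by blast
qed

definition "poisson_extension f x = (if 0 < snd x then poisson_integral P f x else f (fst x))"

text \<open>Comparison with the value at 0 puts Hoelder data into the class of data for which
  Poisson integrals were differentiated.\<close>

lemma holder_dominated: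
  assumes "A \<ge> 0" "\<And>x y :: 'a. x \<noteq> y \<Longrightarrow> norm (f x - f y :: complex^'M) \<le> A * \<omega> (norm (x - y))"
  shows "norm (f y) \<le> (norm (f 0) / \<omega> 1 + A) * \<omega> (1 + norm y)"
proof -
  have p: "0 < 1 + norm y" using norm_ge_zero[of y] by linarith
  have "norm (f y - f 0) \<le> A * \<omega> (1 + norm y)"
  proof (cases "y = 0")
    case True then show ?thesis using assms(1) pos[OF p] by simp
  next
    case False
    then have "A * \<omega> (norm (y - 0)) \<le> A * \<omega> (1 + norm y)"
      using assms(1) by (intro mult_left_mono monoD) auto
    then show ?thesis using assms(2)[OF False] by simp
  qed
  moreover have "norm (f y) \<le> norm (f 0) + norm (f y - f 0)" using norm_triangle_ineq[of "f 0" "f y - f 0"] by simp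
  moreover have "norm (f 0) \<le> norm (f 0) / \<omega> 1 * \<omega> (1 + norm y)" by (rule const_dominated)
  ultimately show ?thesis by (simp add: distrib_right)
qed

text \<open>Points closer to each other than to the boundary are compared through the gradient bound;
  otherwise both are compared with their boundary values.\<close>

lemma poisson_extension_holder:
  "\<exists>c\<ge>0. \<forall>f A. A \<ge> 0 \<longrightarrow> continuous_on UNIV f \<longrightarrow> (\<forall>x y. x \<noteq> y \<longrightarrow> norm (f x - f y) \<le> A * \<omega> (norm (x - y))) \<longrightarrow>
     (\<forall>x y. 0 \<le> snd x \<longrightarrow> 0 \<le> snd y \<longrightarrow> x \<noteq> y \<longrightarrow>
       norm (poisson_extension f x - poisson_extension f y) \<le> c * A * \<omega> (norm (x - y)))"
proof -
  obtain c where c: "c \<ge> 0" and est: "\<And>f A B t x. continuous_on UNIV f \<Longrightarrow> (\<And>y. norm (f y) \<le> B * \<omega> (1 + norm y)) \<Longrightarrow> A \<ge> 0 \<Longrightarrow> t > 0 \<Longrightarrow>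
      (\<And>y. norm (f y - f x) \<le> A * \<omega> (t + norm (x - y))) \<Longrightarrow>
      norm (poisson_integral P f (x, t) - f x) \<le> c * A * \<omega> t \<and>
      (\<forall>b\<in>Basis. norm (partial_deriv b (poisson_integral P f) (x, t)) \<le> c * A * (\<omega> t / t))"
    using poisson_integral_estimates by blast
  \<comment> \<open>The first summand serves pairs whose distance is less than the lower height. The
    second serves pairs near the boundary: 2 c C from each end point, 1 from the data.\<close>
  define c' where "c' = real DIM('a \<times> real) * c * C + (4 * c * C + 1)"
  have C: "C \<ge> 1" by (rule constant_ge_1)
  have c': "c' \<ge> 0" using c C by (simp add: c'_def)
  have main: "norm (poisson_extension f x - poisson_extension f y) \<le> c' * A * \<omega> (norm (x - y))"
    if A: "A \<ge> 0" and f: "continuous_on UNIV f"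
      and hol: "\<And>x y. x \<noteq> y \<Longrightarrow> norm (f x - f y) \<le> A * \<omega> (norm (x - y))"
      and s: "0 \<le> snd x" "snd x \<le> snd y" and "x \<noteq> y" for f A x y
  proof -
    define r where "r = norm (x - y)"
    have r: "r > 0" using \<open>x \<noteq> y\<close> by (simp add: r_def)
    have dom: "norm (f y) \<le> (norm (f 0) / \<omega> 1 + A) * \<omega> (1 + norm y)" for y
      by (rule holder_dominated[OF A hol])
    have hol': "norm (f z - f w) \<le> A * \<omega> (t + norm (w - z))" if "t > 0" for t z w
    proof (cases "z = w")
      case True then show ?thesis using A pos[OF that] by simp
    next
      case False
      have "A * \<omega> (norm (z - w)) \<le> A * \<omega> (t + norm (w - z))"
        using A False that by (intro mult_left_mono monoD) (auto simp: norm_minus_commute)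
      then show ?thesis using hol[OF False] by simp
    qed
    have est': "norm (poisson_integral P f (w, t) - f w) \<le> c * A * \<omega> t \<and>
        (\<forall>b\<in>Basis. norm (partial_deriv b (poisson_integral P f) (w, t)) \<le> c * A * (\<omega> t / t))" if "t > 0" for w t
      by (rule est[OF f dom A that hol'[OF that]])
    have near: "norm (poisson_extension f z - f (fst z)) \<le> 2 * c * C * A * \<omega> r" if "0 \<le> snd z" "snd z \<le> 2 * r" for z
    proof (cases "0 < snd z")
      case True
      have "norm (poisson_extension f z - f (fst z)) \<le> c * A * \<omega> (snd z)"
        using est'[OF True, of "fst z"] True by (simp add: poisson_extension_def)
      also have "\<dots> \<le> c * A * (2 * C * \<omega> r)"
        using monoD[OF True that(2)] double_le[OF r] A c by (intro mult_left_mono) auto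
      finally show ?thesis by (simp add: mult_ac)
    next
      case False
      then show ?thesis using A c C pos[OF r] that by (simp add: poisson_extension_def)
    qed
    show ?thesis
    proof (cases "snd x \<le> r")
      case True
      have "snd y \<le> 2 * r"
        using True norm_snd_le_norm[of "x - y"] by (simp add: r_def)
      then have y: "norm (poisson_extension f y - f (fst y)) \<le> 2 * c * C * A * \<omega> r" using s by (intro near) auto
      have x: "norm (poisson_extension f x - f (fst x)) \<le> 2 * c * C * A * \<omega> r" using s True r by (intro near) auto
      have m: "norm (f (fst x) - f (fst y)) \<le> A * \<omega> r"
      proof (cases "fst x = fst y")
        case True then show ?thesis using A pos[OF r] by simp
      next
        case False
        then have "A * \<omega> (norm (fst x - fst y)) \<le> A * \<omega> r"
          using A norm_fst_le_norm[of "x - y"] by (intro mult_left_mono monoD) (auto simp: r_def)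
        then show ?thesis using hol[OF False] by simp
      qed
      have "poisson_extension f x - poisson_extension f y
        = (poisson_extension f x - f (fst x)) + (f (fst x) - f (fst y)) - (poisson_extension f y - f (fst y))" by simp
      also have "norm \<dots> \<le> 2 * c * C * A * \<omega> r + A * \<omega> r + 2 * c * C * A * \<omega> r"
        by (rule order_trans[OF norm_triangle_ineq4 add_mono[OF order_trans[OF norm_triangle_ineq add_mono[OF x m]] y]])
      also have "\<dots> = (4 * c * C + 1) * (A * \<omega> r)" by (simp add: algebra_simps)
      also have "\<dots> \<le> c' * (A * \<omega> r)"
        using A pos[OF r] c C by (intro mult_right_mono) (auto simp: c'_def)
      finally show ?thesis by (simp add: r_def mult_ac)
    next
      case False
      then have sr: "r < snd x" by simp
      have "norm (poisson_integral P f x - poisson_integral P f y) \<le> real DIM('a \<times> real) * (c * A * (C * \<omega> r / r)) * norm (x - y)"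
      \<comment> \<open>The half-space above the lower point is convex, and all heights s in it
        exceed r, so that \<open>quotient_le\<close> bounds \<omega>(s)/s by C
        \<omega>(r)/r.\<close>
      proof (rule mean_value_partial[where S = "{z. snd x \<le> snd z}"])
        show "convex {z :: 'a \<times> real. snd x \<le> snd z}"
          using convex_linear_vimage[of snd "{snd x..}"] linear_snd by (simp add: vimage_def)
        fix z :: "'a \<times> real" assume "z \<in> {z. snd x \<le> snd z}"
        then have z: "snd x \<le> snd z" "0 < snd z" using sr r by auto
        show "poisson_integral P f differentiable at z"
          by (rule smooth_on_differentiable[OF smooth_on_poisson_integral[OF f dom]])
             (use z in \<open>simp add: upper_half_space_iff\<close>)
        fix b :: "'a \<times> real" assume b: "b \<in> Basis"
        have "norm (partial_deriv b (poisson_integral P f) z) \<le> c * A * (\<omega> (snd z) / snd z)"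
          using est'[OF z(2), of "fst z"] b by simp
        also have "\<dots> \<le> c * A * (C * \<omega> r / r)"
          using quotient_le[OF r, of "snd z"] z sr A c by (intro mult_left_mono) auto
        finally show "norm (partial_deriv b (poisson_integral P f) z) \<le> c * A * (C * \<omega> r / r)" .
      qed (use s in auto)
      also have "\<dots> = (real DIM('a \<times> real) * c * C) * (A * \<omega> r)"
        using r by (simp add: r_def)
      also have "\<dots> \<le> c' * (A * \<omega> r)"
        using A pos[OF r] c C by (intro mult_right_mono) (auto simp: c'_def)
      finally have "norm (poisson_integral P f x - poisson_integral P f y) \<le> c' * (A * \<omega> r)" .
      moreover have "0 < snd x" "0 < snd y" using sr r s by linarith+
      ultimately show ?thesis by (simp add: poisson_extension_def r_def mult_ac)
    qed
  qed
  have "norm (poisson_extension f x - poisson_extension f y) \<le> c' * A * \<omega> (norm (x - y))"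
    if "A \<ge> 0" "continuous_on UNIV f"
      "\<forall>x y. x \<noteq> y \<longrightarrow> norm (f x - f y) \<le> A * \<omega> (norm (x - y))"
      "0 \<le> snd x" "0 \<le> snd y" "x \<noteq> y" for f A x y
    using main[of A f x y] main[of A f y x] that
    by (cases "snd x \<le> snd y") (auto simp: norm_minus_commute)
  with c' show ?thesis by blast
qed

end

section \<open>Compactly supported functions and the Fourier transform\<close>

definition compactly_supported :: "('a::real_normed_vector \<Rightarrow> 'b::zero) \<Rightarrow> bool" where
  "compactly_supported g \<longleftrightarrow> (\<exists>R. \<forall>x. R < norm x \<longrightarrow> g x = 0)"

definition C1_on_UNIV :: "('a::euclidean_space \<Rightarrow> 'b::real_normed_vector) \<Rightarrow> bool" where
  "C1_on_UNIV w \<longleftrightarrow> (\<forall>x. w differentiable at x) \<and> (\<forall>b\<in>Basis. continuous_on UNIV (partial_deriv b w))"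

lemma C1_continuous: "C1_on_UNIV w \<Longrightarrow> continuous_on UNIV w"
  by (intro continuous_at_imp_continuous_on ballI differentiable_imp_continuous_within)
     (simp add: C1_on_UNIV_def)

lemma compactly_supported_partial_deriv:
  assumes "compactly_supported w"
  shows "compactly_supported (partial_deriv b w)"
proof -
  obtain R where R: "\<And>x. R < norm x \<Longrightarrow> w x = 0" using assms by (auto simp: compactly_supported_def)
  have "partial_deriv b w x = 0" if "R < norm x" for x
  proof -
    have "open {x :: 'a. R < norm x}" by (intro open_Collect_less continuous_intros)
    then have "partial_deriv b w x = partial_deriv b (\<lambda>_. 0) x"
      using that R by (intro partial_deriv_cong) auto
    also have "\<dots> = 0" by (rule partial_deriv_eq[OF has_derivative_const])
    finally show ?thesis .
  qed
  then show ?thesis by (auto simp: compactly_supported_def)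
qed

lemma compactly_supported_compose:
  "compactly_supported g \<Longrightarrow> F 0 = 0 \<Longrightarrow> compactly_supported (\<lambda>x. F (g x))"
  by (force simp: compactly_supported_def)

lemma compactly_supported_times:
  fixes g h :: "'a::real_normed_vector \<Rightarrow> 'b::mult_zero"
  shows "compactly_supported g \<Longrightarrow> compactly_supported (\<lambda>x. g x * h x)"
  by (force simp: compactly_supported_def)

lemma integrable_compactly_supported:
  fixes g :: "'a::euclidean_space \<Rightarrow> 'b::euclidean_space"
  assumes "continuous_on UNIV g" "compactly_supported g"
  shows "integrable lborel g"
proof -
  obtain R where R: "\<And>x. R < norm x \<Longrightarrow> g x = 0" using assms by (auto simp: compactly_supported_def)
  have "integrable lborel (\<lambda>x. indicator (cball 0 R) x *\<^sub>R g x)"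
    by (rule borel_integrable_compact) (auto intro: continuous_on_subset[OF assms(1)])
  moreover have "indicator (cball 0 R) x *\<^sub>R g x = g x" for x
    using R[of x] by (auto simp: indicator_def not_le)
  ultimately show ?thesis by simp
qed

lemma bounded_compactly_supported:
  fixes g :: "'a::euclidean_space \<Rightarrow> 'b::real_normed_vector"
  assumes "continuous_on UNIV g" "compactly_supported g"
  shows "\<exists>M\<ge>0. \<forall>x. norm (g x) \<le> M"
proof -
  obtain R where R: "\<And>x. R < norm x \<Longrightarrow> g x = 0" using assms by (auto simp: compactly_supported_def)
  have "compact (g ` cball 0 R)"
    by (intro compact_continuous_image continuous_on_subset[OF assms(1)]) auto
  then obtain M where M: "M > 0" "\<And>y. y \<in> g ` cball 0 R \<Longrightarrow> norm y \<le> M"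
    using compact_imp_bounded bounded_pos by metis
  have "norm (g x) \<le> M" for x
    using M R[of x] by (cases "norm x \<le> R") auto
  then show ?thesis using M(1) by (intro exI[of _ M]) auto
qed

lemma integral_lborel_translate:
  fixes g :: "'a::euclidean_space \<Rightarrow> 'b::{banach, second_countable_topology}"
  assumes "g \<in> borel_measurable borel"
  shows "(\<integral>x. g (h + x) \<partial>lborel) = integral\<^sup>L lborel g"
proof -
  have "integral\<^sup>L lborel g = integral\<^sup>L (distr lborel borel ((+) h)) g"
    unfolding lborel_distr_plus by (rule refl)
  also have "\<dots> = (\<integral>x. g (h + x) \<partial>lborel)"
    using assms by (subst integral_distr) auto
  finally show ?thesis ..
qed

lemma integrable_lborel_translate:
  fixes g :: "'a::euclidean_space \<Rightarrow> 'b::{banach, second_countable_topology}"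
  assumes "integrable lborel g"
  shows "integrable lborel (\<lambda>x. g (h + x))"
proof -
  have "integrable (distr lborel borel ((+) h)) g"
    unfolding lborel_distr_plus by (rule assms)
  then show ?thesis
    using assms by (subst (asm) integrable_distr_eq) auto
qed

lemma increment_bound:
  fixes w :: "'a::euclidean_space \<Rightarrow> 'b::real_normed_vector"
  assumes "C1_on_UNIV w" "compactly_supported w"
  shows "\<exists>L\<ge>0. \<forall>x h. norm (w (h + x) - w x) \<le> L * norm h"
proof -
  have "\<forall>b\<in>Basis. \<exists>M\<ge>0. \<forall>x. norm (partial_deriv b w x) \<le> M"
    using assms by (intro ballI bounded_compactly_supported compactly_supported_partial_deriv) (auto simp: C1_on_UNIV_def)
  from bchoice[OF this] obtain M where M: "\<And>b. b \<in> Basis \<Longrightarrow> M b \<ge> 0" "\<And>b x. b \<in> Basis \<Longrightarrow> norm (partial_deriv b w x) \<le> M b"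
    by blast
  define B where "B = (\<Sum>b\<in>Basis. M b)"
  have B: "norm (partial_deriv b w x) \<le> B" if "b \<in> Basis" for b x
    unfolding B_def using M member_le_sum[of b Basis M] that by (auto intro: order_trans)
  have "norm (w (h + x) - w x) \<le> (real DIM('a) * B) * norm h" for x h
    using mean_value_partial[of UNIV w B "h + x" x] B assms(1) by (simp add: C1_on_UNIV_def)
  moreover have "real DIM('a) * B \<ge> 0" unfolding B_def using M(1) by (intro mult_nonneg_nonneg sum_nonneg) auto
  ultimately show ?thesis by blast
qed

text \<open>The steps are h / (i+1), so that an integer number of them adds up to h; the telescoping
  in \<open>integral_square_difference_le\<close> relies on this.\<close>

lemma difference_quotient_tendsto:
  assumes "w differentiable at x"
  shows "(\<lambda>i. (w (inverse (real (Suc i)) *\<^sub>R h + x) - w x) /\<^sub>R inverse (real (Suc i))) \<longlonglongrightarrow> frechet_derivative w (at x) h"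
proof (cases "h = 0")
  case True
  then show ?thesis using linear_0[OF linear_frechet_derivative[OF assms]] by simp
next
  case False
  define X where "X i = inverse (real (Suc i)) *\<^sub>R h" for i
  have X: "X \<longlonglongrightarrow> 0" unfolding X_def using LIMSEQ_inverse_real_of_nat by (auto intro: tendsto_eq_intros)
  have Xn: "X i \<noteq> 0" "norm (X i) = inverse (real (Suc i)) * norm h" for i using False by (auto simp: X_def)
  have "((\<lambda>h. norm (w (x + h) - w x - frechet_derivative w (at x) h) / norm h) \<longlongrightarrow> 0) (at 0)"
    using has_derivative_frechet[OF assms] unfolding has_derivative_at by blast
  then have "(\<lambda>i. norm (w (x + X i) - w x - frechet_derivative w (at x) (X i)) / norm (X i)) \<longlonglongrightarrow> 0"
    using X Xn unfolding tendsto_at_iff_sequentially comp_def by blast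
  then have "(\<lambda>i. norm (w (x + X i) - w x - frechet_derivative w (at x) (X i)) / norm (X i) * norm h) \<longlonglongrightarrow> 0"
    by (rule tendsto_mult_left_zero)
  moreover have "norm (w (x + X i) - w x - frechet_derivative w (at x) (X i)) / norm (X i) * norm h
     = norm ((w (X i + x) - w x) /\<^sub>R inverse (real (Suc i)) - frechet_derivative w (at x) h)" for i
  proof -
    have "frechet_derivative w (at x) (X i) = inverse (real (Suc i)) *\<^sub>R frechet_derivative w (at x) h"
      using linear_frechet_derivative[OF assms] by (simp add: X_def linear_scale)
    then have "(w (X i + x) - w x) /\<^sub>R inverse (real (Suc i)) - frechet_derivative w (at x) h
       = (w (x + X i) - w x - frechet_derivative w (at x) (X i)) /\<^sub>R inverse (real (Suc i))"
      by (simp add: scaleR_diff_right add.commute)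
    then show ?thesis using False by (simp add: Xn divide_inverse mult.commute)
  qed
  ultimately have "(\<lambda>i. norm ((w (X i + x) - w x) /\<^sub>R inverse (real (Suc i)) - frechet_derivative w (at x) h)) \<longlonglongrightarrow> 0"
    by simp
  then show ?thesis unfolding X_def by (simp add: tendsto_norm_zero_iff LIM_zero_iff)
qed

text \<open>By translation invariance every difference quotient integrates to 0, and the Lipschitz
  bound permits passage to the limit. The integrations by parts below rest on this fact.\<close>

lemma integral_partial_deriv_eq_0:
  fixes w :: "'a::euclidean_space \<Rightarrow> 'b::euclidean_space"
  assumes w: "C1_on_UNIV w" "compactly_supported w" and b: "b \<in> Basis"
  shows "(\<integral>x. partial_deriv b w x \<partial>lborel) = 0"
proof -
  obtain L where L: "L \<ge> 0" "\<And>x h. norm (w (h + x) - w x) \<le> L * norm h"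
    using increment_bound[OF w] by blast
  obtain R where R: "\<And>x. R < norm x \<Longrightarrow> w x = 0" using w by (auto simp: compactly_supported_def)
  have cont: "continuous_on UNIV w" by (rule C1_continuous[OF w(1)])
  have int: "integrable lborel w" by (rule integrable_compactly_supported[OF cont w(2)])
  define s where "s i x = (w (inverse (real (Suc i)) *\<^sub>R b + x) - w x) /\<^sub>R inverse (real (Suc i))" for i x
  have "(\<lambda>i. integral\<^sup>L lborel (s i)) \<longlonglongrightarrow> (\<integral>x. partial_deriv b w x \<partial>lborel)"
  \<comment> \<open>The shifts have length at most 1, so all difference quotients vanish outside the
    ball of radius R + 1.\<close>
  proof (rule integral_dominated_convergence[where w = "\<lambda>x. indicator (cball 0 (R + 1)) x *\<^sub>R L"])
    show "AE x in lborel. (\<lambda>i. s i x) \<longlonglongrightarrow> partial_deriv b w x"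
      unfolding s_def partial_deriv_def using w(1) by (intro AE_I2 difference_quotient_tendsto) (auto simp: C1_on_UNIV_def)
    show "integrable lborel (\<lambda>x :: 'a. indicator (cball 0 (R + 1)) x *\<^sub>R L)"
      by (intro borel_integrable_compact) auto
    show "AE x in lborel. norm (s i x) \<le> indicator (cball 0 (R + 1)) x *\<^sub>R L" for i
    proof (rule AE_I2)
      fix x :: 'a
      have inv: "0 < inverse (real (Suc i))" "inverse (real (Suc i)) \<le> 1" by (auto simp: inverse_le_1_iff)
      show "norm (s i x) \<le> indicator (cball 0 (R + 1)) x *\<^sub>R L"
      proof (cases "norm x \<le> R + 1")
        case True
        have "norm (s i x) = norm (w (inverse (real (Suc i)) *\<^sub>R b + x) - w x) / inverse (real (Suc i))"
          using inv by (simp add: s_def divide_inverse)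
        also have "\<dots> \<le> L * norm (inverse (real (Suc i)) *\<^sub>R b) / inverse (real (Suc i))"
          using inv by (intro divide_right_mono L) auto
        also have "\<dots> = L" using b inv by simp
        finally show ?thesis using True by (simp add: dist_norm)
      next
        case False
        have "norm x - norm (inverse (real (Suc i)) *\<^sub>R b) \<le> norm (inverse (real (Suc i)) *\<^sub>R b + x)"
          by (metis add.commute norm_diff_ineq)
        then have "R < norm (inverse (real (Suc i)) *\<^sub>R b + x)" "R < norm x"
          using False b inv by auto
        then show ?thesis using L(1) by (simp add: s_def R)
      qed
    qed
    have "(\<lambda>x. w (inverse (real (Suc i)) *\<^sub>R b + x)) \<in> borel_measurable lborel" for i
      using borel_measurable_integrable[OF integrable_lborel_translate[OF int]] .
    then show "s i \<in> borel_measurable lborel" for i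
      unfolding s_def using borel_measurable_integrable[OF int] by measurable
    show "(\<lambda>x. partial_deriv b w x) \<in> borel_measurable lborel"
      using w(1) b by (simp add: C1_on_UNIV_def borel_measurable_continuous_onI)
  qed
  moreover have "integral\<^sup>L lborel (s i) = 0" for i
  proof -
    have "integral\<^sup>L lborel (s i) = ((\<integral>x. w (inverse (real (Suc i)) *\<^sub>R b + x) \<partial>lborel) - integral\<^sup>L lborel w) /\<^sub>R inverse (real (Suc i))"
      unfolding s_def using integrable_lborel_translate[OF int] int by simp
    also have "(\<integral>x. w (inverse (real (Suc i)) *\<^sub>R b + x) \<partial>lborel) = integral\<^sup>L lborel w"
      by (rule integral_lborel_translate) (use borel_measurable_integrable[OF int] in simp)
    finally show ?thesis by simp
  qed
  ultimately have "(\<lambda>i. 0) \<longlonglongrightarrow> (\<integral>x. partial_deriv b w x \<partial>lborel)" by simp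
  then show ?thesis by (simp add: LIMSEQ_const_iff)
qed

section \<open>Gaussian integrals in several variables\<close>

lemma lborel_integral_prod:
  fixes f :: "'a::euclidean_space \<Rightarrow> real \<Rightarrow> 'b::{real_normed_field, banach, second_countable_topology}"
  assumes "\<And>b. b \<in> Basis \<Longrightarrow> integrable lborel (f b)"
  shows "integrable lborel (\<lambda>x :: 'a. \<Prod>b\<in>Basis. f b (x \<bullet> b))"
    and "(\<integral>x. (\<Prod>b\<in>Basis. f b (x \<bullet> b)) \<partial>lborel) = (\<Prod>b\<in>Basis. \<integral>s. f b s \<partial>lborel)"
proof -
  interpret product_sigma_finite "\<lambda>_ :: 'a. lborel :: real measure" by standard
  have m: "(\<lambda>g. \<Sum>b\<in>Basis. g b *\<^sub>R b) \<in> measurable (\<Pi>\<^sub>M b\<in>(Basis :: 'a set). lborel) borel"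
    by measurable
  have f: "(\<lambda>x :: 'a. \<Prod>b\<in>Basis. f b (x \<bullet> b)) \<in> borel_measurable borel"
    by (intro borel_measurable_prod measurable_compose[OF borel_measurable_inner[OF measurable_ident_sets[OF refl] measurable_const]])
       (use borel_measurable_integrable[OF assms] in auto)
  have eq: "(\<Prod>b\<in>Basis. f b ((\<Sum>b\<in>Basis. g b *\<^sub>R b) \<bullet> b)) = (\<Prod>b\<in>Basis. f b (g b))" for g
    by (rule prod.cong) (auto simp: inner_sum_left_Basis)
  show "integrable lborel (\<lambda>x :: 'a. \<Prod>b\<in>Basis. f b (x \<bullet> b))"
    by (subst lborel_eq, subst integrable_distr_eq[OF m f], subst eq)
       (rule product_integrable_prod, use assms in auto)
  show "(\<integral>x. (\<Prod>b\<in>Basis. f b (x \<bullet> b)) \<partial>lborel) = (\<Prod>b\<in>Basis. \<integral>s. f b s \<partial>lborel)"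
    by (subst lborel_eq, subst integral_distr[OF m f], subst eq)
       (rule product_integral_prod, use assms in auto)
qed

definition gauss :: "'a::euclidean_space \<Rightarrow> real" where
  "gauss x = (\<Prod>b\<in>Basis. std_normal_density (x \<bullet> b))"

lemma gauss_nonneg: "0 \<le> gauss x"
  by (simp add: gauss_def prod_nonneg)

lemma integrable_gauss: "integrable lborel (gauss :: 'a::euclidean_space \<Rightarrow> real)"
  unfolding gauss_def[abs_def] by (rule lborel_integral_prod) simp

lemma integral_gauss: "integral\<^sup>L lborel (gauss :: 'a::euclidean_space \<Rightarrow> real) = 1"
  unfolding gauss_def[abs_def] by (subst lborel_integral_prod) simp_all

text \<open>The integral is the characteristic function exp(-r^2/2) of the standard normal
  distribution, rewritten as a multiple of the density itself.\<close>

lemma fourier_gauss_real: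
  "integrable lborel (\<lambda>s. complex_of_real (std_normal_density s) * iexp (r * s))"
  "(\<integral>s. complex_of_real (std_normal_density s) * iexp (r * s) \<partial>lborel)
     = complex_of_real (sqrt (2 * pi) * std_normal_density r)"
proof -
  have m: "(\<lambda>s. iexp (r * s)) \<in> borel_measurable borel"
    by (intro borel_measurable_continuous_onI continuous_intros)
  show "integrable lborel (\<lambda>s. complex_of_real (std_normal_density s) * iexp (r * s))"
    by (rule Bochner_Integration.integrable_bound[OF integrable_normal_density[where \<mu> = 0 and \<sigma> = 1]])
       (use m in \<open>auto simp: norm_mult\<close>)
  have "complex_of_real (exp (- (r\<^sup>2) / 2)) = (\<integral>s. iexp (r * s) \<partial>density lborel (\<lambda>s. ennreal (std_normal_density s)))"
    using fun_cong[OF char_std_normal_distribution, of r] by (simp add: char_def)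
  also have "\<dots> = (\<integral>s. std_normal_density s *\<^sub>R iexp (r * s) \<partial>lborel)"
    by (rule integral_density) (use m in auto)
  finally show "(\<integral>s. complex_of_real (std_normal_density s) * iexp (r * s) \<partial>lborel)
     = complex_of_real (sqrt (2 * pi) * std_normal_density r)"
    by (simp add: scaleR_conv_of_real std_normal_density_def)
qed

lemma fourier_gauss:
  fixes z :: "'a::euclidean_space"
  shows "(\<integral>\<xi>. complex_of_real (gauss \<xi>) * iexp (z \<bullet> \<xi>) \<partial>lborel) = complex_of_real (sqrt (2 * pi) ^ DIM('a) * gauss z)"
proof -
  have "complex_of_real (gauss \<xi>) * iexp (z \<bullet> \<xi>)
      = (\<Prod>b\<in>Basis. complex_of_real (std_normal_density (\<xi> \<bullet> b)) * iexp ((z \<bullet> b) * (\<xi> \<bullet> b)))" for \<xi>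
    unfolding euclidean_inner[of z \<xi>]
    by (simp add: gauss_def prod.distrib exp_sum sum_distrib_left)
  then have "(\<integral>\<xi>. complex_of_real (gauss \<xi>) * iexp (z \<bullet> \<xi>) \<partial>lborel)
    = (\<Prod>b\<in>Basis. \<integral>s. complex_of_real (std_normal_density s) * iexp ((z \<bullet> b) * s) \<partial>lborel)"
    by (simp only: lborel_integral_prod(2)[OF fourier_gauss_real(1)])
  also have "\<dots> = complex_of_real (sqrt (2 * pi) ^ DIM('a) * gauss z)"
    unfolding fourier_gauss_real(2) by (simp add: gauss_def prod.distrib)
  finally show ?thesis .
qed

definition fourier :: "('a::euclidean_space \<Rightarrow> complex) \<Rightarrow> 'a \<Rightarrow> complex" where
  "fourier g \<xi> = (\<integral>x. g x * iexp (- (x \<bullet> \<xi>)) \<partial>lborel)"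

lemma integrable_fourier:
  assumes "continuous_on UNIV g" "compactly_supported g"
  shows "integrable lborel (\<lambda>x. g x * iexp (- (x \<bullet> \<xi>)))"
  by (intro integrable_compactly_supported compactly_supported_times continuous_intros assms)

text \<open>Multiplication formula: the Gaussian is, up to a constant, its own Fourier transform, so integrating
  \<open>R\<close> against it amounts to integrating the Fourier transform of \<open>R\<close> against it.\<close>

lemma integral_times_gauss_nonneg:
  fixes R :: "'a::euclidean_space \<Rightarrow> complex"
  assumes R: "continuous_on UNIV R" "compactly_supported R" and nonneg: "\<And>\<xi>. 0 \<le> Re (fourier R \<xi>)"
  shows "0 \<le> Re (\<integral>z. R z * complex_of_real (gauss z) \<partial>lborel)"
proof -
  define F where "F \<xi> z = R z * iexp (- (z \<bullet> \<xi>)) * complex_of_real (gauss \<xi>)" for \<xi> z :: 'a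
  have gm: "gauss \<in> borel_measurable (borel :: 'a measure)"
    using borel_measurable_integrable[OF integrable_gauss] by simp
  have intR: "integrable lborel R" by (rule integrable_compactly_supported[OF R])
  have int: "integrable (lborel \<Otimes>\<^sub>M lborel) (case_prod F)"
  proof (rule lborel_pair.Fubini_integrable)
    have c: "continuous_on UNIV (\<lambda>p :: 'a \<times> 'a. R (snd p) * iexp (- (snd p \<bullet> fst p)))"
      by (intro continuous_intros continuous_on_compose2[OF R(1)]) auto
    have "(\<lambda>p. R (snd p) * iexp (- (snd p \<bullet> fst p)) * complex_of_real (gauss (fst p))) \<in> borel_measurable (borel :: ('a \<times> 'a) measure)"
      by (rule borel_measurable_times[OF borel_measurable_continuous_onI[OF c] measurable_compose[OF
          measurable_compose[OF borel_measurable_continuous_onI[OF continuous_on_fst[OF continuous_on_id]] gm]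
          borel_measurable_of_real]])
    then show "case_prod F \<in> borel_measurable (lborel \<Otimes>\<^sub>M lborel)"
      by (simp add: lborel_prod F_def[abs_def] case_prod_beta')
    \<comment> \<open>The exponential has modulus 1, so absolute integrability separates into the
      two variables.\<close>
    have "norm (case_prod F (\<xi>, z)) = norm (R z) * gauss \<xi>" for \<xi> z
      by (simp add: F_def norm_mult gauss_nonneg)
    then show "integrable lborel (\<lambda>\<xi>. \<integral>z. norm (case_prod F (\<xi>, z)) \<partial>lborel)"
      by (simp add: integrable_gauss)
    show "AE \<xi> in lborel. integrable lborel (\<lambda>z. case_prod F (\<xi>, z))"
      unfolding F_def case_prod_conv
      by (intro AE_I2 integrable_mult_left integrable_fourier[OF R])
  qed
  have "(\<integral>z. \<integral>\<xi>. F \<xi> z \<partial>lborel \<partial>lborel) = (\<integral>\<xi>. \<integral>z. F \<xi> z \<partial>lborel \<partial>lborel)"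
    by (rule lborel_pair.Fubini_integral[OF int])
  also have "(\<integral>\<xi>. \<integral>z. F \<xi> z \<partial>lborel \<partial>lborel) = (\<integral>\<xi>. fourier R \<xi> * complex_of_real (gauss \<xi>) \<partial>lborel)"
    unfolding F_def fourier_def by simp
  also have "(\<lambda>z. \<integral>\<xi>. F \<xi> z \<partial>lborel) = (\<lambda>z. complex_of_real (sqrt (2 * pi) ^ DIM('a)) * (R z * complex_of_real (gauss z)))"
  proof
    fix z :: 'a
    have "(\<integral>\<xi>. F \<xi> z \<partial>lborel) = (\<integral>\<xi>. R z * (complex_of_real (gauss \<xi>) * iexp ((- z) \<bullet> \<xi>)) \<partial>lborel)"
      by (simp add: F_def mult_ac)
    also have "\<dots> = R z * complex_of_real (sqrt (2 * pi) ^ DIM('a) * gauss (- z))"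
      by (simp only: integral_mult_right_zero fourier_gauss)
    also have "gauss (- z) = gauss z" by (simp add: gauss_def std_normal_density_def)
    finally show "(\<integral>\<xi>. F \<xi> z \<partial>lborel) = complex_of_real (sqrt (2 * pi) ^ DIM('a)) * (R z * complex_of_real (gauss z))"
      by (simp add: mult_ac)
  qed
  finally have eq: "complex_of_real (sqrt (2 * pi) ^ DIM('a)) * (\<integral>z. R z * complex_of_real (gauss z) \<partial>lborel)
      = (\<integral>\<xi>. fourier R \<xi> * complex_of_real (gauss \<xi>) \<partial>lborel)"
    by (simp only: integral_mult_right_zero)
  have int': "integrable lborel (\<lambda>\<xi>. fourier R \<xi> * complex_of_real (gauss \<xi>))"
    using lborel_pair.integrable_fst'[OF int] by (simp add: F_def fourier_def)
  have "0 \<le> (\<integral>\<xi>. Re (fourier R \<xi> * complex_of_real (gauss \<xi>)) \<partial>lborel)"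
    by (rule Bochner_Integration.integral_nonneg) (simp add: nonneg gauss_nonneg)
  also have "\<dots> = Re (\<integral>\<xi>. fourier R \<xi> * complex_of_real (gauss \<xi>) \<partial>lborel)"
    by (rule integral_Re[OF int'])
  also have "\<dots> = sqrt (2 * pi) ^ DIM('a) * Re (\<integral>z. R z * complex_of_real (gauss z) \<partial>lborel)"
    unfolding eq[symmetric] by simp
  finally have *: "0 \<le> sqrt (2 * pi) ^ DIM('a) * Re (\<integral>z. R z * complex_of_real (gauss z) \<partial>lborel)" .
  have "0 < sqrt (2 * pi) ^ DIM('a)" by simp
  with * show ?thesis by (meson linorder_not_le mult_pos_neg)
qed

text \<open>This stands in for Fourier inversion at the origin. Dilating R rescales its transform by
  a positive factor and moves the frequency, so the sign condition persists, and the Gaussian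
  average of the dilated function tends to \<open>R 0\<close>.\<close>

lemma Re_at_0_nonneg:
  fixes R :: "'a::euclidean_space \<Rightarrow> complex"
  assumes R: "continuous_on UNIV R" "compactly_supported R" and nonneg: "\<And>\<xi>. 0 \<le> Re (fourier R \<xi>)"
  shows "0 \<le> Re (R 0)"
proof -
  define e where "e i = inverse (real (Suc i))" for i
  have e: "e i > 0" "e \<longlonglongrightarrow> 0" for i
    unfolding e_def using LIMSEQ_inverse_real_of_nat by auto
  obtain M where M: "\<And>x. norm (R x) \<le> M" using bounded_compactly_supported[OF R] by blast
  have gm: "gauss \<in> borel_measurable (borel :: 'a measure)"
    using borel_measurable_integrable[OF integrable_gauss] by simp
  have c: "continuous_on UNIV (\<lambda>z. R (e i *\<^sub>R z))" for i
    by (intro continuous_on_compose2[OF R(1)] continuous_intros) auto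
  have "0 \<le> Re (\<integral>z. R (e i *\<^sub>R z) * complex_of_real (gauss z) \<partial>lborel)" for i
  proof (rule integral_times_gauss_nonneg[OF c])
    obtain r where r: "\<And>x. r < norm x \<Longrightarrow> R x = 0" using R by (auto simp: compactly_supported_def)
    show "compactly_supported (\<lambda>z. R (e i *\<^sub>R z))"
      unfolding compactly_supported_def
      by (rule exI[of _ "r / e i"]) (use e(1)[of i] in \<open>auto intro!: r simp: field_simps\<close>)
    fix \<xi> :: 'a
    define f where "f x = R x * iexp (- (x \<bullet> (\<xi> /\<^sub>R e i)))" for x
    define g where "g z = R (e i *\<^sub>R z) * iexp (- (z \<bullet> \<xi>))" for z
    have f: "continuous_on UNIV f" unfolding f_def by (intro continuous_intros R)
    have "g (0 + (1 / e i) *\<^sub>R x) = f x" for x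
      using e(1)[of i] by (simp add: f_def g_def divide_inverse)
    moreover have "has_bochner_integral lborel f (fourier R (\<xi> /\<^sub>R e i))"
      unfolding fourier_def f_def
      by (intro has_bochner_integral_integrable integrable_fourier R)
    moreover have "g \<in> borel_measurable borel"
      unfolding g_def by (intro borel_measurable_continuous_onI continuous_intros c)
    ultimately have "has_bochner_integral lborel g (\<bar>1 / e i\<bar> ^ DIM('a) *\<^sub>R fourier R (\<xi> /\<^sub>R e i))"
      using e(1)[of i] by (intro has_bochner_integral_lborel_affine[where t = 0]) auto
    then have "fourier (\<lambda>z. R (e i *\<^sub>R z)) \<xi> = \<bar>1 / e i\<bar> ^ DIM('a) *\<^sub>R fourier R (\<xi> /\<^sub>R e i)"
      unfolding fourier_def g_def by (rule has_bochner_integral_integral_eq)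
    then show "0 \<le> Re (fourier (\<lambda>z. R (e i *\<^sub>R z)) \<xi>)" using nonneg by simp
  qed
  moreover have "(\<lambda>i. \<integral>z. R (e i *\<^sub>R z) * complex_of_real (gauss z) \<partial>lborel) \<longlonglongrightarrow> (\<integral>z. R 0 * complex_of_real (gauss (z :: 'a)) \<partial>lborel)"
  proof (rule integral_dominated_convergence[where w = "\<lambda>z :: 'a. M * gauss z"])
    show "AE z in lborel. (\<lambda>i. R (e i *\<^sub>R z) * complex_of_real (gauss z)) \<longlonglongrightarrow> R 0 * complex_of_real (gauss z)"
    proof (rule AE_I2, rule tendsto_mult_right)
      fix z :: 'a
      have "(\<lambda>i. e i *\<^sub>R z) \<longlonglongrightarrow> 0 *\<^sub>R z" by (intro tendsto_scaleR e tendsto_const)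
      moreover have "isCont R 0" using R(1) by (simp add: continuous_on_eq_continuous_at)
      ultimately show "(\<lambda>i. R (e i *\<^sub>R z)) \<longlonglongrightarrow> R 0"
        using isCont_tendsto_compose[of 0 R "\<lambda>i. e i *\<^sub>R z" sequentially] by simp
    qed
    show "AE z in lborel. norm (R (e i *\<^sub>R z) * complex_of_real (gauss z)) \<le> M * gauss z" for i
      by (intro AE_I2) (simp add: norm_mult gauss_nonneg mult_right_mono M)
    show "(\<lambda>z. R (e i *\<^sub>R z) * complex_of_real (gauss z)) \<in> borel_measurable lborel" for i
      using borel_measurable_continuous_onI[OF c] gm by measurable
    show "(\<lambda>z :: 'a. R 0 * complex_of_real (gauss z)) \<in> borel_measurable lborel"
      using gm by measurable
    show "integrable lborel (\<lambda>z :: 'a. M * gauss z)" by (simp add: integrable_gauss)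
  qed
  ultimately have "0 \<le> Re (\<integral>z. R 0 * complex_of_real (gauss (z :: 'a)) \<partial>lborel)"
    by (intro LIMSEQ_le_const[OF tendsto_Re]) auto
  then show ?thesis
    by (simp add: integral_gauss)
qed

section \<open>Garding's inequality\<close>

definition "continuous_compact g \<longleftrightarrow> continuous_on UNIV g \<and> compactly_supported g"

lemma continuous_compact_diff:
  fixes g h :: "'a::real_normed_vector \<Rightarrow> 'b::real_normed_vector"
  assumes "continuous_compact g" "continuous_compact h"
  shows "continuous_compact (\<lambda>x. g x - h x)"
proof -
  obtain R where "\<And>x. R < norm x \<Longrightarrow> g x = 0" using assms by (auto simp: continuous_compact_def compactly_supported_def)
  moreover obtain S where "\<And>x. S < norm x \<Longrightarrow> h x = 0" using assms by (auto simp: continuous_compact_def compactly_supported_def)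
  ultimately have "compactly_supported (\<lambda>x. g x - h x)"
    unfolding compactly_supported_def by (intro exI[of _ "max R S"]) auto
  then show ?thesis using assms by (auto simp: continuous_compact_def intro: continuous_intros)
qed

lemma continuous_compact_add:
  fixes g h :: "'a::real_normed_vector \<Rightarrow> 'b::real_normed_vector"
  assumes "continuous_compact g" "continuous_compact h"
  shows "continuous_compact (\<lambda>x. g x + h x)"
proof -
  obtain R where "\<And>x. R < norm x \<Longrightarrow> g x = 0" using assms by (auto simp: continuous_compact_def compactly_supported_def)
  moreover obtain S where "\<And>x. S < norm x \<Longrightarrow> h x = 0" using assms by (auto simp: continuous_compact_def compactly_supported_def)
  ultimately have "compactly_supported (\<lambda>x. g x + h x)"
    unfolding compactly_supported_def by (intro exI[of _ "max R S"]) auto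
  then show ?thesis using assms by (auto simp: continuous_compact_def intro: continuous_intros)
qed

lemma continuous_compact_zero: "continuous_compact (\<lambda>_. 0)"
  by (simp add: continuous_compact_def compactly_supported_def)

lemma continuous_compact_sum:
  fixes g :: "'i \<Rightarrow> 'a::real_normed_vector \<Rightarrow> 'b::real_normed_vector"
  assumes "\<And>i. i \<in> I \<Longrightarrow> continuous_compact (g i)"
  shows "continuous_compact (\<lambda>x. \<Sum>i\<in>I. g i x)"
  using assms
  by (induction I rule: infinite_finite_induct) (auto intro: continuous_compact_add continuous_compact_zero)

lemma continuous_compact_times:
  fixes g h :: "'a::real_normed_vector \<Rightarrow> 'b::real_normed_algebra"
  assumes "continuous_compact g" "continuous_on UNIV h"
  shows "continuous_compact (\<lambda>x. g x * h x)" "continuous_compact (\<lambda>x. h x * g x)"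
  using assms unfolding continuous_compact_def compactly_supported_def
  by (auto intro: continuous_intros) force+

lemma continuous_compact_integrable:
  fixes g :: "'a::euclidean_space \<Rightarrow> 'b::euclidean_space"
  shows "continuous_compact g \<Longrightarrow> integrable lborel g"
  by (simp add: continuous_compact_def integrable_compactly_supported)

lemma fourier_diff:
  "continuous_compact g \<Longrightarrow> continuous_compact h \<Longrightarrow> fourier (\<lambda>x. g x - h x) \<xi> = fourier g \<xi> - fourier h \<xi>"
  unfolding fourier_def left_diff_distrib continuous_compact_def
  by (intro Bochner_Integration.integral_diff integrable_fourier) auto

lemma fourier_sum:
  "(\<And>i. i \<in> I \<Longrightarrow> continuous_compact (g i)) \<Longrightarrow> fourier (\<lambda>x. \<Sum>i\<in>I. g i x) \<xi> = (\<Sum>i\<in>I. fourier (g i) \<xi>)"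
  unfolding fourier_def sum_distrib_right continuous_compact_def
  by (intro Bochner_Integration.integral_sum integrable_fourier) auto

lemma fourier_cmult: "fourier (\<lambda>x. c * g x) \<xi> = c * fourier g \<xi>"
  unfolding fourier_def mult.assoc by (rule integral_mult_right_zero)

text \<open>At z = 0 this is the inner product of g and h in L^2, while its Fourier transform is a
  product. Quadratic integral inequalities thereby become statements about the value at 0 of a
  continuous function, to which \<open>Re_at_0_nonneg\<close> applies.\<close>

definition correlation :: "('a::euclidean_space \<Rightarrow> complex) \<Rightarrow> ('a \<Rightarrow> complex) \<Rightarrow> 'a \<Rightarrow> complex" where
  "correlation g h z = (\<integral>x. g x * cnj (h (x - z)) \<partial>lborel)"

lemma continuous_compact_correlation:
  assumes "continuous_compact g" "continuous_compact h"
  shows "continuous_compact (correlation g h)"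
proof -
  have g: "continuous_on UNIV g" "compactly_supported g" and h: "continuous_on UNIV h" "compactly_supported h"
    using assms by (auto simp: continuous_compact_def)
  obtain M where M: "\<And>x. norm (h x) \<le> M" using bounded_compactly_supported[OF h] by blast
  obtain R where R: "\<And>x. R < norm x \<Longrightarrow> g x = 0" using g by (auto simp: compactly_supported_def)
  obtain S where S: "\<And>x. S < norm x \<Longrightarrow> h x = 0" using h by (auto simp: compactly_supported_def)
  have c: "continuous_on UNIV (\<lambda>x. g x * cnj (h (x - z)))" for z
    by (intro continuous_intros g continuous_on_compose2[OF h(1)]) auto
  have "isCont (correlation g h) z" for z
    unfolding continuous_at_sequentially comp_def correlation_def
  proof (intro allI impI)
    fix X :: "nat \<Rightarrow> 'a" assume X: "X \<longlonglongrightarrow> z"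
    show "(\<lambda>i. \<integral>x. g x * cnj (h (x - X i)) \<partial>lborel) \<longlonglongrightarrow> (\<integral>x. g x * cnj (h (x - z)) \<partial>lborel)"
    proof (rule integral_dominated_convergence[where w = "\<lambda>x. norm (g x) * M"])
      show "integrable lborel (\<lambda>x. norm (g x) * M)"
        using integrable_compactly_supported[OF g] by simp
      show "AE x in lborel. norm (g x * cnj (h (x - X i))) \<le> norm (g x) * M" for i
        by (intro AE_I2) (simp add: norm_mult mult_left_mono M)
      show "AE x in lborel. (\<lambda>i. g x * cnj (h (x - X i))) \<longlonglongrightarrow> g x * cnj (h (x - z))"
      proof (intro AE_I2 tendsto_mult_left tendsto_cnj)
        fix x
        have "isCont h (x - z)" using h(1) by (simp add: continuous_on_eq_continuous_at)
        then show "(\<lambda>i. h (x - X i)) \<longlonglongrightarrow> h (x - z)"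
          by (rule isCont_tendsto_compose) (intro tendsto_intros X)
      qed
    qed (use c in \<open>auto intro!: borel_measurable_continuous_onI\<close>)
  qed
  then have "continuous_on UNIV (correlation g h)" by (simp add: continuous_at_imp_continuous_on)
  moreover have "correlation g h z = 0" if "R + S < norm z" for z
  proof -
    have "g x * cnj (h (x - z)) = 0" for x
    proof (cases "R < norm x")
      case False
      then have "S < norm (x - z)" using that norm_triangle_ineq2[of z x] by (simp add: norm_minus_commute)
      then show ?thesis by (simp add: S)
    qed (simp add: R)
    then have "(\<lambda>x. g x * cnj (h (x - z))) = (\<lambda>_. 0)" by (rule ext)
    then show ?thesis unfolding correlation_def by simp
  qed
  ultimately show ?thesis unfolding continuous_compact_def compactly_supported_def by blast
qed

text \<open>Fubini, followed by the substitution z = x - y in the inner integral.\<close>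

lemma fourier_correlation:
  assumes "continuous_compact g" "continuous_compact h"
  shows "fourier (correlation g h) \<xi> = fourier g \<xi> * cnj (fourier h \<xi>)"
proof -
  have g: "continuous_on UNIV g" "compactly_supported g" and h: "continuous_on UNIV h" "compactly_supported h"
    using assms by (auto simp: continuous_compact_def)
  obtain R where R: "\<And>x. R < norm x \<Longrightarrow> g x = 0" using g by (auto simp: compactly_supported_def)
  obtain S where S: "\<And>x. S < norm x \<Longrightarrow> h x = 0" using h by (auto simp: compactly_supported_def)
  define F where "F x z = g x * cnj (h (x - z)) * iexp (- (z \<bullet> \<xi>))" for x z
  have c: "continuous_on UNIV (\<lambda>p. F (fst p) (snd p))"
    unfolding F_def
    by (intro continuous_intros continuous_on_compose2[OF g(1)] continuous_on_compose2[OF h(1)]) auto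
  have "F x z = 0" if "R + R + S < norm (x, z)" for x z
  proof (cases "R < norm x")
    case False
    have "norm (x, z) \<le> norm x + norm z" by (rule norm_Pair_le)
    then have "S < norm (x - z)" using that False norm_triangle_ineq2[of z x] by (simp add: norm_minus_commute)
    then show ?thesis by (simp add: F_def S)
  qed (simp add: F_def R)
  then have "compactly_supported (\<lambda>p. F (fst p) (snd p))"
    unfolding compactly_supported_def by (intro exI[of _ "R + R + S"]) auto
  from integrable_compactly_supported[OF c this]
  have int: "integrable (lborel \<Otimes>\<^sub>M lborel) (case_prod F)"
    by (simp add: lborel_prod case_prod_beta')
  have inner: "(\<integral>z. F x z \<partial>lborel) = g x * iexp (- (x \<bullet> \<xi>)) * cnj (fourier h \<xi>)" for x
  proof -
    define f where "f z = cnj (h (x - z)) * iexp (- (z \<bullet> \<xi>))" for z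
    have f: "continuous_on UNIV f" unfolding f_def
      by (intro continuous_intros continuous_on_compose2[OF h(1)]) auto
    have "f (x + (- 1) *\<^sub>R y) = iexp (- (x \<bullet> \<xi>)) * cnj (h y * iexp (- (y \<bullet> \<xi>)))" for y
    proof -
      have "iexp (- ((x - y) \<bullet> \<xi>)) = iexp (- (x \<bullet> \<xi>)) * iexp (y \<bullet> \<xi>)"
        by (simp add: inner_diff_left algebra_simps exp_add[symmetric])
      moreover have "cnj (iexp (- (y \<bullet> \<xi>))) = iexp (y \<bullet> \<xi>)" by (simp add: exp_cnj)
      ultimately show ?thesis by (simp only: f_def complex_cnj_mult) simp
    qed
    moreover have "has_bochner_integral lborel (\<lambda>y. iexp (- (x \<bullet> \<xi>)) * cnj (h y * iexp (- (y \<bullet> \<xi>)))) (iexp (- (x \<bullet> \<xi>)) * cnj (fourier h \<xi>))"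
      unfolding fourier_def
      by (intro has_bochner_integral_mult_right has_bochner_integral_bounded_linear[OF bounded_linear_cnj]
          has_bochner_integral_integrable integrable_fourier h)
    ultimately have "has_bochner_integral lborel f (\<bar>-1\<bar> ^ DIM('a) *\<^sub>R (iexp (- (x \<bullet> \<xi>)) * cnj (fourier h \<xi>)))"
      by (intro has_bochner_integral_lborel_affine[where t = x] borel_measurable_continuous_onI f) auto
    then have "(\<integral>z. f z \<partial>lborel) = iexp (- (x \<bullet> \<xi>)) * cnj (fourier h \<xi>)"
      by (simp add: has_bochner_integral_integral_eq)
    moreover have "(\<integral>z. F x z \<partial>lborel) = g x * (\<integral>z. f z \<partial>lborel)"
      unfolding F_def f_def mult.assoc by (rule integral_mult_right_zero)
    ultimately show ?thesis by simp
  qed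
  have "fourier (correlation g h) \<xi> = (\<integral>z. \<integral>x. F x z \<partial>lborel \<partial>lborel)"
    unfolding fourier_def correlation_def F_def by (simp add: integral_mult_left_zero)
  also have "\<dots> = (\<integral>x. \<integral>z. F x z \<partial>lborel \<partial>lborel)" by (rule lborel_pair.Fubini_integral[OF int])
  also have "\<dots> = fourier g \<xi> * cnj (fourier h \<xi>)"
    unfolding inner fourier_def[of g] by (rule integral_mult_left_zero)
  finally show ?thesis .
qed

text \<open>Integration by parts: the partial derivative of w times the exponential integrates to 0
  by \<open>integral_partial_deriv_eq_0\<close>.\<close>

lemma fourier_partial_deriv:
  fixes w :: "'a::euclidean_space \<Rightarrow> complex"
  assumes w: "C1_on_UNIV w" "compactly_supported w" and b: "b \<in> Basis"
  shows "fourier (partial_deriv b w) \<xi> = \<i> * complex_of_real (\<xi> \<bullet> b) * fourier w \<xi>"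
proof -
  define E where "E x = iexp (- (x \<bullet> \<xi>))" for x
  have E': "(E has_derivative (\<lambda>h. E x * (\<i> * complex_of_real (- (h \<bullet> \<xi>))))) (at x)" for x
  proof -
    have "((\<lambda>x. \<i> * complex_of_real (- (x \<bullet> \<xi>))) has_derivative (\<lambda>h. \<i> * complex_of_real (- (h \<bullet> \<xi>)))) (at x)"
      by (auto intro!: derivative_eq_intros)
    from has_derivative_compose[OF this has_field_derivative_imp_has_derivative[OF DERIV_exp]]
    show ?thesis unfolding E_def .
  qed
  have Ec: "continuous_on UNIV E" unfolding E_def by (intro continuous_intros)
  have D: "((\<lambda>x. w x * E x) has_derivative (\<lambda>h. w x * (E x * (\<i> * complex_of_real (- (h \<bullet> \<xi>)))) + frechet_derivative w (at x) h * E x)) (at x)" for x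
    by (intro has_derivative_mult has_derivative_frechet E') (use w in \<open>auto simp: C1_on_UNIV_def\<close>)
  have pd: "partial_deriv c (\<lambda>x. w x * E x) = (\<lambda>x. w x * (E x * (\<i> * complex_of_real (- (c \<bullet> \<xi>)))) + partial_deriv c w x * E x)" for c
    using partial_deriv_eq[OF D] by (auto simp: fun_eq_iff partial_deriv_def)
  have C1: "C1_on_UNIV (\<lambda>x. w x * E x)"
    unfolding C1_on_UNIV_def pd
  proof (intro conjI allI ballI)
    show "(\<lambda>x. w x * E x) differentiable at x" for x using D by (rule differentiableI)
    fix c :: 'a assume "c \<in> Basis"
    then have "continuous_on UNIV (partial_deriv c w)" using w by (auto simp: C1_on_UNIV_def)
    then show "continuous_on UNIV (\<lambda>x. w x * (E x * (\<i> * complex_of_real (- (c \<bullet> \<xi>)))) + partial_deriv c w x * E x)"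
      by (intro continuous_on_add continuous_on_mult continuous_on_const Ec C1_continuous[OF w(1)])
  qed
  have i1: "integrable lborel (\<lambda>x. w x * E x)" unfolding E_def
    by (intro integrable_fourier C1_continuous w)
  have i2: "integrable lborel (\<lambda>x. partial_deriv b w x * E x)" unfolding E_def
    using w b by (intro integrable_fourier compactly_supported_partial_deriv) (auto simp: C1_on_UNIV_def)
  have "0 = (\<integral>x. partial_deriv b (\<lambda>x. w x * E x) x \<partial>lborel)"
    by (rule integral_partial_deriv_eq_0[OF C1 compactly_supported_times b, symmetric]) (rule w)
  also have "\<dots> = (\<integral>x. (w x * E x) * (- (\<i> * complex_of_real (b \<bullet> \<xi>))) + partial_deriv b w x * E x \<partial>lborel)"
    unfolding pd by (simp add: mult.assoc)
  also have "\<dots> = (\<integral>x. (w x * E x) * (- (\<i> * complex_of_real (b \<bullet> \<xi>))) \<partial>lborel) + (\<integral>x. partial_deriv b w x * E x \<partial>lborel)"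
    by (intro Bochner_Integration.integral_add integrable_mult_left i1 i2)
  also have "\<dots> = (\<integral>x. w x * E x \<partial>lborel) * (- (\<i> * complex_of_real (b \<bullet> \<xi>))) + (\<integral>x. partial_deriv b w x * E x \<partial>lborel)"
    by (simp only: integral_mult_left_zero)
  finally show ?thesis unfolding fourier_def E_def[symmetric] by (simp add: inner_commute add_eq_0_iff mult.commute)
qed

lemma partial_deriv_vec_nth:
  fixes w :: "'a::euclidean_space \<Rightarrow> complex^'M::finite"
  assumes "w differentiable at x"
  shows "partial_deriv b (\<lambda>x. w x $ \<alpha>) x = partial_deriv b w x $ \<alpha>"
    and "(\<lambda>x. w x $ \<alpha>) differentiable at x"
proof -
  have D: "((\<lambda>x. w x $ \<alpha>) has_derivative (\<lambda>h. frechet_derivative w (at x) h $ \<alpha>)) (at x)"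
    by (rule bounded_linear.has_derivative[OF bounded_linear_vec_nth has_derivative_frechet[OF assms]])
  show "partial_deriv b (\<lambda>x. w x $ \<alpha>) x = partial_deriv b w x $ \<alpha>"
    using partial_deriv_eq[OF D] by (simp add: partial_deriv_def)
  show "(\<lambda>x. w x $ \<alpha>) differentiable at x" using D by (rule differentiableI)
qed

lemma norm_vec_power2: "(norm (v :: complex^'M::finite))\<^sup>2 = (\<Sum>\<alpha>\<in>UNIV. (norm (v $ \<alpha>))\<^sup>2)"
  by (simp add: norm_vec_def L2_set_def sum_nonneg)

text \<open>The integrated difference of both sides is the value at the origin of a sum of correlations whose
  Fourier transform has non-negative real part by strong ellipticity.\<close>

lemma garding:
  fixes a :: "('a::euclidean_space, 'M::finite) system" and w :: "'a \<Rightarrow> complex^'M"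
  assumes ell: "\<And>(\<xi>::'a) (\<zeta>::complex^'M). \<kappa> * (norm \<xi>)\<^sup>2 * (norm \<zeta>)\<^sup>2 \<le>
      Re (\<Sum>\<alpha>\<in>UNIV. \<Sum>\<beta>\<in>UNIV. \<Sum>j\<in>Basis. \<Sum>k\<in>Basis.
        a j k $ \<alpha> $ \<beta> * of_real (\<xi> \<bullet> j) * of_real (\<xi> \<bullet> k) * cnj (\<zeta> $ \<alpha>) * \<zeta> $ \<beta>)"
    and w: "C1_on_UNIV w" "compactly_supported w"
  shows "\<kappa> * (\<Sum>b\<in>Basis. \<integral>x. (norm (partial_deriv b w x))\<^sup>2 \<partial>lborel) \<le>
    Re (\<Sum>\<alpha>\<in>UNIV. \<Sum>\<beta>\<in>UNIV. \<Sum>j\<in>Basis. \<Sum>k\<in>Basis.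
      a j k $ \<alpha> $ \<beta> * (\<integral>x. partial_deriv k w x $ \<beta> * cnj (partial_deriv j w x $ \<alpha>) \<partial>lborel))"
proof -
  define p where "p b \<alpha> x = partial_deriv b w x $ \<alpha>" for b \<alpha> x
  have wd: "w differentiable at x" for x using w by (simp add: C1_on_UNIV_def)
  have p_eq: "p b \<alpha> = partial_deriv b (\<lambda>x. w x $ \<alpha>)" for b \<alpha>
    by (simp add: fun_eq_iff p_def partial_deriv_vec_nth(1)[OF wd])
  have w\<alpha>: "C1_on_UNIV (\<lambda>x. w x $ \<alpha>)" "compactly_supported (\<lambda>x. w x $ \<alpha>)" for \<alpha>
    using w partial_deriv_vec_nth(2)[OF wd] compactly_supported_compose[OF w(2), of "\<lambda>v. v $ \<alpha>"]
    by (auto simp: C1_on_UNIV_def p_eq[symmetric] p_def intro: bounded_linear.continuous_on[OF bounded_linear_vec_nth])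
  have p: "continuous_compact (p b \<alpha>)" if "b \<in> Basis" for b \<alpha>
    unfolding p_eq continuous_compact_def
    using w\<alpha>(1) that by (intro conjI compactly_supported_partial_deriv w\<alpha>(2)) (simp add: C1_on_UNIV_def)
  have corr: "continuous_compact (correlation (p k \<beta>) (p j \<alpha>))" if "k \<in> Basis" "j \<in> Basis" for k \<beta> j \<alpha>
    by (intro continuous_compact_correlation p that)
  have corr': "continuous_compact (\<lambda>z. c * correlation (p k \<beta>) (p j \<alpha>) z)" if "k \<in> Basis" "j \<in> Basis" for c k \<beta> j \<alpha>
    by (intro continuous_compact_times corr that continuous_on_const)
  define R1 where "R1 z = (\<Sum>\<alpha>\<in>UNIV. \<Sum>\<beta>\<in>UNIV. \<Sum>j\<in>Basis. \<Sum>k\<in>Basis. a j k $ \<alpha> $ \<beta> * correlation (p k \<beta>) (p j \<alpha>) z)" for z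
  define R2 where "R2 z = (\<Sum>b\<in>Basis. \<Sum>\<alpha>\<in>UNIV. complex_of_real \<kappa> * correlation (p b \<alpha>) (p b \<alpha>) z)" for z
  have R1: "continuous_compact R1" unfolding R1_def by (intro continuous_compact_sum corr')
  have R2: "continuous_compact R2" unfolding R2_def by (intro continuous_compact_sum corr')
  have "0 \<le> Re (R1 0 - R2 0)"
  proof (rule Re_at_0_nonneg[of "\<lambda>z. R1 z - R2 z"])
    show "continuous_on UNIV (\<lambda>z. R1 z - R2 z)" "compactly_supported (\<lambda>z. R1 z - R2 z)"
      using continuous_compact_diff[OF R1 R2] by (auto simp: continuous_compact_def)
    fix \<xi> :: 'a
    \<comment> \<open>At each frequency \<xi>, strong ellipticity is applied to the vector of the
      transforms of the components of w.\<close>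
    define \<zeta> :: "complex^'M" where "\<zeta> = (\<chi> \<alpha>. fourier (\<lambda>x. w x $ \<alpha>) \<xi>)"
    have fp: "fourier (p b \<alpha>) \<xi> = \<i> * complex_of_real (\<xi> \<bullet> b) * \<zeta> $ \<alpha>" if "b \<in> Basis" for b \<alpha>
      unfolding p_eq fourier_partial_deriv[OF w\<alpha> that] by (simp add: \<zeta>_def)
    have fc: "fourier (correlation (p k \<beta>) (p j \<alpha>)) \<xi> = of_real (\<xi> \<bullet> j) * of_real (\<xi> \<bullet> k) * cnj (\<zeta> $ \<alpha>) * \<zeta> $ \<beta>"
      if "k \<in> Basis" "j \<in> Basis" for k \<beta> j \<alpha>
    proof -
      have "fourier (correlation (p k \<beta>) (p j \<alpha>)) \<xi>
        = (\<i> * complex_of_real (\<xi> \<bullet> k) * \<zeta> $ \<beta>) * cnj (\<i> * complex_of_real (\<xi> \<bullet> j) * \<zeta> $ \<alpha>)"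
        by (simp only: fourier_correlation[OF p[OF that(1)] p[OF that(2)]] fp that)
      \<comment> \<open>The two derivatives contribute one imaginary unit each, the second one
        conjugated, and these multiply to 1.\<close>
      also have "\<dots> = - (\<i> * \<i>) * (of_real (\<xi> \<bullet> j) * of_real (\<xi> \<bullet> k) * cnj (\<zeta> $ \<alpha>) * \<zeta> $ \<beta>)"
        by (simp only: complex_cnj_mult complex_cnj_i complex_cnj_complex_of_real mult_ac mult_minus_left mult_minus_right)
      finally show ?thesis by simp
    qed
    have "fourier R1 \<xi> = (\<Sum>\<alpha>\<in>UNIV. \<Sum>\<beta>\<in>UNIV. \<Sum>j\<in>Basis. \<Sum>k\<in>Basis.
        a j k $ \<alpha> $ \<beta> * of_real (\<xi> \<bullet> j) * of_real (\<xi> \<bullet> k) * cnj (\<zeta> $ \<alpha>) * \<zeta> $ \<beta>)"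
      unfolding R1_def
      by (simp add: fourier_sum continuous_compact_sum corr' fourier_cmult fc mult.assoc)
    moreover have "fourier R2 \<xi> = complex_of_real (\<kappa> * (norm \<xi>)\<^sup>2 * (norm \<zeta>)\<^sup>2)"
    proof -
      have "fourier R2 \<xi> = (\<Sum>b\<in>Basis. \<Sum>\<alpha>\<in>UNIV. complex_of_real \<kappa> * (of_real (\<xi> \<bullet> b) * of_real (\<xi> \<bullet> b) * cnj (\<zeta> $ \<alpha>) * \<zeta> $ \<alpha>))"
        unfolding R2_def by (simp add: fourier_sum continuous_compact_sum corr' fourier_cmult fc)
      also have "\<dots> = (\<Sum>b\<in>Basis. \<Sum>\<alpha>\<in>UNIV. complex_of_real (\<kappa> * ((\<xi> \<bullet> b)\<^sup>2 * (norm (\<zeta> $ \<alpha>))\<^sup>2)))"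
      proof (intro sum.cong refl)
        fix b and \<alpha> :: 'M
        have "cnj (\<zeta> $ \<alpha>) * \<zeta> $ \<alpha> = complex_of_real ((norm (\<zeta> $ \<alpha>))\<^sup>2)"
          by (metis complex_norm_square mult.commute)
        then show "complex_of_real \<kappa> * (of_real (\<xi> \<bullet> b) * of_real (\<xi> \<bullet> b) * cnj (\<zeta> $ \<alpha>) * \<zeta> $ \<alpha>)
            = complex_of_real (\<kappa> * ((\<xi> \<bullet> b)\<^sup>2 * (norm (\<zeta> $ \<alpha>))\<^sup>2))"
          by (simp add: power2_eq_square mult.assoc)
      qed
      also have "\<dots> = complex_of_real (\<kappa> * ((\<Sum>b\<in>Basis. (\<xi> \<bullet> b)\<^sup>2) * (\<Sum>\<alpha>\<in>UNIV. (norm (\<zeta> $ \<alpha>))\<^sup>2)))"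
        by (simp only: of_real_sum[symmetric] sum_distrib_left[symmetric] sum_product)
      also have "(\<Sum>b\<in>Basis. (\<xi> \<bullet> b)\<^sup>2) = (norm \<xi>)\<^sup>2"
        unfolding power2_norm_eq_inner euclidean_inner[of \<xi> \<xi>] by (simp add: power2_eq_square)
      also have "(\<Sum>\<alpha>\<in>UNIV. (norm (\<zeta> $ \<alpha>))\<^sup>2) = (norm \<zeta>)\<^sup>2"
        by (rule norm_vec_power2[symmetric])
      finally show ?thesis by (simp add: mult.assoc)
    qed
    ultimately show "0 \<le> Re (fourier (\<lambda>z. R1 z - R2 z) \<xi>)"
      using ell[of \<xi> \<zeta>] fourier_diff[OF R1 R2, of \<xi>] by simp
  qed
  moreover have "R1 0 = (\<Sum>\<alpha>\<in>UNIV. \<Sum>\<beta>\<in>UNIV. \<Sum>j\<in>Basis. \<Sum>k\<in>Basis.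
      a j k $ \<alpha> $ \<beta> * (\<integral>x. partial_deriv k w x $ \<beta> * cnj (partial_deriv j w x $ \<alpha>) \<partial>lborel))"
    by (simp add: R1_def correlation_def p_def)
  moreover have "Re (R2 0) = \<kappa> * (\<Sum>b\<in>Basis. \<integral>x. (norm (partial_deriv b w x))\<^sup>2 \<partial>lborel)"
  proof -
    have "(\<integral>x. (norm (partial_deriv b w x))\<^sup>2 \<partial>lborel) = (\<Sum>\<alpha>\<in>UNIV. Re (correlation (p b \<alpha>) (p b \<alpha>) 0))"
      if b: "b \<in> Basis" for b
    proof -
      have i: "integrable lborel (\<lambda>x. p b \<alpha> x * cnj (p b \<alpha> x))" for \<alpha>
        using p[OF b] by (intro continuous_compact_integrable continuous_compact_times)
          (auto simp: continuous_compact_def intro: continuous_intros)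
      have sq: "(norm (p b \<alpha> x))\<^sup>2 = Re (p b \<alpha> x * cnj (p b \<alpha> x))" for \<alpha> x
        by (simp add: complex_norm_square[symmetric])
      have "(\<integral>x. (norm (partial_deriv b w x))\<^sup>2 \<partial>lborel) = (\<integral>x. (\<Sum>\<alpha>\<in>UNIV. Re (p b \<alpha> x * cnj (p b \<alpha> x))) \<partial>lborel)"
        by (simp only: norm_vec_power2 p_def[symmetric] sq)
      also have "\<dots> = (\<Sum>\<alpha>\<in>UNIV. \<integral>x. Re (p b \<alpha> x * cnj (p b \<alpha> x)) \<partial>lborel)"
        by (intro Bochner_Integration.integral_sum integrable_Re i)
      also have "\<dots> = (\<Sum>\<alpha>\<in>UNIV. Re (correlation (p b \<alpha>) (p b \<alpha>) 0))"
        by (intro sum.cong refl) (simp only: integral_Re[OF i] correlation_def diff_zero)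
      finally show ?thesis .
    qed
    then show ?thesis by (simp add: R2_def sum_distrib_left)
  qed
  ultimately show ?thesis by simp
qed

section \<open>Caccioppoli's inequality\<close>

text \<open>Telescoping over \<open>m\<close> equal steps bounds the left-hand side by the \<open>L\<^sup>2\<close> norm of the difference
  quotient with step \<open>h / m\<close>, and \<open>m\<close> tends to infinity.\<close>

lemma integral_square_difference_le:
  fixes w :: "'a::euclidean_space \<Rightarrow> 'b::euclidean_space"
  assumes w: "C1_on_UNIV w" "compactly_supported w"
  shows "integrable lborel (\<lambda>x. (norm (w (h + x) - w x))\<^sup>2)"
    and "(\<integral>x. (norm (w (h + x) - w x))\<^sup>2 \<partial>lborel) \<le> (\<integral>x. (norm (frechet_derivative w (at x) h))\<^sup>2 \<partial>lborel)"
proof -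
  define I where "I d = (\<integral>x. (norm (w (d + x) - w x))\<^sup>2 \<partial>lborel)" for d
  have cont: "continuous_on UNIV w" by (rule C1_continuous[OF w(1)])
  have wd: "w differentiable at x" for x using w by (simp add: C1_on_UNIV_def)
  obtain R where R: "\<And>x. R < norm x \<Longrightarrow> w x = 0" using w by (auto simp: compactly_supported_def)
  obtain L where L: "L \<ge> 0" "\<And>x h. norm (w (h + x) - w x) \<le> L * norm h"
    using increment_bound[OF w] by blast
  have contd: "continuous_on UNIV (\<lambda>x. (norm (w (d + x) - w x))\<^sup>2)" for d
    by (intro continuous_intros cont continuous_on_compose2[OF cont]) auto
  have far: "w (d + x) = 0 \<and> w x = 0" if "R + norm d < norm x" for d x
  proof -
    have "0 \<le> norm d" "norm x - norm d \<le> norm (d + x)"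
      using norm_diff_ineq[of x d] by (simp_all add: add.commute)
    then have "R < norm (d + x)" "R < norm x" using that by linarith+
    then show ?thesis by (simp add: R)
  qed
  have int: "integrable lborel (\<lambda>x. (norm (w (d + x) - w x))\<^sup>2)" for d
  proof (rule integrable_compactly_supported[OF contd])
    show "compactly_supported (\<lambda>x. (norm (w (d + x) - w x))\<^sup>2)"
      unfolding compactly_supported_def using far by (intro exI[of _ "R + norm d"]) auto
  qed
  \<comment> \<open>Cauchy-Schwarz over m summands costs a factor m, and by translation invariance
    all m summands have the same integral. The resulting m^2 is exactly the scaling of the squared
    difference quotient with step h / m.\<close>
  have step: "I (real m *\<^sub>R d) \<le> (real m)\<^sup>2 * I d" for m d
  proof -
    have int': "integrable lborel (\<lambda>x. (norm (w (d + (real i *\<^sub>R d + x)) - w (real i *\<^sub>R d + x)))\<^sup>2)" for i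
      by (rule integrable_lborel_translate[OF int])
    have int'': "(\<integral>x. (norm (w (d + (real i *\<^sub>R d + x)) - w (real i *\<^sub>R d + x)))\<^sup>2 \<partial>lborel) = I d" for i
      unfolding I_def
      by (rule integral_lborel_translate[where g = "\<lambda>x. (norm (w (d + x) - w x))\<^sup>2"])
         (rule borel_measurable_continuous_onI[OF contd])
    have pw: "(norm (w (real m *\<^sub>R d + x) - w x))\<^sup>2
        \<le> real m * (\<Sum>i<m. (norm (w (d + (real i *\<^sub>R d + x)) - w (real i *\<^sub>R d + x)))\<^sup>2)" for x
    proof -
      have "w (real m *\<^sub>R d + x) - w x = (\<Sum>i<m. w (real (Suc i) *\<^sub>R d + x) - w (real i *\<^sub>R d + x))"
        using sum_lessThan_telescope[of "\<lambda>i. w (real i *\<^sub>R d + x)" m] by simp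
      also have "\<dots> = (\<Sum>i<m. w (d + (real i *\<^sub>R d + x)) - w (real i *\<^sub>R d + x))"
        by (simp add: algebra_simps)
      finally have "norm (w (real m *\<^sub>R d + x) - w x)
          \<le> (\<Sum>i<m. norm (w (d + (real i *\<^sub>R d + x)) - w (real i *\<^sub>R d + x)))"
        by (simp only: norm_sum)
      then have "(norm (w (real m *\<^sub>R d + x) - w x))\<^sup>2
          \<le> (\<Sum>i<m. norm (w (d + (real i *\<^sub>R d + x)) - w (real i *\<^sub>R d + x)))\<^sup>2"
        by (intro power_mono) auto
      also have "\<dots> \<le> (\<Sum>i<m. (norm (w (d + (real i *\<^sub>R d + x)) - w (real i *\<^sub>R d + x)))\<^sup>2) * card {..<m}"
        by (rule sum_squared_le_sum_of_squares)
      finally show ?thesis by (simp add: mult.commute)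
    qed
    have "I (real m *\<^sub>R d) \<le> (\<integral>x. real m * (\<Sum>i<m. (norm (w (d + (real i *\<^sub>R d + x)) - w (real i *\<^sub>R d + x)))\<^sup>2) \<partial>lborel)"
      unfolding I_def by (intro integral_mono int pw integrable_mult_right Bochner_Integration.integrable_sum int')
    also have "\<dots> = real m * (\<Sum>i<m. I d)"
      by (simp only: integral_mult_right_zero Bochner_Integration.integral_sum[OF int'] int'')
    finally show ?thesis by (simp add: power2_eq_square mult.assoc)
  qed
  define s where "s i x = (norm ((w (inverse (real (Suc i)) *\<^sub>R h + x) - w x) /\<^sub>R inverse (real (Suc i))))\<^sup>2" for i x
  have s_eq: "s i x = (real (Suc i))\<^sup>2 * (norm (w (inverse (real (Suc i)) *\<^sub>R h + x) - w x))\<^sup>2" for i x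
    unfolding s_def by (simp add: power_mult_distrib)
  have le: "I h \<le> integral\<^sup>L lborel (s i)" for i
    using step[of "Suc i" "inverse (real (Suc i)) *\<^sub>R h"] unfolding s_eq[abs_def] integral_mult_right_zero I_def by simp
  have "(\<lambda>i. integral\<^sup>L lborel (s i)) \<longlonglongrightarrow> (\<integral>x. (norm (frechet_derivative w (at x) h))\<^sup>2 \<partial>lborel)"
  proof (rule integral_dominated_convergence[where w = "\<lambda>x. indicator (cball 0 (R + norm h)) x *\<^sub>R (L * norm h)\<^sup>2"])
    show lim: "AE x in lborel. (\<lambda>i. s i x) \<longlonglongrightarrow> (norm (frechet_derivative w (at x) h))\<^sup>2"
      unfolding s_def by (intro AE_I2 tendsto_power tendsto_norm difference_quotient_tendsto wd)
    show "integrable lborel (\<lambda>x :: 'a. indicator (cball 0 (R + norm h)) x *\<^sub>R (L * norm h)\<^sup>2)"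
      by (intro borel_integrable_compact) auto
    show m: "s i \<in> borel_measurable lborel" for i
      unfolding s_eq[abs_def] using borel_measurable_continuous_onI[OF contd] by simp
    have "frechet_derivative w (at x) h = (\<Sum>b\<in>Basis. (h \<bullet> b) *\<^sub>R partial_deriv b w x)" for x
      by (rule frechet_derivative_sum_partial[OF wd])
    moreover have "continuous_on UNIV (\<lambda>x. (norm (\<Sum>b\<in>Basis. (h \<bullet> b) *\<^sub>R partial_deriv b w x))\<^sup>2)"
      using w(1) by (intro continuous_on_power continuous_on_norm continuous_on_sum continuous_on_scaleR continuous_on_const) (auto simp: C1_on_UNIV_def)
    ultimately show "(\<lambda>x. (norm (frechet_derivative w (at x) h))\<^sup>2) \<in> borel_measurable lborel"
      by (simp add: borel_measurable_continuous_onI)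
    show "AE x in lborel. norm (s i x) \<le> indicator (cball 0 (R + norm h)) x *\<^sub>R (L * norm h)\<^sup>2" for i
    proof (rule AE_I2)
      fix x :: 'a
      define k where "k = inverse (real (Suc i))"
      have k: "0 < k" "k \<le> 1" by (auto simp: k_def inverse_le_1_iff)
      show "norm (s i x) \<le> indicator (cball 0 (R + norm h)) x *\<^sub>R (L * norm h)\<^sup>2"
      proof (cases "norm x \<le> R + norm h")
        case True
        have "norm (w (k *\<^sub>R h + x) - w x) / k \<le> L * norm (k *\<^sub>R h) / k"
          using k by (intro divide_right_mono L) auto
        also have "\<dots> = L * norm h" using k by simp
        finally have "(norm (w (k *\<^sub>R h + x) - w x) / k)\<^sup>2 \<le> (L * norm h)\<^sup>2"
          using k by (intro power_mono) auto
        moreover have "s i x = (norm (w (k *\<^sub>R h + x) - w x) / k)\<^sup>2"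
          unfolding s_def k_def[symmetric] using k by (simp add: divide_inverse mult.commute)
        ultimately show ?thesis using True by simp
      next
        case False
        have "norm (k *\<^sub>R h) \<le> norm h" using k mult_right_mono[of k 1 "norm h"] by simp
        then have "R + norm (k *\<^sub>R h) < norm x" using False by simp
        then show ?thesis using far[of "k *\<^sub>R h" x] by (simp add: s_def k_def)
      qed
    qed
  qed
  then have "I h \<le> (\<integral>x. (norm (frechet_derivative w (at x) h))\<^sup>2 \<partial>lborel)"
    by (rule LIMSEQ_le_const) (use le in auto)
  then show "(\<integral>x. (norm (w (h + x) - w x))\<^sup>2 \<partial>lborel) \<le> (\<integral>x. (norm (frechet_derivative w (at x) h))\<^sup>2 \<partial>lborel)"
    by (simp add: I_def)
  show "integrable lborel (\<lambda>x. (norm (w (h + x) - w x))\<^sup>2)" by (rule int)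
qed

section \<open>Products with cutoffs supported in a closed subset of an open set\<close>

context
  fixes S T :: "'a::euclidean_space set"
  assumes S: "open S" and T: "closed T" "T \<subseteq> S"
begin

text \<open>G is arbitrary outside S. Continuity is glued from the open sets S and
  \<open>- T\<close>, which cover the space.\<close>

lemma cutoff_continuous:
  assumes "continuous_on UNIV \<phi>" "\<And>x. x \<notin> T \<Longrightarrow> \<phi> x = 0" "continuous_on S G"
  shows "continuous_on UNIV (\<lambda>x. \<phi> x *\<^sub>R (G x :: 'b::real_normed_vector))"
proof -
  have "continuous_on (S \<union> - T) (\<lambda>x. \<phi> x *\<^sub>R G x)"
  proof (rule continuous_on_open_Un)
    show "continuous_on S (\<lambda>x. \<phi> x *\<^sub>R G x)"
      by (intro continuous_intros assms continuous_on_subset[OF assms(1)]) auto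
    show "continuous_on (- T) (\<lambda>x. \<phi> x *\<^sub>R G x)"
      by (subst continuous_on_cong[OF refl, of _ _ "\<lambda>_. 0"]) (auto simp: assms(2))
  qed (use S T in auto)
  moreover have "S \<union> - T = UNIV" using T by auto
  ultimately show ?thesis by simp
qed

lemma partial_deriv_outside:
  assumes "\<And>x. x \<notin> T \<Longrightarrow> f x = 0" "x \<notin> T"
  shows "partial_deriv b f x = 0"
proof -
  have "partial_deriv b f x = partial_deriv b (\<lambda>_. 0) x"
    by (rule partial_deriv_cong[of "- T"]) (use T assms in auto)
  also have "\<dots> = 0" by (rule partial_deriv_eq[OF has_derivative_const])
  finally show ?thesis .
qed

context
  fixes \<eta> :: "'a \<Rightarrow> real" and G :: "'a \<Rightarrow> 'b::real_normed_vector"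
  assumes \<eta>: "C1_on_UNIV \<eta>" "\<And>x. x \<notin> T \<Longrightarrow> \<eta> x = 0" and G: "\<And>x. x \<in> S \<Longrightarrow> G differentiable at x"
begin

text \<open>The product rule holds at every point, even where the partial derivative of G is an
  arbitrary value: outside S both \<eta> and its partial derivatives vanish.\<close>

lemma cutoff_differentiable: "(\<lambda>x. \<eta> x *\<^sub>R G x) differentiable at x"
  and partial_deriv_cutoff: "partial_deriv b (\<lambda>x. \<eta> x *\<^sub>R G x) x = \<eta> x *\<^sub>R partial_deriv b G x + partial_deriv b \<eta> x *\<^sub>R G x"
proof -
  have "(\<lambda>x. \<eta> x *\<^sub>R G x) differentiable at x \<and>
    partial_deriv b (\<lambda>x. \<eta> x *\<^sub>R G x) x = \<eta> x *\<^sub>R partial_deriv b G x + partial_deriv b \<eta> x *\<^sub>R G x"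
  proof (cases "x \<in> S")
    case True
    have "\<eta> differentiable at x" using \<eta>(1) by (simp add: C1_on_UNIV_def)
    then have D: "((\<lambda>x. \<eta> x *\<^sub>R G x) has_derivative (\<lambda>h. \<eta> x *\<^sub>R frechet_derivative G (at x) h + frechet_derivative \<eta> (at x) h *\<^sub>R G x)) (at x)"
      by (intro has_derivative_scaleR has_derivative_frechet G True)
    from partial_deriv_eq[OF D] differentiableI[OF D] show ?thesis by (simp add: partial_deriv_def)
  next
    case False
    then have "x \<notin> T" using T by auto
    have "(\<lambda>x. \<eta> x *\<^sub>R G x) differentiable at x"
      by (rule differentiable_cong[of "- T" x "\<lambda>_. 0"]) (use T \<open>x \<notin> T\<close> \<eta>(2) in auto)
    then show ?thesis
      using partial_deriv_outside[of "\<lambda>x. \<eta> x *\<^sub>R G x"] partial_deriv_outside[of \<eta>] \<open>x \<notin> T\<close> \<eta>(2) by simp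
  qed
  then show "(\<lambda>x. \<eta> x *\<^sub>R G x) differentiable at x"
    "partial_deriv b (\<lambda>x. \<eta> x *\<^sub>R G x) x = \<eta> x *\<^sub>R partial_deriv b G x + partial_deriv b \<eta> x *\<^sub>R G x" by auto
qed

lemma cutoff_C1:
  assumes "\<And>b. b \<in> Basis \<Longrightarrow> continuous_on S (partial_deriv b G)"
  shows "C1_on_UNIV (\<lambda>x. \<eta> x *\<^sub>R G x)"
  unfolding C1_on_UNIV_def
proof (intro conjI allI ballI cutoff_differentiable)
  fix b :: 'a assume b: "b \<in> Basis"
  have "continuous_on S G"
    using G by (intro continuous_at_imp_continuous_on ballI differentiable_imp_continuous_within)
  then show "continuous_on UNIV (partial_deriv b (\<lambda>x. \<eta> x *\<^sub>R G x))"
    unfolding partial_deriv_cutoff[abs_def]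
    using b \<eta> assms[OF b] partial_deriv_outside[of \<eta>]
    by (intro continuous_on_add cutoff_continuous C1_continuous[OF \<eta>(1)]) (auto simp: C1_on_UNIV_def)
qed

end

end

text \<open>Garding's inequality is applied to \<open>w = \<eta> V\<close>. Subtracting the weak form of the system tested with
  \<open>\<eta>\<^sup>2 V\<close> leaves only terms containing a derivative of \<open>\<eta>\<close>.\<close>

lemma caccioppoli:
  fixes a :: "('a::euclidean_space, 'M::finite) system"
  assumes "strongly_elliptic a"
  shows "\<exists>C\<ge>0. \<forall>S T V \<eta>. open S \<longrightarrow> closed T \<longrightarrow> T \<subseteq> S \<longrightarrow> smooth_on S V \<longrightarrow> (\<forall>x\<in>S. apply_system a V x = 0) \<longrightarrow>
    C1_on_UNIV \<eta> \<longrightarrow> compactly_supported \<eta> \<longrightarrow> (\<forall>x. x \<notin> T \<longrightarrow> \<eta> x = 0) \<longrightarrow>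
      C1_on_UNIV (\<lambda>x. \<eta> x *\<^sub>R V x) \<and>
      (\<Sum>b\<in>Basis. \<integral>x. (norm (partial_deriv b (\<lambda>x. \<eta> x *\<^sub>R V x) x))\<^sup>2 \<partial>lborel)
        \<le> C * (\<integral>x. (\<Sum>b\<in>Basis. (partial_deriv b \<eta> x)\<^sup>2) * (norm (V x))\<^sup>2 \<partial>lborel)"
proof -
  obtain \<kappa> where \<kappa>: "\<kappa> > 0" and ell: "\<And>(\<xi>::'a) (\<zeta>::complex^'M). \<kappa> * (norm \<xi>)\<^sup>2 * (norm \<zeta>)\<^sup>2 \<le>
      Re (\<Sum>\<alpha>\<in>UNIV. \<Sum>\<beta>\<in>UNIV. \<Sum>j\<in>Basis. \<Sum>k\<in>Basis.
        a j k $ \<alpha> $ \<beta> * of_real (\<xi> \<bullet> j) * of_real (\<xi> \<bullet> k) * cnj (\<zeta> $ \<alpha>) * \<zeta> $ \<beta>)"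
    using assms unfolding strongly_elliptic_def by blast
  define A where "A = (\<Sum>\<alpha>\<in>UNIV. \<Sum>\<beta>\<in>UNIV. \<Sum>j\<in>Basis. \<Sum>k\<in>Basis. norm (a j k $ \<alpha> $ \<beta>))"
  have A: "A \<ge> 0" unfolding A_def by (intro sum_nonneg) auto
  \<comment> \<open>The first term stems from the Young inequality 2 A e s <= (\<kappa>/2) s^2 +
    (2/\<kappa>) A^2 e^2, the second from the part A e^2 of the remainder.\<close>
  define B where "B = 2 * A\<^sup>2 / \<kappa> + A"
  have B: "B \<ge> 0" using A \<kappa> by (simp add: B_def)
  have main: "C1_on_UNIV (\<lambda>x. \<eta> x *\<^sub>R V x) \<and>
      (\<Sum>b\<in>Basis. \<integral>x. (norm (partial_deriv b (\<lambda>x. \<eta> x *\<^sub>R V x) x))\<^sup>2 \<partial>lborel)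
        \<le> (2 * B / \<kappa>) * (\<integral>x. (\<Sum>b\<in>Basis. (partial_deriv b \<eta> x)\<^sup>2) * (norm (V x))\<^sup>2 \<partial>lborel)"
    if S: "open S" and T: "closed T" "T \<subseteq> S" and V: "smooth_on S V" "\<forall>x\<in>S. apply_system a V x = 0"
      and \<eta>: "C1_on_UNIV \<eta>" "compactly_supported \<eta>" "\<forall>x. x \<notin> T \<longrightarrow> \<eta> x = 0" for S T V \<eta>
  proof -
    define w where "w x = \<eta> x *\<^sub>R V x" for x
    note \<eta>0 = \<eta>(3)[rule_format]
    note cc = cutoff_continuous[OF S T] and pc = partial_deriv_cutoff[OF S T] and cC1 = cutoff_C1[OF S T]
      and out = partial_deriv_outside[OF S T]
    have Vd: "V differentiable at x" if "x \<in> S" for x by (rule smooth_on_differentiable[OF V(1) that])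
    have Vc: "continuous_on S V" by (rule smooth_on_continuous_on[OF V(1)])
    have pV: "smooth_on S (partial_deriv k V)" if "k \<in> Basis" for k by (rule smooth_on_partial_deriv[OF V(1) that])
    have pVd: "partial_deriv k V differentiable at x" if "x \<in> S" "k \<in> Basis" for x k
      by (rule smooth_on_differentiable[OF pV[OF that(2)] that(1)])
    have pVc: "continuous_on S (partial_deriv k V)" if "k \<in> Basis" for k by (rule smooth_on_continuous_on[OF pV[OF that]])
    have ppVc: "continuous_on S (partial_deriv j (partial_deriv k V))" if "k \<in> Basis" "j \<in> Basis" for k j
      by (rule smooth_on_continuous_on[OF smooth_on_partial_deriv[OF pV[OF that(1)] that(2)]])
    have \<eta>c: "continuous_on UNIV \<eta>" by (rule C1_continuous[OF \<eta>(1)])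
    have p\<eta>c: "continuous_on UNIV (partial_deriv b \<eta>)" if "b \<in> Basis" for b using \<eta>(1) that by (simp add: C1_on_UNIV_def)
    have w: "C1_on_UNIV w" unfolding w_def using cC1[OF \<eta>(1) \<eta>0 Vd pVc] by simp
    have wsupp: "compactly_supported w"
      using \<eta>(2) unfolding w_def compactly_supported_def by force
    have pw: "partial_deriv b w x = \<eta> x *\<^sub>R partial_deriv b V x + partial_deriv b \<eta> x *\<^sub>R V x" for b x
      unfolding w_def[abs_def] by (rule pc[OF \<eta>(1) \<eta>0 Vd])
    have pwc: "continuous_on UNIV (partial_deriv b w)" "compactly_supported (partial_deriv b w)" if "b \<in> Basis" for b
      using w wsupp compactly_supported_partial_deriv that by (auto simp: C1_on_UNIV_def)
    define \<phi> where "\<phi> x = (\<eta> x)\<^sup>2" for x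
    have \<phi>D: "(\<phi> has_derivative (\<lambda>h. 2 * \<eta> x * frechet_derivative \<eta> (at x) h)) (at x)" for x
    proof -
      have "(\<eta> has_derivative frechet_derivative \<eta> (at x)) (at x)"
        using \<eta>(1) by (intro has_derivative_frechet) (simp add: C1_on_UNIV_def)
      from has_derivative_mult[OF this this] show ?thesis
        unfolding \<phi>_def[abs_def] power2_eq_square by (simp add: mult_ac)
    qed
    have p\<phi>: "partial_deriv b \<phi> = (\<lambda>x. 2 * \<eta> x * partial_deriv b \<eta> x)" for b
      using partial_deriv_eq[OF \<phi>D] by (auto simp: partial_deriv_def fun_eq_iff)
    have \<phi>C1: "C1_on_UNIV \<phi>"
      unfolding C1_on_UNIV_def p\<phi> using differentiableI[OF \<phi>D]
      by (auto intro!: continuous_intros \<eta>c p\<eta>c)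
    have \<phi>0: "\<phi> x = 0" if "x \<notin> T" for x using \<eta>0[OF that] by (simp add: \<phi>_def)
    have \<phi>s: "compactly_supported \<phi>" using \<eta>(2) by (force simp: \<phi>_def compactly_supported_def)
    define G where "G k \<alpha> \<beta> x = partial_deriv k V x $ \<beta> * cnj (V x $ \<alpha>)" for k \<alpha> \<beta> x
    have GD: "(G k \<alpha> \<beta> has_derivative (\<lambda>h. partial_deriv k V x $ \<beta> * cnj (frechet_derivative V (at x) h $ \<alpha>)
        + frechet_derivative (partial_deriv k V) (at x) h $ \<beta> * cnj (V x $ \<alpha>))) (at x)"
      if "x \<in> S" "k \<in> Basis" for k \<alpha> \<beta> x
      unfolding G_def[abs_def]
      by (intro has_derivative_mult bounded_linear.has_derivative[OF bounded_linear_cnj]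
          bounded_linear.has_derivative[OF bounded_linear_vec_nth] has_derivative_frechet Vd pVd that)
    have pG: "partial_deriv j (G k \<alpha> \<beta>) x = partial_deriv k V x $ \<beta> * cnj (partial_deriv j V x $ \<alpha>)
        + partial_deriv j (partial_deriv k V) x $ \<beta> * cnj (V x $ \<alpha>)"
      if "x \<in> S" "k \<in> Basis" for j k \<alpha> \<beta> x
      using partial_deriv_eq[OF GD[OF that]] by (simp add: partial_deriv_def)
    have pGc: "continuous_on S (partial_deriv j (G k \<alpha> \<beta>))" if "k \<in> Basis" "j \<in> Basis" for j k \<alpha> \<beta>
    proof -
      have "continuous_on S (\<lambda>x. partial_deriv k V x $ \<beta> * cnj (partial_deriv j V x $ \<alpha>)
        + partial_deriv j (partial_deriv k V) x $ \<beta> * cnj (V x $ \<alpha>))"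
        by (intro continuous_on_add continuous_on_mult continuous_on_cnj
          bounded_linear.continuous_on[OF bounded_linear_vec_nth] pVc ppVc Vc that)
      then show ?thesis by (rule continuous_on_eq) (use pG that in simp)
    qed
    have qC1: "C1_on_UNIV (\<lambda>x. \<phi> x *\<^sub>R G k \<alpha> \<beta> x)" if "k \<in> Basis" for k \<alpha> \<beta>
      by (rule cC1[OF \<phi>C1 \<phi>0 differentiableI[OF GD] pGc]) (use that in auto)
    have qs: "compactly_supported (\<lambda>x. \<phi> x *\<^sub>R G k \<alpha> \<beta> x)" for k \<alpha> \<beta>
      using \<phi>s by (force simp: compactly_supported_def)
    \<comment> \<open>Total derivatives, hence of integral 0. Summed against the coefficients they
      form the weak formulation of the system tested with \<eta>^2 V.\<close>
    define q where "q j k \<alpha> \<beta> = partial_deriv j (\<lambda>x. \<phi> x *\<^sub>R G k \<alpha> \<beta> x)" for j k \<alpha> \<beta>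
    have q0: "(\<integral>x. q j k \<alpha> \<beta> x \<partial>lborel) = 0" if "k \<in> Basis" "j \<in> Basis" for j k \<alpha> \<beta>
      unfolding q_def by (rule integral_partial_deriv_eq_0[OF qC1[OF that(1)] qs that(2)])
    have qi: "integrable lborel (q j k \<alpha> \<beta>)" if "k \<in> Basis" "j \<in> Basis" for j k \<alpha> \<beta>
      unfolding q_def
      by (rule integrable_compactly_supported[OF _ compactly_supported_partial_deriv[OF qs]])
         (use qC1[OF that(1)] that(2) in \<open>simp add: C1_on_UNIV_def\<close>)
    have q_eq: "q j k \<alpha> \<beta> x = \<phi> x *\<^sub>R partial_deriv j (G k \<alpha> \<beta>) x + (2 * \<eta> x * partial_deriv j \<eta> x) *\<^sub>R G k \<alpha> \<beta> x"
      if "k \<in> Basis" for j k \<alpha> \<beta> x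
    proof -
      have "q j k \<alpha> \<beta> x = \<phi> x *\<^sub>R partial_deriv j (G k \<alpha> \<beta>) x + partial_deriv j \<phi> x *\<^sub>R G k \<alpha> \<beta> x"
        unfolding q_def by (rule pc[OF \<phi>C1 \<phi>0 differentiableI[OF GD]]) (use that in auto)
      then show ?thesis by (simp add: p\<phi>)
    qed
    define Q where "Q j k \<alpha> \<beta> x = partial_deriv k w x $ \<beta> * cnj (partial_deriv j w x $ \<alpha>)" for j k \<alpha> \<beta> x
    have Qi: "integrable lborel (Q j k \<alpha> \<beta>)" if "k \<in> Basis" "j \<in> Basis" for j k \<alpha> \<beta>
    proof (rule continuous_compact_integrable)
      have "continuous_compact (\<lambda>x. partial_deriv k w x $ \<beta>)"
        using pwc[OF that(1)] compactly_supported_compose[OF pwc(2)[OF that(1)], of "\<lambda>v. v $ \<beta>"]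
        by (auto simp: continuous_compact_def intro: bounded_linear.continuous_on[OF bounded_linear_vec_nth])
      then show "continuous_compact (Q j k \<alpha> \<beta>)"
        unfolding Q_def[abs_def]
        by (rule continuous_compact_times)
           (intro continuous_on_cnj bounded_linear.continuous_on[OF bounded_linear_vec_nth] pwc that)
    qed
    \<comment> \<open>What is left of Q - q apart from the second-order terms. It is expressed
      through the derivatives of w and not of V, so that it can be estimated by the quantities
      \<open>s\<close> and \<open>e\<close> introduced below.\<close>
    define r where "r j k \<alpha> \<beta> x = complex_of_real (partial_deriv k \<eta> x) * V x $ \<beta> * cnj (partial_deriv j w x $ \<alpha>)
        - partial_deriv k w x $ \<beta> * (complex_of_real (partial_deriv j \<eta> x) * cnj (V x $ \<alpha>))
        + complex_of_real (partial_deriv k \<eta> x) * V x $ \<beta> * (complex_of_real (partial_deriv j \<eta> x) * cnj (V x $ \<alpha>))" for j k \<alpha> \<beta> x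
    define F where "F x = (\<Sum>\<alpha>\<in>UNIV. \<Sum>\<beta>\<in>UNIV. \<Sum>j\<in>Basis. \<Sum>k\<in>Basis. a j k $ \<alpha> $ \<beta> * (Q j k \<alpha> \<beta> x - q j k \<alpha> \<beta> x))" for x
    have F_eq: "F x = (\<Sum>\<alpha>\<in>UNIV. \<Sum>\<beta>\<in>UNIV. \<Sum>j\<in>Basis. \<Sum>k\<in>Basis. a j k $ \<alpha> $ \<beta> * r j k \<alpha> \<beta> x)" for x
    proof (cases "x \<in> S")
      case True
      have key: "Q j k \<alpha> \<beta> x - q j k \<alpha> \<beta> x
          = r j k \<alpha> \<beta> x - complex_of_real (\<phi> x) * cnj (V x $ \<alpha>) * partial_deriv j (partial_deriv k V) x $ \<beta>"
        if "k \<in> Basis" for j k \<alpha> \<beta>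
        unfolding q_eq[OF that] pG[OF True that] Q_def r_def pw G_def \<phi>_def
        by (simp add: scaleR_conv_of_real[where 'a = complex] power2_eq_square) (simp add: scaleR_conv_of_real algebra_simps)
      have "F x = (\<Sum>\<alpha>\<in>UNIV. \<Sum>\<beta>\<in>UNIV. \<Sum>j\<in>Basis. \<Sum>k\<in>Basis. a j k $ \<alpha> $ \<beta> * r j k \<alpha> \<beta> x
          - (complex_of_real (\<phi> x) * cnj (V x $ \<alpha>)) * (a j k $ \<alpha> $ \<beta> * partial_deriv j (partial_deriv k V) x $ \<beta>))"
        unfolding F_def by (intro sum.cong refl) (subst key, assumption, simp add: right_diff_distrib mult_ac)
      also have "\<dots> = (\<Sum>\<alpha>\<in>UNIV. \<Sum>\<beta>\<in>UNIV. \<Sum>j\<in>Basis. \<Sum>k\<in>Basis. a j k $ \<alpha> $ \<beta> * r j k \<alpha> \<beta> x)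
          - (\<Sum>\<alpha>\<in>UNIV. (complex_of_real (\<phi> x) * cnj (V x $ \<alpha>)) * apply_system a V x $ \<alpha>)"
        by (simp add: sum_subtractf apply_system_def sum_distrib_left)
      finally show ?thesis using V(2) True by simp
    next
      \<comment> \<open>Off S nothing is known about V, but \<eta> and its partial derivatives
        vanish there, so all terms on both sides are 0.\<close>
      case False
      then have "x \<notin> T" using T by auto
      have "\<eta> x = 0" "partial_deriv b \<eta> x = 0" for b
        using \<eta>0[OF \<open>x \<notin> T\<close>] out[of \<eta>, OF \<eta>0 \<open>x \<notin> T\<close>] by auto
      then show ?thesis unfolding F_def
        by (intro sum.cong refl) (simp add: Q_def q_eq r_def pw \<phi>_def)
    qed
    define s where "s x = sqrt (\<Sum>b\<in>Basis. (norm (partial_deriv b w x))\<^sup>2)" for x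
    define e where "e x = sqrt (\<Sum>b\<in>Basis. (partial_deriv b \<eta> x)\<^sup>2) * norm (V x)" for x
    have s0: "0 \<le> s x" and e0: "0 \<le> e x" for x by (auto simp: s_def e_def intro!: sum_nonneg mult_nonneg_nonneg)
    have s2: "(s x)\<^sup>2 = (\<Sum>b\<in>Basis. (norm (partial_deriv b w x))\<^sup>2)" for x by (simp add: s_def sum_nonneg)
    have e2: "(e x)\<^sup>2 = (\<Sum>b\<in>Basis. (partial_deriv b \<eta> x)\<^sup>2) * (norm (V x))\<^sup>2" for x
      by (simp add: e_def sum_nonneg power_mult_distrib)
    have ws: "norm (partial_deriv b w x $ \<beta>) \<le> s x" if "b \<in> Basis" for b \<beta> x
    proof -
      have "norm (partial_deriv b w x) \<le> s x" unfolding s_def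
        using member_le_sum[of b Basis "\<lambda>b. (norm (partial_deriv b w x))\<^sup>2"] that by (intro real_le_rsqrt) auto
      then show ?thesis using Finite_Cartesian_Product.norm_nth_le[of "partial_deriv b w x" \<beta>] by linarith
    qed
    have ve: "norm (complex_of_real (partial_deriv b \<eta> x) * V x $ \<beta>) \<le> e x" if "b \<in> Basis" for b \<beta> x
    proof -
      have "\<bar>partial_deriv b \<eta> x\<bar> \<le> sqrt (\<Sum>b\<in>Basis. (partial_deriv b \<eta> x)\<^sup>2)"
        using member_le_sum[of b Basis "\<lambda>b. (partial_deriv b \<eta> x)\<^sup>2"] that by (intro real_le_rsqrt) auto
      then show ?thesis unfolding e_def norm_mult norm_of_real
        by (intro mult_mono Finite_Cartesian_Product.norm_nth_le) (auto intro!: sum_nonneg)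
    qed
    have rb: "norm (r j k \<alpha> \<beta> x) \<le> 2 * e x * s x + (e x)\<^sup>2" if "k \<in> Basis" "j \<in> Basis" for j k \<alpha> \<beta> x
    proof -
      have ve': "norm (complex_of_real (partial_deriv j \<eta> x) * cnj (V x $ \<alpha>)) \<le> e x"
        using ve[OF that(2), of x \<alpha>] by (simp add: norm_mult)
      have ws': "norm (cnj (partial_deriv j w x $ \<alpha>)) \<le> s x" using ws[OF that(2)] by simp
      have "norm (r j k \<alpha> \<beta> x) \<le> e x * s x + s x * e x + e x * e x"
        unfolding r_def
        by (intro order_trans[OF norm_triangle_ineq] add_mono order_trans[OF norm_triangle_ineq4];
            simp only: norm_mult[of "_ * _ $ _"] norm_mult[of "partial_deriv _ w _ $ _"]; intro mult_mono ve ve' ws ws' that e0 s0 norm_ge_zero)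
      then show ?thesis by (simp add: power2_eq_square)
    qed
    have Fb: "norm (F x) \<le> \<kappa> / 2 * (s x)\<^sup>2 + B * (e x)\<^sup>2" for x
    proof -
      have "norm (F x) \<le> (\<Sum>\<alpha>\<in>UNIV. \<Sum>\<beta>\<in>UNIV. \<Sum>j\<in>Basis. \<Sum>k\<in>Basis. norm (a j k $ \<alpha> $ \<beta>) * (2 * e x * s x + (e x)\<^sup>2))"
        unfolding F_eq
        by (intro sum_norm_le) (simp add: norm_mult mult_left_mono rb)
      also have "\<dots> = A * (2 * e x * s x + (e x)\<^sup>2)"
        by (simp add: A_def sum_distrib_right)
      also have "2 * (A * e x) * s x \<le> \<kappa> / 2 * (s x)\<^sup>2 + 2 / \<kappa> * (A * e x)\<^sup>2"
      proof -
        have "0 \<le> \<kappa> / 2 * (s x - 2 / \<kappa> * (A * e x))\<^sup>2" using \<kappa> by simp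
        also have "\<dots> = \<kappa> / 2 * (s x)\<^sup>2 + 2 / \<kappa> * (A * e x)\<^sup>2 - 2 * (A * e x) * s x"
          using \<kappa> by (simp add: power2_eq_square field_simps)
        finally show ?thesis by simp
      qed
      then have "A * (2 * e x * s x + (e x)\<^sup>2) \<le> \<kappa> / 2 * (s x)\<^sup>2 + B * (e x)\<^sup>2"
        by (simp add: B_def power2_eq_square algebra_simps)
      finally show ?thesis by simp
    qed
    have si: "integrable lborel (\<lambda>x. (norm (partial_deriv b w x))\<^sup>2)" if "b \<in> Basis" for b
      using compactly_supported_compose[OF pwc(2)[OF that], of "\<lambda>v. (norm v)\<^sup>2"]
      by (intro integrable_compactly_supported continuous_intros pwc that) auto
    have s2i: "integrable lborel (\<lambda>x. (s x)\<^sup>2)"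
      unfolding s2 by (intro Bochner_Integration.integrable_sum si)
    have e2i: "integrable lborel (\<lambda>x. (e x)\<^sup>2)"
    proof -
      have c: "continuous_on UNIV (\<lambda>x. (\<Sum>b\<in>Basis. (partial_deriv b \<eta> x)\<^sup>2) *\<^sub>R (norm (V x))\<^sup>2)"
        by (rule cc) (auto intro!: continuous_intros p\<eta>c Vc sum.neutral simp: out[of \<eta>, OF \<eta>0])
      have "\<forall>b\<in>Basis. \<exists>R. \<forall>x. R < norm x \<longrightarrow> partial_deriv b \<eta> x = 0"
        using compactly_supported_partial_deriv[OF \<eta>(2)] by (simp add: compactly_supported_def)
      then have "continuous_compact (\<lambda>x. \<Sum>b\<in>Basis. (partial_deriv b \<eta> x)\<^sup>2)"
        by (intro continuous_compact_sum)
           (auto simp: continuous_compact_def compactly_supported_def intro!: continuous_intros p\<eta>c)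
      then have "compactly_supported (\<lambda>x. (\<Sum>b\<in>Basis. (partial_deriv b \<eta> x)\<^sup>2) * (norm (V x))\<^sup>2)"
        by (intro compactly_supported_times) (simp add: continuous_compact_def)
      then show ?thesis unfolding e2
        using c by (intro integrable_compactly_supported) auto
    qed
    have Fi: "integrable lborel F" unfolding F_def
      by (intro Bochner_Integration.integrable_sum integrable_mult_right Bochner_Integration.integrable_diff Qi qi)
    have "\<kappa> * (\<integral>x. (s x)\<^sup>2 \<partial>lborel) = \<kappa> * (\<Sum>b\<in>Basis. \<integral>x. (norm (partial_deriv b w x))\<^sup>2 \<partial>lborel)"
      unfolding s2 by (simp add: Bochner_Integration.integral_sum si)
    also have "\<dots> \<le> Re (\<Sum>\<alpha>\<in>UNIV. \<Sum>\<beta>\<in>UNIV. \<Sum>j\<in>Basis. \<Sum>k\<in>Basis. a j k $ \<alpha> $ \<beta> * (\<integral>x. Q j k \<alpha> \<beta> x \<partial>lborel))"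
      unfolding Q_def by (rule garding[OF ell w wsupp])
    also have "(\<Sum>\<alpha>\<in>UNIV. \<Sum>\<beta>\<in>UNIV. \<Sum>j\<in>Basis. \<Sum>k\<in>Basis. a j k $ \<alpha> $ \<beta> * (\<integral>x. Q j k \<alpha> \<beta> x \<partial>lborel)) = integral\<^sup>L lborel F"
      unfolding F_def
      by (simp add: Bochner_Integration.integral_sum Bochner_Integration.integrable_sum integrable_mult_right
          Bochner_Integration.integrable_diff Qi qi q0)
    also have "Re (integral\<^sup>L lborel F) \<le> norm (integral\<^sup>L lborel F)" by (rule complex_Re_le_cmod)
    also have "\<dots> \<le> (\<integral>x. norm (F x) \<partial>lborel)" by (rule integral_norm_bound)
    also have "\<dots> \<le> (\<integral>x. \<kappa> / 2 * (s x)\<^sup>2 + B * (e x)\<^sup>2 \<partial>lborel)"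
      using Fi s2i e2i Fb by (intro integral_mono) auto
    also have "\<dots> = \<kappa> / 2 * (\<integral>x. (s x)\<^sup>2 \<partial>lborel) + B * (\<integral>x. (e x)\<^sup>2 \<partial>lborel)"
      using s2i e2i by simp
    \<comment> \<open>Half of the energy on the left absorbs the term with \<kappa>/2, which gives
      the factor 2 B / \<kappa>.\<close>
    finally have "(\<integral>x. (s x)\<^sup>2 \<partial>lborel) \<le> (2 * B / \<kappa>) * (\<integral>x. (e x)\<^sup>2 \<partial>lborel)"
      using \<kappa> by (simp add: field_simps)
    then have "(\<Sum>b\<in>Basis. \<integral>x. (norm (partial_deriv b w x))\<^sup>2 \<partial>lborel) \<le> (2 * B / \<kappa>) * (\<integral>x. (e x)\<^sup>2 \<partial>lborel)"
      unfolding s2 by (simp add: Bochner_Integration.integral_sum si)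
    then show ?thesis using w unfolding e2 w_def[abs_def] by simp
  qed
  have "0 \<le> 2 * B / \<kappa>" using B \<kappa> by simp
  then show ?thesis using main by blast
qed

section \<open>Energy of tangential differences\<close>

text \<open>A step from 0 on x <= 1 to 1 on x >= 2. It is assembled from squares of positive parts,
  which are continuously differentiable; this is the regularity that \<open>C1_on_UNIV\<close> asks
  of a cutoff.\<close>

definition smooth_step :: "real \<Rightarrow> real" where
  "smooth_step x = 1 - (max 0 (1 - (max 0 (x - 1))\<^sup>2))\<^sup>2"

definition smooth_step' :: "real \<Rightarrow> real" where
  "smooth_step' x = 4 * max 0 (1 - (max 0 (x - 1))\<^sup>2) * max 0 (x - 1)"

lemma DERIV_square_max: "((\<lambda>y::real. (max 0 y)\<^sup>2) has_real_derivative 2 * max 0 y) (at y)"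
proof (cases "y = 0")
  case True
  have "((\<lambda>h :: real. (max 0 h)\<^sup>2 / h) \<longlongrightarrow> 0) (at 0)"
  proof (rule Lim_null_comparison[OF always_eventually], rule allI)
    fix h :: real
    show "norm ((max 0 h)\<^sup>2 / h) \<le> \<bar>h\<bar>"
      by (cases "h > 0") (auto simp: max_def power2_eq_square)
  qed (auto intro!: tendsto_eq_intros)
  then show ?thesis using True by (simp add: DERIV_def)
next
  case False
  then consider "y > 0" | "y < 0" by linarith
  then show ?thesis
  proof cases
    case 1
    have "((\<lambda>y::real. y\<^sup>2) has_real_derivative 2 * max 0 y) (at y)"
      using 1 by (auto intro!: derivative_eq_intros)
    then show ?thesis
      by (rule has_field_derivative_transform_within_open[of _ _ _ "{0<..}"]) (use 1 in auto)
  next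
    case 2
    have "((\<lambda>y::real. 0) has_real_derivative 2 * max 0 y) (at y)"
      using 2 by simp
    then show ?thesis
      by (rule has_field_derivative_transform_within_open[of _ _ _ "{..<0}"]) (use 2 in auto)
  qed
qed

lemma DERIV_smooth_step: "(smooth_step has_real_derivative smooth_step' x) (at x)"
proof -
  have "((\<lambda>x. (max 0 (x - 1))\<^sup>2) has_real_derivative 2 * max 0 (x - 1) * 1) (at x)"
    by (rule DERIV_chain2[OF DERIV_square_max]) (auto intro!: derivative_eq_intros)
  then have 1: "((\<lambda>x. 1 - (max 0 (x - 1))\<^sup>2) has_real_derivative - (2 * max 0 (x - 1))) (at x)"
    using DERIV_diff[OF DERIV_const] by fastforce
  have "((\<lambda>x. 1 - (max 0 (1 - (max 0 (x - 1))\<^sup>2))\<^sup>2) has_real_derivative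
     0 - 2 * max 0 (1 - (max 0 (x - 1))\<^sup>2) * (- (2 * max 0 (x - 1)))) (at x)"
    by (rule DERIV_diff[OF DERIV_const DERIV_chain2[OF DERIV_square_max 1]])
  then show ?thesis unfolding smooth_step_def[abs_def] smooth_step'_def by (simp add: mult.assoc)
qed

lemma smooth_step_bounds: "0 \<le> smooth_step x" "smooth_step x \<le> 1"
proof -
  have "max 0 (1 - (max 0 (x - 1))\<^sup>2) \<le> 1" by simp
  then have "(max 0 (1 - (max 0 (x - 1))\<^sup>2))\<^sup>2 \<le> 1" by (simp add: power_le_one)
  then show "0 \<le> smooth_step x" "smooth_step x \<le> 1" unfolding smooth_step_def by auto
qed

lemma smooth_step_low: "x \<le> 1 \<Longrightarrow> smooth_step x = 0" "x \<le> 1 \<Longrightarrow> smooth_step' x = 0"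
  by (simp_all add: smooth_step_def smooth_step'_def)

lemma smooth_step_high:
  assumes "2 \<le> x"
  shows "smooth_step x = 1" "smooth_step' x = 0"
proof -
  have "1 \<le> (x - 1)\<^sup>2" using assms by (simp add: one_le_power)
  then show "smooth_step x = 1" "smooth_step' x = 0" using assms by (simp_all add: smooth_step_def smooth_step'_def)
qed

lemma smooth_step'_bound: "\<bar>smooth_step' x\<bar> \<le> 4"
proof (cases "x \<le> 2")
  case True
  have "max 0 (1 - (max 0 (x - 1))\<^sup>2) * max 0 (x - 1) \<le> 1 * 1"
    using True by (intro mult_mono) auto
  then show ?thesis by (simp add: smooth_step'_def abs_mult)
qed (simp add: smooth_step_high)

lemma continuous_smooth_step': "continuous_on UNIV smooth_step'"
  unfolding smooth_step'_def[abs_def] by (intro continuous_intros)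

lemma continuous_smooth_step: "continuous_on UNIV smooth_step"
  unfolding smooth_step_def[abs_def] by (intro continuous_intros)

text \<open>Equal to 1 on the part of the ball of radius R above height 2 s, and 0 below height s.
  The squared norm keeps the radial factor differentiable at the origin; this factor reaches 0 at x
  \<bullet> x = 2 R^2, inside radius 2 R.\<close>

definition half_ball_cutoff :: "real \<Rightarrow> real \<Rightarrow> 'a::euclidean_space \<times> real \<Rightarrow> real" where
  "half_ball_cutoff R s x = (1 - smooth_step (x \<bullet> x / R\<^sup>2)) * smooth_step (snd x / s)"

lemma half_ball_cutoff_eq_0:
  assumes "R > 0" "s > 0" "\<not> (norm x \<le> 2 * R \<and> s \<le> snd x)"
  shows "half_ball_cutoff R s x = 0"
proof (cases "s \<le> snd x")
  case True
  then have "2 * R < norm x" using assms by simp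
  then have "(2 * R)\<^sup>2 \<le> x \<bullet> x"
    using assms(1) unfolding power2_norm_eq_inner[symmetric] by (intro power_mono) auto
  moreover have "2 * R\<^sup>2 \<le> (2 * R)\<^sup>2" by (simp add: power_mult_distrib)
  ultimately have "2 * R\<^sup>2 \<le> x \<bullet> x" by linarith
  then have "2 \<le> x \<bullet> x / R\<^sup>2" using assms(1) by (simp add: pos_le_divide_eq)
  then show ?thesis by (simp add: half_ball_cutoff_def smooth_step_high)
qed (use assms in \<open>simp add: half_ball_cutoff_def smooth_step_low\<close>)

lemma half_ball_cutoff_eq_1:
  assumes "R > 0" "s > 0" "norm x \<le> R" "2 * s \<le> snd x"
  shows "half_ball_cutoff R s x = 1"
proof -
  have "x \<bullet> x \<le> R\<^sup>2" using assms unfolding power2_norm_eq_inner[symmetric] by (intro power_mono) auto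
  then show ?thesis using assms
    by (simp add: half_ball_cutoff_def smooth_step_high smooth_step_low field_simps)
qed

lemma half_ball_cutoff_derivative:
  assumes "R > 0" "s > 0"
  shows "(half_ball_cutoff R s has_derivative (\<lambda>h.
     (1 - smooth_step (x \<bullet> x / R\<^sup>2)) * (smooth_step' (snd x / s) * (snd h / s))
     + - (smooth_step' (x \<bullet> x / R\<^sup>2) * (2 * (x \<bullet> h) / R\<^sup>2)) * smooth_step (snd x / s))) (at x)"
proof -
  have 1: "((\<lambda>x. x \<bullet> x / R\<^sup>2) has_derivative (\<lambda>h. 2 * (x \<bullet> h) / R\<^sup>2)) (at x)"
  proof -
    have "((\<lambda>x. x \<bullet> x) has_derivative (\<lambda>h. 2 * (x \<bullet> h))) (at x)"
      by (auto intro!: derivative_eq_intros simp: inner_commute)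
    from has_derivative_mult_left[OF this, of "inverse (R\<^sup>2)"] show ?thesis by (simp add: divide_inverse)
  qed
  have 2: "((\<lambda>x. snd x / s) has_derivative (\<lambda>h. snd h / s)) (at x)"
    using assms by (auto intro!: derivative_eq_intros)
  have 3: "((\<lambda>x. smooth_step (x \<bullet> x / R\<^sup>2)) has_derivative (\<lambda>h. smooth_step' (x \<bullet> x / R\<^sup>2) * (2 * (x \<bullet> h) / R\<^sup>2))) (at x)"
    by (rule has_derivative_compose[OF 1 has_field_derivative_imp_has_derivative[OF DERIV_smooth_step]])
  have 4: "((\<lambda>x. smooth_step (snd x / s)) has_derivative (\<lambda>h. smooth_step' (snd x / s) * (snd h / s))) (at x)"
    by (rule has_derivative_compose[OF 2 has_field_derivative_imp_has_derivative[OF DERIV_smooth_step]])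
  have 5: "((\<lambda>x. 1 - smooth_step (x \<bullet> x / R\<^sup>2)) has_derivative (\<lambda>h. - (smooth_step' (x \<bullet> x / R\<^sup>2) * (2 * (x \<bullet> h) / R\<^sup>2)))) (at x)"
    using has_derivative_diff[OF has_derivative_const 3] by simp
  show ?thesis unfolding half_ball_cutoff_def[abs_def] by (rule has_derivative_mult[OF 5 4])
qed

lemma partial_half_ball_cutoff:
  assumes "R > 0" "s > 0"
  shows "partial_deriv b (half_ball_cutoff R s) x =
     (1 - smooth_step (x \<bullet> x / R\<^sup>2)) * (smooth_step' (snd x / s) * (snd b / s))
     + - (smooth_step' (x \<bullet> x / R\<^sup>2) * (2 * (x \<bullet> b) / R\<^sup>2)) * smooth_step (snd x / s)"
  by (rule partial_deriv_eq[OF half_ball_cutoff_derivative[OF assms]])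

lemma half_ball_cutoff_C1:
  assumes "R > 0" "s > 0"
  shows "C1_on_UNIV (half_ball_cutoff R s)" "compactly_supported (half_ball_cutoff R s)"
proof -
  show "C1_on_UNIV (half_ball_cutoff R s)"
    unfolding C1_on_UNIV_def
  proof (intro conjI allI ballI)
    show "half_ball_cutoff R s differentiable at x" for x
      by (rule differentiableI[OF half_ball_cutoff_derivative[OF assms]])
    fix b
    show "continuous_on UNIV (partial_deriv b (half_ball_cutoff R s))"
      unfolding partial_half_ball_cutoff[OF assms, abs_def]
      using assms
      by (intro continuous_intros continuous_on_compose2[OF continuous_smooth_step]
          continuous_on_compose2[OF continuous_smooth_step']) auto
  qed
  show "compactly_supported (half_ball_cutoff R s)"
    unfolding compactly_supported_def
    by (rule exI[of _ "2 * R"]) (use half_ball_cutoff_eq_0[OF assms] in force)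
qed

lemma partial_half_ball_cutoff_bound:
  assumes "R > 0" "s > 0" "b \<in> Basis"
  shows "(partial_deriv b (half_ball_cutoff R s) x)\<^sup>2
    \<le> (if norm x \<le> 2 * R \<and> 0 < snd x then 512 / R\<^sup>2 + (if s \<le> snd x \<and> snd x \<le> 2 * s then 32 / s\<^sup>2 else 0) else 0)"
proof (cases "norm x \<le> 2 * R \<and> s \<le> snd x")
  case False
  define T where "T = {x :: 'a \<times> real. norm x \<le> 2 * R \<and> s \<le> snd x}"
  have "closed T" unfolding T_def by (intro closed_Collect_conj closed_Collect_le continuous_intros)
  have "partial_deriv b (half_ball_cutoff R s) x = partial_deriv b (\<lambda>_. 0) x"
    by (rule partial_deriv_cong[of "- T"])
       (use \<open>closed T\<close> False half_ball_cutoff_eq_0[OF assms(1,2)] in \<open>auto simp: T_def\<close>)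
  also have "\<dots> = 0" by (rule partial_deriv_eq[OF has_derivative_const])
  finally show ?thesis by simp
next
  case True
  \<comment> \<open>The contributions of the vertical and of the radial factor. From
    |\<open>smooth_step'\<close>| <= 4 and |x| <= 2 R one gets |p| <= 4/s and |q| <= 16/R; squaring
    the sum doubles 16/s^2 and 256/R^2.\<close>
  define p where "p = (1 - smooth_step (x \<bullet> x / R\<^sup>2)) * (smooth_step' (snd x / s) * (snd b / s))"
  define q where "q = - (smooth_step' (x \<bullet> x / R\<^sup>2) * (2 * (x \<bullet> b) / R\<^sup>2)) * smooth_step (snd x / s)"
  have "\<bar>snd b\<bar> \<le> 1" using norm_snd_le_norm[of b] assms(3) by simp
  then have m1: "\<bar>smooth_step' (snd x / s)\<bar> * (\<bar>snd b\<bar> / s) \<le> 4 * (1 / s)"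
    using assms(2) by (intro mult_mono smooth_step'_bound divide_right_mono) auto
  have m2: "\<bar>1 - smooth_step (x \<bullet> x / R\<^sup>2)\<bar> \<le> 1" using smooth_step_bounds[of "x \<bullet> x / R\<^sup>2"] by simp
  have "\<bar>1 - smooth_step (x \<bullet> x / R\<^sup>2)\<bar> * (\<bar>smooth_step' (snd x / s)\<bar> * (\<bar>snd b\<bar> / s)) \<le> 1 * (4 * (1 / s))"
    by (rule mult_mono[OF m2 m1]) (use assms(2) in auto)
  then have p: "\<bar>p\<bar> \<le> 4 / s" using assms(2) by (simp add: p_def abs_mult)
  have "\<bar>x \<bullet> b\<bar> \<le> 2 * R" using Basis_le_norm[OF assms(3), of x] True by simp
  then have "2 * \<bar>x \<bullet> b\<bar> / R\<^sup>2 \<le> 2 * (2 * R) / R\<^sup>2" using assms(1) by (intro divide_right_mono) auto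
  then have m3: "\<bar>smooth_step' (x \<bullet> x / R\<^sup>2)\<bar> * (2 * \<bar>x \<bullet> b\<bar> / R\<^sup>2) \<le> 4 * (2 * (2 * R) / R\<^sup>2)"
    by (rule mult_mono[OF smooth_step'_bound]) auto
  have m4: "\<bar>smooth_step (snd x / s)\<bar> \<le> 1" using smooth_step_bounds[of "snd x / s"] by simp
  have "\<bar>smooth_step' (x \<bullet> x / R\<^sup>2)\<bar> * (2 * \<bar>x \<bullet> b\<bar> / R\<^sup>2) * \<bar>smooth_step (snd x / s)\<bar> \<le> 4 * (2 * (2 * R) / R\<^sup>2) * 1"
    by (rule mult_mono[OF m3 m4]) (use assms(1) in auto)
  also have "4 * (2 * (2 * R) / R\<^sup>2) * 1 = 16 / R" using assms(1) by (simp add: power2_eq_square)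
  finally have q: "\<bar>q\<bar> \<le> 16 / R" using assms(1) by (simp add: q_def abs_mult)
  have "p\<^sup>2 \<le> (4 / s)\<^sup>2" "q\<^sup>2 \<le> (16 / R)\<^sup>2"
    using p q assms by (simp_all add: abs_le_square_iff[symmetric])
  then have pq: "p\<^sup>2 \<le> 16 / s\<^sup>2" "q\<^sup>2 \<le> 256 / R\<^sup>2" by (simp_all add: power_divide)
  have p0: "p = 0" if "\<not> snd x \<le> 2 * s"
    using that assms(2) by (simp add: p_def smooth_step_high field_simps)
  have "(p + q)\<^sup>2 \<le> 2 * p\<^sup>2 + 2 * q\<^sup>2"
    using zero_le_power2[of "p - q"] by (simp add: power2_eq_square algebra_simps)
  also have "\<dots> \<le> 2 * p\<^sup>2 + 2 * (256 / R\<^sup>2)" using pq(2) by simp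
  finally have "(p + q)\<^sup>2 \<le> 2 * p\<^sup>2 + 512 / R\<^sup>2" by simp
  moreover have "2 * p\<^sup>2 \<le> (if s \<le> snd x \<and> snd x \<le> 2 * s then 32 / s\<^sup>2 else 0)"
    using pq(1) p0 True by auto
  ultimately have "(p + q)\<^sup>2 \<le> 512 / R\<^sup>2 + (if s \<le> snd x \<and> snd x \<le> 2 * s then 32 / s\<^sup>2 else 0)"
    by linarith
  then show ?thesis
    using True assms(2) by (auto simp: partial_half_ball_cutoff[OF assms(1,2)] p_def q_def)
qed

text \<open>Values in \<open>ennreal\<close> postpone every question of finiteness. The indicator is
  there because V is arbitrary outside the open half-space, where it need not even be
  measurable.\<close>

definition half_ball_energy :: "('a::euclidean_space \<times> real \<Rightarrow> 'b::euclidean_space) \<Rightarrow> real \<Rightarrow> ennreal" where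
  "half_ball_energy V R = (\<integral>\<^sup>+x. ennreal ((norm (indicator upper_half_space x *\<^sub>R V x))\<^sup>2) * indicator (cball 0 R) x \<partial>lborel)"

text \<open>Any exponent strictly between \<open>1/2\<close> and \<open>1\<close> would do: below \<open>1\<close> it is attained by Poisson integrals of
  Lipschitz data, and above \<open>1/2\<close> the cutoff near the boundary costs no energy in the limit.\<close>

definition vanishing_solution :: "('a::euclidean_space \<times> real, 'M::finite) system \<Rightarrow> ('a \<times> real \<Rightarrow> complex^'M) \<Rightarrow> bool" where
  "vanishing_solution a V \<longleftrightarrow> smooth_on upper_half_space V \<and> (\<forall>x\<in>upper_half_space. apply_system a V x = 0) \<and>
    (\<forall>R>0. \<exists>B. \<forall>x. 0 < snd x \<longrightarrow> norm x \<le> R \<longrightarrow> norm (V x) \<le> B * snd x powr (3/4))"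

text \<open>A tangential shift preserves heights, so the bound by t^(3/4) is inherited from a larger
  ball. This closes the class under the differences that are iterated later.\<close>

lemma vanishing_solution_difference:
  assumes "vanishing_solution a V" "snd h = 0"
  shows "vanishing_solution a (\<lambda>x. V (x + h) - V x)"
proof -
  have mem: "x + h \<in> upper_half_space" if "x \<in> upper_half_space" for x
    using that assms(2) by (simp add: upper_half_space_iff)
  have V: "smooth_on upper_half_space V" "\<And>x. x \<in> upper_half_space \<Longrightarrow> apply_system a V x = 0"
    using assms(1) by (auto simp: vanishing_solution_def)
  have Vh: "smooth_on upper_half_space (\<lambda>x. V (x + h))" by (rule smooth_on_translate[OF V(1) mem])
  have "\<exists>B. \<forall>x. 0 < snd x \<longrightarrow> norm x \<le> R \<longrightarrow> norm (V (x + h) - V x) \<le> B * snd x powr (3/4)" if "R > 0" for R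
  proof -
    have "0 < R + norm h" using that by (simp add: add_pos_nonneg)
    then obtain B where B: "\<And>x. 0 < snd x \<Longrightarrow> norm x \<le> R + norm h \<Longrightarrow> norm (V x) \<le> B * snd x powr (3/4)"
      using assms(1) unfolding vanishing_solution_def by blast
    have "norm (V (x + h) - V x) \<le> (2 * B) * snd x powr (3/4)" if x: "0 < snd x" "norm x \<le> R" for x
    proof -
      have "norm (x + h) \<le> R + norm h" using x norm_triangle_ineq[of x h] by linarith
      moreover have "norm x \<le> R + norm h" using x by (simp add: add_increasing2)
      ultimately have "norm (V (x + h)) + norm (V x) \<le> B * snd x powr (3/4) + B * snd x powr (3/4)"
        using B[of "x + h"] B[of x] x assms(2) by (intro add_mono) auto
      then show ?thesis using norm_triangle_ineq4[of "V (x + h)" "V x"] by simp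
    qed
    then show ?thesis by blast
  qed
  moreover have "apply_system a (\<lambda>x. V (x + h) - V x) x = 0" if "x \<in> upper_half_space" for x
    using apply_system_diff[OF open_upper_half_space Vh V(1) that] apply_system_translate[of a V h x] V(2) mem that by simp
  ultimately show ?thesis
    unfolding vanishing_solution_def using smooth_on_diff[OF open_upper_half_space Vh V(1)] by blast
qed

lemma ennreal_integral_le: "(\<And>x. 0 \<le> g x) \<Longrightarrow> ennreal (integral\<^sup>L M g) \<le> (\<integral>\<^sup>+x. ennreal (g x) \<partial>M)"
  by (cases "integrable M g") (auto simp: nn_integral_eq_integral not_integrable_integral_eq)

lemma ennreal_mult_combination:
  assumes "0 \<le> p" "0 \<le> q" "0 \<le> m" "0 \<le> n"
  shows "ennreal p * (ennreal q * X + ennreal m * ennreal n) = ennreal (p * q) * X + ennreal (p * (m * n))"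
  using assms by (simp add: distrib_left mult.assoc ennreal_mult)

text \<open>The layer \<open>s \<le> t \<le> 2 s\<close>, where the cutoff has slope of order \<open>1/s\<close>, contributes at most a multiple of
  \<open>s\<^bsup>-2\<^esup> s\<^bsup>3/2\<^esup> s = s\<^bsup>1/2\<^esup>\<close>, which vanishes as \<open>s\<close> tends to \<open>0\<close>.\<close>

lemma half_ball_energy_difference:
  fixes a :: "('a::euclidean_space \<times> real, 'M::finite) system"
  assumes "strongly_elliptic a"
  shows "\<exists>C\<ge>0. \<forall>V b r R. vanishing_solution a V \<longrightarrow> b \<in> Basis \<longrightarrow> R > 0 \<longrightarrow> \<bar>r\<bar> \<le> R \<longrightarrow>
    half_ball_energy (\<lambda>x. V (x + (r *\<^sub>R b, 0)) - V x) R \<le> ennreal (C * r\<^sup>2 / R\<^sup>2) * half_ball_energy V (4 * R)"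
proof -
  obtain C where C: "C \<ge> 0" and cacc: "\<And>S T V \<eta>. open S \<Longrightarrow> closed T \<Longrightarrow> T \<subseteq> S \<Longrightarrow> smooth_on S V \<Longrightarrow> (\<forall>x\<in>S. apply_system a V x = 0) \<Longrightarrow>
    C1_on_UNIV \<eta> \<Longrightarrow> compactly_supported \<eta> \<Longrightarrow> (\<forall>x. x \<notin> T \<longrightarrow> \<eta> x = 0) \<Longrightarrow>
      C1_on_UNIV (\<lambda>x. \<eta> x *\<^sub>R V x) \<and>
      (\<Sum>b\<in>Basis. \<integral>x. (norm (partial_deriv b (\<lambda>x. \<eta> x *\<^sub>R V x) x))\<^sup>2 \<partial>lborel)
        \<le> C * (\<integral>x. (\<Sum>b\<in>Basis. (partial_deriv b \<eta> x)\<^sup>2) * (norm (V x))\<^sup>2 \<partial>lborel)"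
    using caccioppoli[OF assms] by blast
  define N where "N = real DIM('a \<times> real)"
  have main: "half_ball_energy (\<lambda>x. V (x + (r *\<^sub>R b, 0)) - V x) R \<le> ennreal (C * N * 128 * r\<^sup>2 / R\<^sup>2) * half_ball_energy V (4 * R)"
    if V: "vanishing_solution a V" and b: "b \<in> Basis" and R: "R > 0" and r: "\<bar>r\<bar> \<le> R" for V b r R
  proof -
    define h :: "'a \<times> real" where "h = r *\<^sub>R (b, 0)"
    have h: "snd h = 0" "norm h \<le> R" "(r *\<^sub>R b, 0) = h" using b r by (simp_all add: h_def)
    have Vs: "smooth_on upper_half_space V" "\<forall>x\<in>upper_half_space. apply_system a V x = 0"
      using V by (auto simp: vanishing_solution_def)
    have uhs [measurable]: "(upper_half_space :: ('a \<times> real) set) \<in> sets borel"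
      using open_upper_half_space by (rule borel_open)
    define V0 where "V0 x = indicator upper_half_space x *\<^sub>R V x" for x
    have V0 [measurable]: "V0 \<in> borel_measurable borel" unfolding V0_def[abs_def]
      by (rule borel_measurable_continuous_on_indicator[OF uhs smooth_on_continuous_on[OF Vs(1)]])
    obtain B where B: "\<And>x. 0 < snd x \<Longrightarrow> norm x \<le> 4 * R \<Longrightarrow> norm (V x) \<le> B * snd x powr (3/4)"
      using V R unfolding vanishing_solution_def by (metis mult_pos_pos zero_less_numeral)
    \<comment> \<open>v s is the volume of a cylinder that contains the layer s <= t <= 2 s of the
      ball of radius 4 R.\<close>
    define v where "v = unit_ball_vol (real DIM('a)) * (4 * R) ^ DIM('a)"
    have v: "v \<ge> 0" using R by (simp add: v_def)
    have [measurable]: "cball (0 :: 'a \<times> real) \<rho> \<in> sets borel" for \<rho> by (rule borel_closed[OF closed_cball])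
    define D where "D x = ennreal ((norm (indicator upper_half_space x *\<^sub>R (V (x + h) - V x)))\<^sup>2) * indicator (cball 0 R) x" for x
    have D [measurable]: "D \<in> borel_measurable borel"
    proof -
      have "smooth_on upper_half_space (\<lambda>x. V (x + h) - V x)"
        using vanishing_solution_difference[OF V h(1)] by (simp add: vanishing_solution_def)
      then have "(\<lambda>x. indicator upper_half_space x *\<^sub>R (V (x + h) - V x)) \<in> borel_measurable borel"
        by (intro borel_measurable_continuous_on_indicator[OF uhs smooth_on_continuous_on])
      then show ?thesis unfolding D_def[abs_def] by measurable
    qed
    have bound: "(\<integral>\<^sup>+x. D x * indicator {x. 2 * s \<le> snd x} x \<partial>lborel)
        \<le> ennreal (C * N * 128 * r\<^sup>2 / R\<^sup>2) * half_ball_energy V (4 * R) + ennreal (r\<^sup>2 * C * N * 32 * B\<^sup>2 * 2 powr (3/2) * v * s powr (1/2))"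
      if s: "s > 0" for s
    proof -
      \<comment> \<open>With radius 2 R the cutoff is 1 at both x and x + h whenever |x| <= R and
        the height is at least 2 s, and it vanishes outside radius 4 R.\<close>
      define \<eta> :: "'a \<times> real \<Rightarrow> real" where "\<eta> = half_ball_cutoff (2 * R) s"
      define w where "w x = \<eta> x *\<^sub>R V x" for x
      have R2: "0 < 2 * R" using R by simp
      define T where "T = {x :: 'a \<times> real. norm x \<le> 2 * (2 * R) \<and> s \<le> snd x}"
      have "closed T" unfolding T_def by (intro closed_Collect_conj closed_Collect_le continuous_intros)
      moreover have "T \<subseteq> upper_half_space" using s by (auto simp: T_def upper_half_space_iff)
      moreover have "\<forall>x. x \<notin> T \<longrightarrow> \<eta> x = 0" using half_ball_cutoff_eq_0[OF R2 s] by (auto simp: T_def \<eta>_def)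
      ultimately have wC1: "C1_on_UNIV w"
        and wle: "(\<Sum>b\<in>Basis. \<integral>x. (norm (partial_deriv b w x))\<^sup>2 \<partial>lborel)
          \<le> C * (\<integral>x. (\<Sum>b\<in>Basis. (partial_deriv b \<eta> x)\<^sup>2) * (norm (V x))\<^sup>2 \<partial>lborel)"
        using cacc[OF open_upper_half_space _ _ Vs half_ball_cutoff_C1[OF R2 s]]
        unfolding \<eta>_def w_def[abs_def] by blast+
      have wsupp: "compactly_supported w"
        using half_ball_cutoff_C1(2)[OF R2 s] unfolding w_def \<eta>_def compactly_supported_def by force
      have w1: "w x = V x" if "norm x \<le> 2 * R" "2 * s \<le> snd x" for x
        using half_ball_cutoff_eq_1[OF R2 s that] by (simp add: w_def \<eta>_def)
      have "(\<integral>\<^sup>+x. D x * indicator {x. 2 * s \<le> snd x} x \<partial>lborel) \<le> (\<integral>\<^sup>+x. ennreal ((norm (w (h + x) - w x))\<^sup>2) \<partial>lborel)"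
      proof (rule nn_integral_mono)
        fix x :: "'a \<times> real"
        show "D x * indicator {x. 2 * s \<le> snd x} x \<le> ennreal ((norm (w (h + x) - w x))\<^sup>2)"
        proof (cases "norm x \<le> R \<and> 2 * s \<le> snd x")
          case True
          have "norm (x + h) \<le> 2 * R" using True h(2) norm_triangle_ineq[of x h] by linarith
          then have "w (h + x) = V (x + h)" "w x = V x"
            using True R h(1) w1[of "x + h"] w1[of x] by (auto simp: add.commute)
          moreover have "x \<in> upper_half_space" using True s by (simp add: upper_half_space_iff)
          ultimately show ?thesis using True by (simp add: D_def)
        next
          case False
          then show ?thesis by (auto simp: D_def indicator_def)
        qed
      qed
      also have "\<dots> = ennreal (\<integral>x. (norm (w (h + x) - w x))\<^sup>2 \<partial>lborel)"
        by (rule nn_integral_eq_integral[OF integral_square_difference_le(1)[OF wC1 wsupp]]) simp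
      also have "(\<integral>x. (norm (w (h + x) - w x))\<^sup>2 \<partial>lborel) \<le> r\<^sup>2 * C * (\<integral>x. (\<Sum>b\<in>Basis. (partial_deriv b \<eta> x)\<^sup>2) * (norm (V x))\<^sup>2 \<partial>lborel)"
      proof -
        have fd: "(norm (frechet_derivative w (at x) h))\<^sup>2 = r\<^sup>2 * (norm (partial_deriv (b, 0) w x))\<^sup>2" for x
        proof -
          have "linear (frechet_derivative w (at x))" using wC1 unfolding C1_on_UNIV_def by (intro linear_frechet_derivative) blast
          then have "frechet_derivative w (at x) h = r *\<^sub>R frechet_derivative w (at x) (b, 0)"
            unfolding h_def by (rule linear_scale)
          then show ?thesis by (simp add: partial_deriv_def power_mult_distrib)
        qed
        have "(\<integral>x. (norm (w (h + x) - w x))\<^sup>2 \<partial>lborel) \<le> (\<integral>x. (norm (frechet_derivative w (at x) h))\<^sup>2 \<partial>lborel)"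
          by (rule integral_square_difference_le(2)[OF wC1 wsupp])
        also have "\<dots> = r\<^sup>2 * (\<integral>x. (norm (partial_deriv (b, 0) w x))\<^sup>2 \<partial>lborel)"
          unfolding fd by simp
        also have "(\<integral>x. (norm (partial_deriv (b, 0) w x))\<^sup>2 \<partial>lborel) \<le> (\<Sum>b\<in>Basis. \<integral>x. (norm (partial_deriv b w x))\<^sup>2 \<partial>lborel)"
          by (rule member_le_sum) (use b in \<open>auto simp: Basis_prod_def\<close>)
        also note wle
        finally show ?thesis by (simp add: mult_left_mono mult.assoc)
      qed
      then have "ennreal (\<integral>x. (norm (w (h + x) - w x))\<^sup>2 \<partial>lborel)
          \<le> ennreal (r\<^sup>2 * C) * ennreal (\<integral>x. (\<Sum>b\<in>Basis. (partial_deriv b \<eta> x)\<^sup>2) * (norm (V x))\<^sup>2 \<partial>lborel)"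
        using C by (subst ennreal_mult[symmetric]) (auto intro!: ennreal_leI Bochner_Integration.integral_nonneg mult_nonneg_nonneg sum_nonneg)
      also have "\<dots> \<le> ennreal (r\<^sup>2 * C) * (\<integral>\<^sup>+x. ennreal ((\<Sum>b\<in>Basis. (partial_deriv b \<eta> x)\<^sup>2) * (norm (V x))\<^sup>2) \<partial>lborel)"
        by (intro mult_left_mono ennreal_integral_le mult_nonneg_nonneg sum_nonneg) auto
      \<comment> \<open>The constant 128 is 512 / (2 R)^2 times R^2. The second summand collects the
        layer where the cutoff is steep.\<close>
      also have "(\<integral>\<^sup>+x. ennreal ((\<Sum>b\<in>Basis. (partial_deriv b \<eta> x)\<^sup>2) * (norm (V x))\<^sup>2) \<partial>lborel)
        \<le> (\<integral>\<^sup>+x. ennreal (N * 128 / R\<^sup>2) * (ennreal ((norm (V0 x))\<^sup>2) * indicator (cball 0 (4 * R)) x)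
            + ennreal (N * 32 / s\<^sup>2 * (B\<^sup>2 * (2 * s) powr (3/2))) * indicator (cball 0 (4 * R) \<times> {s..2 * s}) x \<partial>lborel)"
      proof (rule nn_integral_mono)
        fix x :: "'a \<times> real"
        define E where "E = (\<Sum>b\<in>Basis. (partial_deriv b \<eta> x)\<^sup>2)"
        have E_le: "E \<le> N * (if norm x \<le> 2 * (2 * R) \<and> 0 < snd x then 512 / (2 * R)\<^sup>2 + (if s \<le> snd x \<and> snd x \<le> 2 * s then 32 / s\<^sup>2 else 0) else 0)"
          unfolding E_def N_def \<eta>_def
          by (rule sum_bounded_above[OF partial_half_ball_cutoff_bound[OF R2 s], THEN order_trans]) auto
        show "ennreal ((\<Sum>b\<in>Basis. (partial_deriv b \<eta> x)\<^sup>2) * (norm (V x))\<^sup>2)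
          \<le> ennreal (N * 128 / R\<^sup>2) * (ennreal ((norm (V0 x))\<^sup>2) * indicator (cball 0 (4 * R)) x)
            + ennreal (N * 32 / s\<^sup>2 * (B\<^sup>2 * (2 * s) powr (3/2))) * indicator (cball 0 (4 * R) \<times> {s..2 * s}) x"
        proof (cases "norm x \<le> 4 * R \<and> 0 < snd x")
          case False
          then have "E \<le> 0" using E_le by auto
          then have "E * (norm (V x))\<^sup>2 \<le> 0" by (simp add: mult_nonpos_nonneg)
          then show ?thesis unfolding E_def[symmetric] by (simp add: ennreal_neg)
        next
          case True
          then have V0x: "V0 x = V x" by (simp add: V0_def upper_half_space_iff)
          show ?thesis
          proof (cases "s \<le> snd x \<and> snd x \<le> 2 * s")
            case False
            then have "E \<le> N * 128 / R\<^sup>2" using E_le True by (auto simp: power_mult_distrib)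
            then have "E * (norm (V x))\<^sup>2 \<le> N * 128 / R\<^sup>2 * (norm (V x))\<^sup>2" by (intro mult_right_mono) auto
            then have "ennreal (E * (norm (V x))\<^sup>2) \<le> ennreal (N * 128 / R\<^sup>2) * ennreal ((norm (V x))\<^sup>2)"
              by (subst ennreal_mult[symmetric]) (auto intro: ennreal_leI simp: N_def)
            then show ?thesis unfolding E_def[symmetric] V0x using True
              by (simp add: add_increasing2)
          next
            case sx: True
            have E2: "E \<le> N * 128 / R\<^sup>2 + N * 32 / s\<^sup>2" using E_le True sx by (simp add: power_mult_distrib distrib_left)
            have "norm (V x) \<le> B * snd x powr (3/4)" using B True by blast
            then have "(norm (V x))\<^sup>2 \<le> (B * snd x powr (3/4))\<^sup>2" by (intro power_mono) auto
            also have "\<dots> = B\<^sup>2 * (snd x powr (3/4))\<^sup>2" by (simp add: power_mult_distrib)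
            also have "(snd x powr (3/4))\<^sup>2 = snd x powr (3/2)"
              by (simp add: power2_eq_square powr_add[symmetric])
            also have "B\<^sup>2 * snd x powr (3/2) \<le> B\<^sup>2 * (2 * s) powr (3/2)"
              using sx True by (intro mult_left_mono powr_mono2) auto
            finally have V2: "(norm (V x))\<^sup>2 \<le> B\<^sup>2 * (2 * s) powr (3/2)" .
            have "E * (norm (V x))\<^sup>2 \<le> (N * 128 / R\<^sup>2 + N * 32 / s\<^sup>2) * (norm (V x))\<^sup>2"
              using E2 by (intro mult_right_mono) auto
            also have "\<dots> = N * 128 / R\<^sup>2 * (norm (V x))\<^sup>2 + N * 32 / s\<^sup>2 * (norm (V x))\<^sup>2" by (rule distrib_right)
            also have "\<dots> \<le> N * 128 / R\<^sup>2 * (norm (V x))\<^sup>2 + N * 32 / s\<^sup>2 * (B\<^sup>2 * (2 * s) powr (3/2))"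
              by (intro add_left_mono mult_left_mono V2) (simp add: N_def)
            finally have "ennreal (E * (norm (V x))\<^sup>2) \<le> ennreal (N * 128 / R\<^sup>2 * (norm (V x))\<^sup>2 + N * 32 / s\<^sup>2 * (B\<^sup>2 * (2 * s) powr (3/2)))"
              by (rule ennreal_leI)
            also have "\<dots> = ennreal (N * 128 / R\<^sup>2) * ennreal ((norm (V x))\<^sup>2) + ennreal (N * 32 / s\<^sup>2 * (B\<^sup>2 * (2 * s) powr (3/2)))"
              by (simp add: N_def ennreal_mult[symmetric] del: of_nat_Suc)
            moreover have "x \<in> cball 0 (4 * R) \<times> {s..2 * s}"
              using sx True norm_fst_le_norm[of x] by (auto simp: mem_Times_iff)
            ultimately show ?thesis unfolding E_def[symmetric] V0x using True by simp
          qed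
        qed
      qed
      also have "\<dots> = ennreal (N * 128 / R\<^sup>2) * half_ball_energy V (4 * R)
          + ennreal (N * 32 / s\<^sup>2 * (B\<^sup>2 * (2 * s) powr (3/2))) * ennreal (v * s)"
      proof -
        have "emeasure lborel (cball (0 :: 'a) (4 * R) \<times> {s..2 * s}) = ennreal v * ennreal s"
          using R s by (simp add: lborel_prod[symmetric] lborel.emeasure_pair_measure_Times emeasure_cball v_def)
        then have "emeasure lborel (cball (0 :: 'a) (4 * R) \<times> {s..2 * s}) = ennreal (v * s)"
          using v s by (simp add: ennreal_mult)
        moreover have "cball (0 :: 'a) (4 * R) \<times> {s..2 * s} \<in> sets lborel"
          by (simp add: borel_closed closed_Times)
        ultimately show ?thesis
          by (subst nn_integral_add) (auto simp: nn_integral_cmult half_ball_energy_def V0_def[symmetric] nn_integral_cmult_indicator)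
      qed
      finally have "(\<integral>\<^sup>+x. D x * indicator {x. 2 * s \<le> snd x} x \<partial>lborel) \<le> ennreal (r\<^sup>2 * C) *
          (ennreal (N * 128 / R\<^sup>2) * half_ball_energy V (4 * R) + ennreal (N * 32 / s\<^sup>2 * (B\<^sup>2 * (2 * s) powr (3/2))) * ennreal (v * s))"
        by (simp add: mult_left_mono)
      also have "\<dots> = ennreal (C * N * 128 * r\<^sup>2 / R\<^sup>2) * half_ball_energy V (4 * R)
          + ennreal (r\<^sup>2 * C * (N * 32 / s\<^sup>2 * (B\<^sup>2 * (2 * s) powr (3/2)) * (v * s)))"
      proof -
        have eq: "r\<^sup>2 * C * (N * 128 / R\<^sup>2) = C * N * 128 * r\<^sup>2 / R\<^sup>2" by simp
        have "0 \<le> r\<^sup>2 * C" "0 \<le> N * 128 / R\<^sup>2" "0 \<le> N * 32 / s\<^sup>2 * (B\<^sup>2 * (2 * s) powr (3/2))" "0 \<le> v * s"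
          using C v s by (auto simp: N_def)
        from ennreal_mult_combination[OF this] show ?thesis unfolding eq .
      qed
      also have "r\<^sup>2 * C * (N * 32 / s\<^sup>2 * (B\<^sup>2 * (2 * s) powr (3/2)) * (v * s)) = r\<^sup>2 * C * N * 32 * B\<^sup>2 * 2 powr (3/2) * v * s powr (1/2)"
      proof -
        have "s powr (3/2) = s powr (1 + 1/2)" by simp
        also have "\<dots> = s * s powr (1/2)" using s by (subst powr_add) simp
        finally show ?thesis using s by (simp add: powr_mult power2_eq_square)
      qed
      finally show ?thesis .
    qed
    define s where "s i = inverse (real (Suc i))" for i
    have s: "s i > 0" "s \<longlonglongrightarrow> 0" "s (Suc i) \<le> s i" for i
      unfolding s_def using LIMSEQ_inverse_real_of_nat by auto
    define c where "c = r\<^sup>2 * C * N * 32 * B\<^sup>2 * 2 powr (3/2) * v"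
    have "(\<lambda>i. c * s i powr (1/2)) \<longlonglongrightarrow> c * 0 powr (1/2)"
      using s by (intro tendsto_mult tendsto_const tendsto_powr2) (auto intro: always_eventually less_imp_le)
    then have "(\<lambda>i. ennreal (c * s i powr (1/2))) \<longlonglongrightarrow> 0"
      using tendsto_ennrealI by fastforce
    then have "(\<lambda>i. ennreal (C * N * 128 * r\<^sup>2 / R\<^sup>2) * half_ball_energy V (4 * R) + ennreal (c * s i powr (1/2)))
        \<longlonglongrightarrow> ennreal (C * N * 128 * r\<^sup>2 / R\<^sup>2) * half_ball_energy V (4 * R) + 0"
      by (intro tendsto_add tendsto_const)
    \<comment> \<open>As s tends to 0, the truncated integrals increase to the full energy of the
      difference, while the contribution of the layer disappears.\<close>
    moreover have "(\<lambda>i. \<integral>\<^sup>+x. D x * indicator {x. 2 * s i \<le> snd x} x \<partial>lborel) \<longlonglongrightarrow> (\<integral>\<^sup>+x. D x \<partial>lborel)"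
    proof (rule nn_integral_LIMSEQ)
      show "incseq (\<lambda>i x. D x * indicator {x. 2 * s i \<le> snd x} x)"
        unfolding incseq_Suc_iff le_fun_def
      proof (intro allI)
        fix i and x :: "'a \<times> real"
        have "2 * s i \<le> snd x \<Longrightarrow> 2 * s (Suc i) \<le> snd x" using s(3)[of i] by linarith
        then show "D x * indicator {x. 2 * s i \<le> snd x} x \<le> D x * indicator {x. 2 * s (Suc i) \<le> snd x} x"
          by (simp add: indicator_def)
      qed
      have "{x :: 'a \<times> real. 2 * s i \<le> snd x} \<in> sets borel" for i
        by (intro borel_closed closed_Collect_le continuous_intros)
      then show "(\<lambda>x. D x * indicator {x. 2 * s i \<le> snd x} x) \<in> borel_measurable lborel" for i
        by (intro borel_measurable_times_ennreal) auto
      fix x :: "'a \<times> real"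
      show "(\<lambda>i. D x * indicator {x. 2 * s i \<le> snd x} x) \<longlonglongrightarrow> D x"
      proof (cases "0 < snd x")
        case True
        have "\<forall>\<^sub>F i in sequentially. s i < snd x / 2"
          using order_tendstoD(2)[OF s(2), of "snd x / 2"] True by simp
        then have "\<forall>\<^sub>F i in sequentially. D x * indicator {x. 2 * s i \<le> snd x} x = D x"
          by eventually_elim (auto simp: indicator_def)
        then show ?thesis by (rule tendsto_eventually)
      next
        case False
        then have "D x = 0" by (simp add: D_def upper_half_space_iff)
        then show ?thesis by simp
      qed
    qed
    ultimately have "(\<integral>\<^sup>+x. D x \<partial>lborel) \<le> ennreal (C * N * 128 * r\<^sup>2 / R\<^sup>2) * half_ball_energy V (4 * R) + 0"
      using bound[OF s(1)] unfolding c_def by (intro LIMSEQ_le) (auto simp: mult_ac)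
    moreover have "half_ball_energy (\<lambda>x. V (x + h) - V x) R = (\<integral>\<^sup>+x. D x \<partial>lborel)"
      by (simp only: half_ball_energy_def D_def)
    ultimately show ?thesis unfolding h(3) by simp
  qed
  have "C * N * 128 \<ge> 0" using C by (simp add: N_def)
  then show ?thesis using main by (intro exI[of _ "C * N * 128"]) auto
qed

section \<open>A Liouville theorem in the half-space\<close>

lemma half_ball_energy_mono: "R \<le> R' \<Longrightarrow> half_ball_energy V R \<le> half_ball_energy V R'"
  unfolding half_ball_energy_def by (intro nn_integral_mono mult_left_mono) (auto simp: indicator_def)

lemma half_ball_energy_le:
  fixes V :: "'a::euclidean_space \<times> real \<Rightarrow> 'b::euclidean_space"
  assumes "\<And>x. 0 < snd x \<Longrightarrow> norm (V x) \<le> B * (1 + snd x)" "B \<ge> 0" "R \<ge> 1"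
  shows "half_ball_energy V R \<le> ennreal (B\<^sup>2 * (2 * R)\<^sup>2 * (unit_ball_vol (real DIM('a \<times> real)) * R ^ DIM('a \<times> real)))"
proof -
  have "half_ball_energy V R \<le> (\<integral>\<^sup>+x. ennreal (B\<^sup>2 * (2 * R)\<^sup>2) * indicator (cball (0 :: 'a \<times> real) R) x \<partial>lborel)"
    unfolding half_ball_energy_def
  proof (intro nn_integral_mono)
    fix x :: "'a \<times> real"
    show "ennreal ((norm (indicator upper_half_space x *\<^sub>R V x))\<^sup>2) * indicator (cball 0 R) x
        \<le> ennreal (B\<^sup>2 * (2 * R)\<^sup>2) * indicator (cball 0 R) x"
    proof (cases "norm x \<le> R \<and> 0 < snd x")
      case True
      have "norm (V x) \<le> B * (1 + snd x)" using assms(1) True by blast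
      also have "\<dots> \<le> B * (2 * R)"
        using True norm_snd_le_norm[of x] assms by (intro mult_left_mono) auto
      finally have "(norm (V x))\<^sup>2 \<le> (B * (2 * R))\<^sup>2" by (intro power_mono) auto
      then show ?thesis using True by (simp add: upper_half_space_iff power_mult_distrib ennreal_leI)
    next
      case False
      then have "indicator upper_half_space x = (0 :: real) \<or> indicator (cball 0 R) x = (0 :: ennreal)"
        by (auto simp: indicator_def upper_half_space_iff)
      then show ?thesis by auto
    qed
  qed
  also have "\<dots> = ennreal (B\<^sup>2 * (2 * R)\<^sup>2) * emeasure lborel (cball (0 :: 'a \<times> real) R)"
    by (rule nn_integral_cmult_indicator) simp
  also have "\<dots> = ennreal (B\<^sup>2 * (2 * R)\<^sup>2 * (unit_ball_vol (real DIM('a \<times> real)) * R ^ DIM('a \<times> real)))"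
    using assms by (subst emeasure_cball) (simp_all add: ennreal_mult[symmetric])
  finally show ?thesis .
qed

text \<open>The integrand vanishes almost everywhere, and by continuity a non-zero value would
  persist on a ball, which has positive measure.\<close>

lemma half_ball_energy_eq_0D:
  fixes W :: "'a::euclidean_space \<times> real \<Rightarrow> 'b::euclidean_space"
  assumes W: "continuous_on upper_half_space W" and zero: "\<And>R. half_ball_energy W R = 0" and x: "x \<in> upper_half_space"
  shows "W x = 0"
proof (rule ccontr)
  assume "W x \<noteq> 0"
  have uhs: "(upper_half_space :: ('a \<times> real) set) \<in> sets borel" using open_upper_half_space by (rule borel_open)
  define R where "R = norm x + 1"
  define O' where "O' = (upper_half_space \<inter> ball 0 R) \<inter> W -` (- {0})"
  have "open O'" unfolding O'_def
    by (intro continuous_open_preimage continuous_on_subset[OF W]) (auto simp: open_upper_half_space)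
  moreover have "x \<in> O'" using x \<open>W x \<noteq> 0\<close> by (simp add: O'_def R_def)
  ultimately obtain e where e: "e > 0" "ball x e \<subseteq> O'" using openE by blast
  have m: "(\<lambda>x. indicator upper_half_space x *\<^sub>R W x) \<in> borel_measurable lborel"
    using borel_measurable_continuous_on_indicator[OF uhs W] by simp
  have "(\<lambda>y. ennreal ((norm (indicator upper_half_space y *\<^sub>R W y))\<^sup>2)) \<in> borel_measurable lborel"
    using m by measurable
  then have m2: "(\<lambda>y. ennreal ((norm (indicator upper_half_space y *\<^sub>R W y))\<^sup>2) * indicator (cball 0 R) y) \<in> borel_measurable lborel"
    by (intro borel_measurable_times_ennreal borel_measurable_indicator) simp_all
  have "AE y in lborel. ennreal ((norm (indicator upper_half_space y *\<^sub>R W y))\<^sup>2) * indicator (cball 0 R) y = 0"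
    using zero[of R] m unfolding half_ball_energy_def
    by (subst (asm) nn_integral_0_iff_AE) (rule m2)
  then have "AE y in lborel. y \<notin> ball x e"
  proof eventually_elim
    case (elim y)
    show ?case
    proof
      assume "y \<in> ball x e"
      then have "y \<in> O'" using e by auto
      then show False using elim by (simp add: O'_def)
    qed
  qed
  then have "ball x e \<in> null_sets lborel" by (subst AE_iff_null_sets) simp_all
  then have "emeasure lborel (ball x e) = 0" by (rule null_setsD1)
  moreover have "emeasure lborel (ball x e) = ennreal (unit_ball_vol (real DIM('a \<times> real)) * e ^ DIM('a \<times> real))"
    using e(1) by (intro emeasure_ball) simp
  ultimately have "ennreal (unit_ball_vol (real DIM('a \<times> real)) * e ^ DIM('a \<times> real)) = 0"
    by (simp only:)
  then have "unit_ball_vol (real DIM('a \<times> real)) * e ^ DIM('a \<times> real) \<le> 0"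
    by (simp only: ennreal_eq_0_iff)
  moreover have "0 < unit_ball_vol (real DIM('a \<times> real)) * e ^ DIM('a \<times> real)"
    using e(1) by (intro mult_pos_pos zero_less_power) simp_all
  ultimately show False by linarith
qed

section \<open>Tangential differences of a solution of at most linear growth in t\<close>

context
  fixes a :: "('a::euclidean_space \<times> real, 'M::finite) system" and V :: "'a \<times> real \<Rightarrow> complex^'M" and B :: real
  assumes ell: "strongly_elliptic a" and V: "vanishing_solution a V"
    and growth: "\<And>x. 0 < snd x \<Longrightarrow> norm (V x) \<le> B * (1 + snd x)"
begin

lemma growth_constant_nonneg: "B \<ge> 0"
  using order_trans[OF norm_ge_zero growth[of "(0, 1)"]] by simp

context
  fixes b :: 'a and r :: real
  assumes b: "b \<in> Basis"
begin

definition "\<Delta> W x = W (x + (r *\<^sub>R b, 0)) - W (x :: 'a \<times> real)" for W :: "'a \<times> real \<Rightarrow> complex^'M"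

lemma iterated_difference_vanishing: "vanishing_solution a ((\<Delta> ^^ k) V)"
proof (induction k)
  case (Suc k)
  then show ?case using vanishing_solution_difference[OF Suc, of "(r *\<^sub>R b, 0)"] by (simp add: \<Delta>_def[abs_def])
qed (simp add: V)

text \<open>Each application of the energy inequality quadruples the radius, hence 4^k. The constant
  may depend on the shift r, which stays fixed while R grows.\<close>

lemma iterated_difference_energy:
  "\<exists>c\<ge>0. \<forall>R>0. \<bar>r\<bar> \<le> R \<longrightarrow> half_ball_energy ((\<Delta> ^^ k) V) R \<le> ennreal (c / R ^ (2 * k)) * half_ball_energy V (4 ^ k * R)"
proof (induction k)
  case 0
  then show ?case by (intro exI[of _ 1]) simp
next
  case (Suc k)
  then obtain c where c: "c \<ge> 0" "\<And>R. R > 0 \<Longrightarrow> \<bar>r\<bar> \<le> R \<Longrightarrow>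
      half_ball_energy ((\<Delta> ^^ k) V) R \<le> ennreal (c / R ^ (2 * k)) * half_ball_energy V (4 ^ k * R)" by blast
  obtain C where C: "C \<ge> 0" "\<And>V b r R. vanishing_solution a V \<Longrightarrow> b \<in> Basis \<Longrightarrow> R > 0 \<Longrightarrow> \<bar>r\<bar> \<le> R \<Longrightarrow>
    half_ball_energy (\<lambda>x. V (x + (r *\<^sub>R b, 0)) - V x) R \<le> ennreal (C * r\<^sup>2 / R\<^sup>2) * half_ball_energy V (4 * R)"
    using half_ball_energy_difference[OF ell] by blast
  have "half_ball_energy ((\<Delta> ^^ Suc k) V) R \<le> ennreal ((C * r\<^sup>2 * c) / R ^ (2 * Suc k)) * half_ball_energy V (4 ^ Suc k * R)"
    if R: "R > 0" "\<bar>r\<bar> \<le> R" for R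
  proof -
    have "half_ball_energy ((\<Delta> ^^ Suc k) V) R \<le> ennreal (C * r\<^sup>2 / R\<^sup>2) * half_ball_energy ((\<Delta> ^^ k) V) (4 * R)"
      using C(2)[OF iterated_difference_vanishing b R] by (simp add: \<Delta>_def[abs_def])
    also have "\<dots> \<le> ennreal (C * r\<^sup>2 / R\<^sup>2) * (ennreal (c / R ^ (2 * k)) * half_ball_energy V (4 ^ k * (4 * R)))"
    proof (intro mult_left_mono)
      have "half_ball_energy ((\<Delta> ^^ k) V) (4 * R) \<le> ennreal (c / (4 * R) ^ (2 * k)) * half_ball_energy V (4 ^ k * (4 * R))"
        using c(2)[of "4 * R"] R by simp
      \<comment> \<open>The gain 4^(-2 k) from the larger radius is given away to keep the shape of
        the claim.\<close>
      also have "\<dots> \<le> ennreal (c / R ^ (2 * k)) * half_ball_energy V (4 ^ k * (4 * R))"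
        using R c(1) by (intro mult_right_mono ennreal_leI divide_left_mono power_mono mult_pos_pos zero_less_power) auto
      finally show "half_ball_energy ((\<Delta> ^^ k) V) (4 * R) \<le> ennreal (c / R ^ (2 * k)) * half_ball_energy V (4 ^ k * (4 * R))" .
    qed simp
    also have "\<dots> = ennreal ((C * r\<^sup>2 * c) / R ^ (2 * Suc k)) * half_ball_energy V (4 ^ Suc k * R)"
    proof -
      have "ennreal (C * r\<^sup>2 / R\<^sup>2) * ennreal (c / R ^ (2 * k)) = ennreal ((C * r\<^sup>2 / R\<^sup>2) * (c / R ^ (2 * k)))"
        using C c R by (intro ennreal_mult[symmetric]) auto
      also have "(C * r\<^sup>2 / R\<^sup>2) * (c / R ^ (2 * k)) = (C * r\<^sup>2 * c) / R ^ (2 * Suc k)"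
        by (simp add: power2_eq_square)
      finally show ?thesis by (simp only: mult.assoc[symmetric] power_Suc2)
    qed
    finally show ?thesis .
  qed
  moreover have "C * r\<^sup>2 * c \<ge> 0" using C c by simp
  ultimately show ?case by blast
qed

text \<open>Every tangential difference gains a factor \<open>R\<^bsup>-2\<^esup>\<close> in energy, while the energy of \<open>V\<close> itself grows
  at most like \<open>R\<^bsup>n+2\<^esup>\<close>.\<close>

lemma high_difference_eq_0:
  assumes "x \<in> upper_half_space"
  shows "(\<Delta> ^^ (DIM('a \<times> real) + 2)) V x = 0"
proof -
  define n where "n = DIM('a \<times> real)"
  \<comment> \<open>The energy of V grows at most like R^(n+2). With k = n + 2 the powers combine to
    R^(-2 k) R^k = R^(-k), which tends to 0.\<close>
  define k where "k = n + 2"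
  define W where "W = (\<Delta> ^^ k) V"
  obtain c where c: "c \<ge> 0" "\<And>R. R > 0 \<Longrightarrow> \<bar>r\<bar> \<le> R \<Longrightarrow>
      half_ball_energy W R \<le> ennreal (c / R ^ (2 * k)) * half_ball_energy V (4 ^ k * R)"
    using iterated_difference_energy[of k] unfolding W_def by blast
  define v where "v = unit_ball_vol (real n)"
  have v: "v \<ge> 0" by (simp add: v_def)
  define c' where "c' = c * (B\<^sup>2 * 4 * v * (4 ^ k) ^ k)"
  have c': "c' \<ge> 0" using c v by (simp add: c'_def)
  have le: "half_ball_energy W R \<le> ennreal (c' / R)" if R: "R \<ge> 1" "\<bar>r\<bar> \<le> R" for R
  proof -
    have "1 * 1 \<le> 4 ^ k * R" using R by (intro mult_mono one_le_power) auto
    then have A: "half_ball_energy V (4 ^ k * R) \<le> ennreal (B\<^sup>2 * (2 * (4 ^ k * R))\<^sup>2 * (v * (4 ^ k * R) ^ n))"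
      unfolding v_def n_def by (intro half_ball_energy_le growth growth_constant_nonneg) auto
    have "half_ball_energy W R \<le> ennreal (c / R ^ (2 * k)) * half_ball_energy V (4 ^ k * R)"
      using c(2)[of R] R by simp
    also have "\<dots> \<le> ennreal (c / R ^ (2 * k)) * ennreal (B\<^sup>2 * (2 * (4 ^ k * R))\<^sup>2 * (v * (4 ^ k * R) ^ n))"
      by (rule mult_left_mono[OF A]) simp
    also have "\<dots> = ennreal (c / R ^ (2 * k) * (B\<^sup>2 * (2 * (4 ^ k * R))\<^sup>2 * (v * (4 ^ k * R) ^ n)))"
      using R c v by (intro ennreal_mult[symmetric]) auto
    also have "c / R ^ (2 * k) * (B\<^sup>2 * (2 * (4 ^ k * R))\<^sup>2 * (v * (4 ^ k * R) ^ n)) = c' / R ^ k"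
    proof -
      have "B\<^sup>2 * (2 * (4 ^ k * R))\<^sup>2 * (v * (4 ^ k * R) ^ n) = B\<^sup>2 * 4 * v * (4 ^ k * R) ^ k"
        by (simp add: k_def power_add power_mult_distrib power2_eq_square)
      also have "\<dots> = B\<^sup>2 * 4 * v * (4 ^ k) ^ k * R ^ k" by (simp only: power_mult_distrib mult.assoc)
      finally have "c / R ^ (2 * k) * (B\<^sup>2 * (2 * (4 ^ k * R))\<^sup>2 * (v * (4 ^ k * R) ^ n)) = c / R ^ (2 * k) * (B\<^sup>2 * 4 * v * (4 ^ k) ^ k * R ^ k)"
        by (rule arg_cong)
      also have "\<dots> = c' / R ^ k" using R unfolding c'_def mult_2 power_add by simp
      finally show ?thesis .
    qed
    also have "c' / R ^ k \<le> c' / R"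
      using R c' power_increasing[of 1 k R] by (intro divide_left_mono) (auto simp: k_def)
    finally show ?thesis by (simp add: ennreal_leI)
  qed
  have "half_ball_energy W R0 = 0" for R0
  proof -
    have "half_ball_energy W R0 \<le> 0 + ennreal e" if "e > 0" for e
    proof -
      \<comment> \<open>Large enough to contain the radius R0, to admit the shift r, and to make c'
        / R at most e.\<close>
      define R where "R = Max {1, \<bar>r\<bar>, R0, c' / e}"
      have R: "R \<ge> 1" "\<bar>r\<bar> \<le> R" "R0 \<le> R" "c' / e \<le> R" by (simp_all add: R_def)
      have "half_ball_energy W R0 \<le> half_ball_energy W R" by (rule half_ball_energy_mono[OF R(3)])
      also have "\<dots> \<le> ennreal (c' / R)" by (rule le[OF R(1,2)])
      also have "\<dots> \<le> ennreal e" using R(1,4) that by (intro ennreal_leI) (simp add: field_simps)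
      finally show ?thesis by simp
    qed
    then have "half_ball_energy W R0 \<le> 0" by (rule ennreal_le_epsilon)
    then show ?thesis by simp
  qed
  moreover have "continuous_on upper_half_space W"
    using iterated_difference_vanishing[of k] unfolding vanishing_solution_def W_def by (blast intro: smooth_on_continuous_on)
  ultimately show ?thesis
    using half_ball_energy_eq_0D[of W x] assms unfolding W_def k_def n_def by blast
qed

text \<open>The bound involves the height only, so it is uniform along tangential translates of
  x.\<close>

lemma iterated_difference_growth:
  "0 < snd x \<Longrightarrow> norm ((\<Delta> ^^ j) V x) \<le> 2 ^ j * (B * (1 + snd x))"
proof (induction j arbitrary: x)
  case (Suc j)
  have "norm ((\<Delta> ^^ Suc j) V x) \<le> norm ((\<Delta> ^^ j) V (x + (r *\<^sub>R b, 0))) + norm ((\<Delta> ^^ j) V x)"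
    by (simp add: \<Delta>_def norm_triangle_ineq4)
  also have "\<dots> \<le> 2 ^ j * (B * (1 + snd x)) + 2 ^ j * (B * (1 + snd x))"
    using Suc.IH[of x] Suc.IH[of "x + (r *\<^sub>R b, 0)"] Suc.prems by (intro add_mono) auto
  finally show ?case by (simp add: algebra_simps)
qed (use growth in simp)

text \<open>If the next difference vanishes, U is affine along the points x + m h with slope
  \<open>W x\<close>. Since U is bounded on them, the slope is 0.\<close>

lemma lower_difference_eq_0:
  assumes "\<And>x. x \<in> upper_half_space \<Longrightarrow> (\<Delta> ^^ Suc (Suc j)) V x = 0" and x: "x \<in> upper_half_space"
  shows "(\<Delta> ^^ Suc j) V x = 0"
proof -
  define U where "U = (\<Delta> ^^ j) V"
  define W where "W = \<Delta> U"
  define h :: "'a \<times> real" where "h = (r *\<^sub>R b, 0)"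
  have mem: "x + real m *\<^sub>R h \<in> upper_half_space" for m using x by (simp add: upper_half_space_iff h_def)
  have W: "W (y + h) = W y" if "y \<in> upper_half_space" for y
    using assms(1)[OF that] by (simp add: W_def U_def h_def \<Delta>_def[of "\<Delta> _"])
  have Wm: "W (x + real m *\<^sub>R h) = W x" for m
  proof (induction m)
    case (Suc m)
    have "x + real (Suc m) *\<^sub>R h = (x + real m *\<^sub>R h) + h" by (simp add: algebra_simps)
    then show ?case using W[OF mem[of m]] Suc by (simp only:)
  qed simp
  have Um: "U (x + real m *\<^sub>R h) = U x + real m *\<^sub>R W x" for m
  proof (induction m)
    case (Suc m)
    have eq: "x + real (Suc m) *\<^sub>R h = (x + real m *\<^sub>R h) + h" by (simp add: algebra_simps)
    have "U (x + real (Suc m) *\<^sub>R h) = U (x + real m *\<^sub>R h) + W (x + real m *\<^sub>R h)"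
      unfolding eq by (simp add: W_def \<Delta>_def h_def)
    then show ?case unfolding Suc Wm by (simp add: algebra_simps)
  qed simp
  define M where "M = 2 ^ j * (B * (1 + snd x))"
  have Ub: "norm (U (x + real m *\<^sub>R h)) \<le> M" for m
    using iterated_difference_growth[of "x + real m *\<^sub>R h" j] x by (simp add: U_def M_def h_def upper_half_space_iff)
  have "real m * norm (W x) \<le> 2 * M" for m
  proof -
    have "real m * norm (W x) = norm (U (x + real m *\<^sub>R h) - U x)" by (simp add: Um)
    also have "\<dots> \<le> M + M" using Ub[of m] Ub[of 0] by (intro order_trans[OF norm_triangle_ineq4] add_mono) auto
    finally show ?thesis by simp
  qed
  note * = this
  have "norm (W x) = 0"
  proof (rule ccontr)
    assume "norm (W x) \<noteq> 0"
    then obtain m where "2 * M < real m * norm (W x)" using reals_Archimedean3[of "norm (W x)"] by auto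
    then show False using *[of m] by simp
  qed
  then show ?thesis by (simp add: W_def U_def)
qed

lemma tangential_invariance:
  assumes "x \<in> upper_half_space"
  shows "V (x + (r *\<^sub>R b, 0)) = V x"
proof -
  \<comment> \<open>The induction lowers the order from \<open>Suc N\<close> = n + 2 to 1, reached
    at i = N; by truncated subtraction the step is trivial once \<open>N - i = 0\<close>.\<close>
  define N where "N = DIM('a \<times> real) + 1"
  have "\<forall>y\<in>upper_half_space. (\<Delta> ^^ Suc (N - i)) V y = 0" for i
  proof (induction i)
    case 0
    then show ?case using high_difference_eq_0 by (simp add: N_def)
  next
    case (Suc i)
    show ?case
    proof (cases "N - i")
      case 0
      then show ?thesis using Suc by simp
    next
      case (Suc j)
      then have "N - Suc i = j" by simp
      then show ?thesis using Suc.IH lower_difference_eq_0[of j] unfolding Suc by blast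
    qed
  qed
  from this[of N] have "(\<Delta> ^^ Suc 0) V x = 0" using assms by simp
  then show ?thesis by (simp add: \<Delta>_def)
qed

end

lemma partial_deriv_tangential_eq_0:
  fixes G :: "'a \<times> real \<Rightarrow> 'b::real_normed_vector"
  assumes "G differentiable at x" "\<And>r. G (x + (r *\<^sub>R b, 0)) = G x"
  shows "partial_deriv (b, 0) G x = 0"
proof -
  have "(\<lambda>i. (G (inverse (real (Suc i)) *\<^sub>R (b, 0) + x) - G x) /\<^sub>R inverse (real (Suc i))) \<longlonglongrightarrow> frechet_derivative G (at x) (b, 0)"
    by (rule difference_quotient_tendsto[OF assms(1)])
  moreover have "G (inverse (real (Suc i)) *\<^sub>R (b, 0) + x) = G x" for i
    using assms(2)[of "inverse (real (Suc i))"] by (simp add: add.commute)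
  ultimately have "(\<lambda>i. 0) \<longlonglongrightarrow> frechet_derivative G (at x) (b, 0)" by simp
  then show ?thesis by (simp add: partial_deriv_def LIMSEQ_const_iff)
qed

text \<open>Once V depends on t alone, the system says that one coefficient matrix annihilates the
  second normal derivative, and ellipticity in the normal direction makes this matrix injective.
  Hence V = t c + d, where decay at the boundary gives d = 0 and sublinear growth gives c =
  0.\<close>

lemma liouville_half_space:
  assumes sublinear: "((\<lambda>t. norm (V (0, t)) / t) \<longlongrightarrow> 0) at_top" and x: "x \<in> upper_half_space"
  shows "V x = 0"
proof -
  define e :: "'a \<times> real" where "e = (0, 1)"
  have e: "e \<in> Basis" by (simp add: e_def Basis_prod_def)
  have basis: "(\<exists>b\<in>Basis. j = (b, 0)) \<or> j = e" if "j \<in> Basis" for j :: "'a \<times> real"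
    using that by (auto simp: Basis_prod_def e_def)
  have Vs: "smooth_on upper_half_space V" and Veq: "\<And>x. x \<in> upper_half_space \<Longrightarrow> apply_system a V x = 0"
    using V by (auto simp: vanishing_solution_def)
  have pVs: "smooth_on upper_half_space (partial_deriv e V)" by (rule smooth_on_partial_deriv[OF Vs e])
  have inv: "V (y + (r *\<^sub>R b, 0)) = V y" if "y \<in> upper_half_space" "b \<in> Basis" for y b r
    by (rule tangential_invariance[OF that(2,1)])
  have tan: "partial_deriv (b, 0) V y = 0" if "y \<in> upper_half_space" "b \<in> Basis" for y b
    by (rule partial_deriv_tangential_eq_0[OF smooth_on_differentiable[OF Vs that(1)] inv[OF that]])
  have inv': "partial_deriv e V (y + (r *\<^sub>R b, 0)) = partial_deriv e V y" if "y \<in> upper_half_space" "b \<in> Basis" for y b r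
    unfolding partial_deriv_translate[symmetric]
    by (rule partial_deriv_cong[OF open_upper_half_space that(1)]) (rule inv[OF _ that(2)])
  have tan': "partial_deriv (b, 0) (partial_deriv e V) y = 0" if "y \<in> upper_half_space" "b \<in> Basis" for y b
    by (rule partial_deriv_tangential_eq_0[OF smooth_on_differentiable[OF pVs that(1)] inv'[OF that]])
  have nn: "partial_deriv e (partial_deriv e V) y = 0" if y: "y \<in> upper_half_space" for y
  proof -
    define z where "z = partial_deriv e (partial_deriv e V) y"
    \<comment> \<open>For basis vectors the factor \<open>snd j * snd k\<close> is 1 for the purely
      normal pair and 0 otherwise, in accordance with the vanishing of all derivatives that involve
      a tangential direction.\<close>
    have second: "partial_deriv j (partial_deriv k V) y = (snd j * snd k) *\<^sub>R z" if jk: "j \<in> Basis" "k \<in> Basis" for j k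
    proof (cases "k = e")
      case True
      then show ?thesis using basis[OF jk(1)] tan'[OF y] by (auto simp: z_def e_def)
    next
      case False
      then obtain b where b: "b \<in> Basis" "k = (b, 0)" using basis[OF jk(2)] by blast
      have "partial_deriv j (partial_deriv k V) y = partial_deriv j (\<lambda>_. 0) y"
        unfolding b(2) by (intro partial_deriv_cong[OF open_upper_half_space y] tan b(1))
      also have "\<dots> = 0" by (rule partial_deriv_eq[OF has_derivative_const])
      finally show ?thesis using b by simp
    qed
    obtain \<kappa> where \<kappa>: "\<kappa> > 0" and elliptic: "\<And>(\<xi>::'a \<times> real) (\<zeta>::complex^'M). \<kappa> * (norm \<xi>)\<^sup>2 * (norm \<zeta>)\<^sup>2 \<le>
      Re (\<Sum>\<alpha>\<in>UNIV. \<Sum>\<beta>\<in>UNIV. \<Sum>j\<in>Basis. \<Sum>k\<in>Basis.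
        a j k $ \<alpha> $ \<beta> * of_real (\<xi> \<bullet> j) * of_real (\<xi> \<bullet> k) * cnj (\<zeta> $ \<alpha>) * \<zeta> $ \<beta>)"
      using ell unfolding strongly_elliptic_def by blast
    \<comment> \<open>Ellipticity is tested with \<xi> = e and with \<zeta> the second normal
      derivative itself, which turns the form into a combination of the components of the
      system.\<close>
    have "(\<Sum>\<alpha>\<in>UNIV. \<Sum>\<beta>\<in>UNIV. \<Sum>j\<in>Basis. \<Sum>k\<in>Basis.
        a j k $ \<alpha> $ \<beta> * of_real (e \<bullet> j) * of_real (e \<bullet> k) * cnj (z $ \<alpha>) * z $ \<beta>)
      = (\<Sum>\<alpha>\<in>UNIV. cnj (z $ \<alpha>) * apply_system a V y $ \<alpha>)"
      unfolding apply_system_def vec_lambda_beta sum_distrib_left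
    proof (intro sum.cong refl)
      fix \<alpha> \<beta> :: 'M and j k :: "'a \<times> real"
      assume j: "j \<in> Basis" and k: "k \<in> Basis"
      have "e \<bullet> j = snd j" "e \<bullet> k = snd k" by (simp_all add: e_def inner_prod_def)
      then show "a j k $ \<alpha> $ \<beta> * of_real (e \<bullet> j) * of_real (e \<bullet> k) * cnj (z $ \<alpha>) * z $ \<beta>
        = cnj (z $ \<alpha>) * (a j k $ \<alpha> $ \<beta> * partial_deriv j (partial_deriv k V) y $ \<beta>)"
        unfolding second[OF j k] by (simp add: scaleR_conv_of_real[where 'a = complex])
    qed
    also have "\<dots> = 0" using Veq[OF y] by simp
    finally have "\<kappa> * (norm e)\<^sup>2 * (norm z)\<^sup>2 \<le> 0" using elliptic[of e z] by simp
    moreover have "norm e = 1" using e by simp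
    ultimately have "(norm z)\<^sup>2 \<le> 0" using \<kappa> by (simp add: mult_le_0_iff)
    then show ?thesis by (simp add: z_def)
  qed
  have conv: "convex (upper_half_space :: ('a \<times> real) set)"
  proof -
    have eq: "(upper_half_space :: ('a \<times> real) set) = snd -` {0<..}" by (auto simp: upper_half_space_def)
    show ?thesis unfolding eq by (intro convex_linear_vimage linear_snd convex_real_interval)
  qed
  define x0 :: "'a \<times> real" where "x0 = (0, 1)"
  have x0: "x0 \<in> upper_half_space" by (simp add: x0_def)
  define c where "c = partial_deriv e V x0"
  have const: "partial_deriv e V y = c" if y: "y \<in> upper_half_space" for y
  proof -
    have "norm (partial_deriv e V y - partial_deriv e V x0) \<le> real DIM('a \<times> real) * 0 * norm (y - x0)"
    proof (rule mean_value_partial[OF conv])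
      fix z j :: "'a \<times> real" assume z: "z \<in> upper_half_space" "j \<in> Basis"
      then show "norm (partial_deriv j (partial_deriv e V) z) \<le> 0" using basis[OF z(2)] tan'[OF z(1)] nn[OF z(1)] by auto
    qed (use y x0 smooth_on_differentiable[OF pVs] in auto)
    then show ?thesis by (simp add: c_def)
  qed
  define d where "d = V x0 - c"
  have lin: "V y = snd y *\<^sub>R c + d" if y: "y \<in> upper_half_space" for y
  proof -
    define f where "f y = V y - snd y *\<^sub>R c" for y
    have D: "(f has_derivative (\<lambda>h. frechet_derivative V (at z) h - snd h *\<^sub>R c)) (at z)" if "z \<in> upper_half_space" for z
      unfolding f_def
      by (intro has_derivative_diff has_derivative_frechet smooth_on_differentiable[OF Vs that] derivative_intros)
    have "norm (f y - f x0) \<le> real DIM('a \<times> real) * 0 * norm (y - x0)"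
    proof (rule mean_value_partial[OF conv])
      fix z j :: "'a \<times> real" assume z: "z \<in> upper_half_space" "j \<in> Basis"
      have "partial_deriv j f z = partial_deriv j V z - snd j *\<^sub>R c"
        using partial_deriv_eq[OF D[OF z(1)]] by (simp add: partial_deriv_def)
      then show "norm (partial_deriv j f z) \<le> 0"
        using basis[OF z(2)] tan[OF z(1)] const[OF z(1)] by (auto simp: e_def)
    qed (use y x0 differentiableI[OF D] in auto)
    then show ?thesis by (simp add: f_def d_def x0_def algebra_simps)
  qed
  have Vt: "V (0, t) = t *\<^sub>R c + d" if "t > 0" for t using lin[of "(0, t)"] that by simp
  have "d = 0"
  proof -
    obtain D where D: "\<And>x. 0 < snd x \<Longrightarrow> norm x \<le> 1 \<Longrightarrow> norm (V x) \<le> D * snd x powr (3/4)"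
      using V unfolding vanishing_solution_def by (metis zero_less_one)
    have "((\<lambda>t. t *\<^sub>R c + d) \<longlongrightarrow> 0 *\<^sub>R c + d) (at_right 0)"
      by (intro tendsto_intros)
    moreover have "((\<lambda>t. t *\<^sub>R c + d) \<longlongrightarrow> 0) (at_right 0)"
    proof (rule Lim_null_comparison)
      show "\<forall>\<^sub>F t in at_right 0. norm (t *\<^sub>R c + d) \<le> D * t powr (3/4)"
        using eventually_at_right_less[of 0] eventually_at_right_real[of 0 1, OF zero_less_one]
      proof eventually_elim
        case (elim t)
        then show ?case using D[of "(0, t)"] Vt[of t] by simp
      qed
      have "((\<lambda>t::real. t powr (3/4)) \<longlongrightarrow> 0 powr (3/4)) (at_right 0)"
        by (rule tendsto_powr2) (auto intro: tendsto_intros simp: eventually_at_right_less less_imp_le eventually_mono[OF eventually_at_right_less])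
      then show "((\<lambda>t. D * t powr (3/4)) \<longlongrightarrow> 0) (at_right 0)"
        by (auto intro: tendsto_mult_right_zero)
    qed
    ultimately have "0 *\<^sub>R c + d = 0" by (intro tendsto_unique[of "at_right 0"]) auto
    then show ?thesis by simp
  qed
  moreover have "c = 0"
  proof -
    have "((\<lambda>t. norm (V (0, t)) / t) \<longlongrightarrow> norm c) at_top"
    proof (rule tendsto_eventually)
      show "\<forall>\<^sub>F t in at_top. norm (V (0, t)) / t = norm c"
        using eventually_gt_at_top[of 0] by eventually_elim (simp add: Vt \<open>d = 0\<close>)
    qed
    from tendsto_unique[OF _ this sublinear] show ?thesis by simp
  qed
  ultimately show ?thesis using lin[OF x] by simp
qed

end

section \<open>Uniqueness and seminorm estimates\<close>

lemma holder_seminorm_le: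
  assumes "A \<ge> 0" "\<And>t. t > 0 \<Longrightarrow> \<omega> t > 0"
    and "\<And>x y. x \<in> E \<Longrightarrow> y \<in> E \<Longrightarrow> x \<noteq> y \<Longrightarrow> dist (u x) (u y) \<le> A * \<omega> (dist x y)"
  shows "holder_seminorm \<omega> E u \<le> ennreal A"
  unfolding holder_seminorm_def
proof (rule SUP_least, clarify)
  fix x y assume xy: "x \<in> E" "y \<in> E" "x \<noteq> y"
  then have "\<omega> (dist x y) > 0" using assms(2) by simp
  then show "ennreal (dist (u x) (u y) / \<omega> (dist x y)) \<le> ennreal A"
    using assms(3)[OF xy] by (intro ennreal_leI) (simp add: pos_divide_le_eq)
qed

text \<open>Finiteness matters, since \<open>enn2real\<close> sends infinity to 0.\<close>

lemma holder_seminormD: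
  assumes fin: "holder_seminorm \<omega> E u < \<infinity>" and pos: "\<And>t. t > 0 \<Longrightarrow> \<omega> t > 0" and xy: "x \<in> E" "y \<in> E" "x \<noteq> y"
  shows "dist (u x) (u y) \<le> enn2real (holder_seminorm \<omega> E u) * \<omega> (dist x y)"
proof -
  have p: "\<omega> (dist x y) > 0" using pos xy by simp
  have "ennreal (dist (u x) (u y) / \<omega> (dist x y)) \<le> holder_seminorm \<omega> E u"
    unfolding holder_seminorm_def by (rule SUP_upper2[of "(x, y)"]) (use xy in auto)
  also have "\<dots> = ennreal (enn2real (holder_seminorm \<omega> E u))"
    using fin by (simp add: ennreal_enn2real_if top.not_eq_extremum)
  finally have "dist (u x) (u y) / \<omega> (dist x y) \<le> enn2real (holder_seminorm \<omega> E u)"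
    by (subst (asm) ennreal_le_iff) simp_all
  then show ?thesis using p by (simp add: pos_divide_le_eq)
qed

lemma holder_continuous_on:
  assumes "A \<ge> 0" "(\<omega> \<longlongrightarrow> 0) (at_right (0::real))"
    and hol: "\<And>x y. x \<in> E \<Longrightarrow> y \<in> E \<Longrightarrow> x \<noteq> y \<Longrightarrow> dist (w x) (w y) \<le> A * \<omega> (dist x y)"
  shows "continuous_on E w"
  unfolding continuous_on_iff
proof (intro ballI allI impI)
  fix x and e :: real assume x: "x \<in> E" and e: "e > 0"
  have "((\<lambda>t. A * \<omega> t) \<longlongrightarrow> A * 0) (at_right 0)" by (intro tendsto_intros assms)
  then have "\<forall>\<^sub>F t in at_right 0. A * \<omega> t < e" using order_tendstoD(2)[of _ "A * 0"] e by simp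
  then obtain d where d: "d > 0" "\<And>t. 0 < t \<Longrightarrow> t < d \<Longrightarrow> A * \<omega> t < e"
    unfolding eventually_at_right_field by auto
  have "dist (w y) (w x) < e" if "y \<in> E" "dist y x < d" for y
  proof (cases "y = x")
    case False
    then show ?thesis using hol[OF that(1) x False] d(2)[of "dist y x"] that by simp
  qed (use e in simp)
  then show "\<exists>d>0. \<forall>y\<in>E. dist y x < d \<longrightarrow> dist (w y) (w x) < e" using d(1) by blast
qed

lemma trace_along_normal:
  fixes v :: "'a::euclidean_space \<times> real \<Rightarrow> 'b::real_normed_vector"
  assumes "(v \<longlongrightarrow> l) (at (x, 0) within upper_half_space)"
  shows "((\<lambda>s. v (x, s)) \<longlongrightarrow> l) (at_right 0)"
proof (rule filterlim_compose[OF assms])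
  have "((\<lambda>s. (x, s)) \<longlongrightarrow> (x, 0)) (at_right (0::real))" by (intro tendsto_intros)
  then show "filterlim (\<lambda>s. (x, s)) (at (x, 0) within upper_half_space) (at_right (0::real))"
    unfolding filterlim_at by (auto intro: eventually_mono[OF eventually_at_right_less])
qed

context holder_poisson
begin

text \<open>v (x, t) is compared with v (x, s) on the same normal, at distance t - s < t, and s
  tends to 0.\<close>

lemma trace_zero_bound:
  fixes v :: "'a \<times> real \<Rightarrow> complex^'M"
  assumes A: "A \<ge> 0"
    and hol: "\<And>x y. x \<in> upper_half_space \<Longrightarrow> y \<in> upper_half_space \<Longrightarrow> x \<noteq> y \<Longrightarrow> norm (v x - v y) \<le> A * \<omega> (norm (x - y))"
    and lim: "(v \<longlongrightarrow> 0) (at (x, 0) within upper_half_space)" and t: "t > 0"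
  shows "norm (v (x, t)) \<le> A * \<omega> t"
proof -
  have "((\<lambda>s. norm (v (x, t) - v (x, s))) \<longlongrightarrow> norm (v (x, t) - 0)) (at_right 0)"
    by (intro tendsto_intros trace_along_normal lim)
  moreover have "\<forall>\<^sub>F s in at_right 0. norm (v (x, t) - v (x, s)) \<le> A * \<omega> t"
    using eventually_at_right_real[OF t]
  proof eventually_elim
    case (elim s)
    then have "norm (v (x, t) - v (x, s)) \<le> A * \<omega> (norm ((x, t) - (x, s)))"
      by (intro hol) auto
    also have "norm ((x, t) - (x, s)) = t - s" using elim by simp
    also have "A * \<omega> (t - s) \<le> A * \<omega> t" using elim A by (intro mult_left_mono monoD) auto
    finally show ?case .
  qed
  ultimately have "norm (v (x, t) - 0) \<le> A * \<omega> t" by (intro tendsto_upperbound) auto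
  then show ?thesis by simp
qed

text \<open>At height \<open>\<delta>\<close> the solution is smooth and bounded, so its shift by \<open>\<delta>\<close> and the Poisson integral of its
  values at that height differ by a function that vanishes at the boundary like \<open>t\<^bsup>3/4\<^esup>\<close>.\<close>

lemma shifted_difference_vanishes:
  fixes v :: "'a \<times> real \<Rightarrow> complex^'M"
  assumes ell: "strongly_elliptic a" and v: "smooth_on upper_half_space v" "\<And>x. x \<in> upper_half_space \<Longrightarrow> apply_system a v x = 0"
    and A: "A \<ge> 0"
    and hol: "\<And>x y. x \<in> upper_half_space \<Longrightarrow> y \<in> upper_half_space \<Longrightarrow> x \<noteq> y \<Longrightarrow> norm (v x - v y) \<le> A * \<omega> (norm (x - y))"
    and bound: "\<And>x t. t > 0 \<Longrightarrow> norm (v (x, t)) \<le> A * \<omega> t" and \<delta>: "\<delta> > 0" and x: "x \<in> upper_half_space"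
  shows "v (x + (0, \<delta>)) = poisson_integral P (\<lambda>y. v (y, \<delta>)) x"
proof -
  \<comment> \<open>The same kernel with the modulus s^(3/4): the Poisson estimates become available
    with t^(3/4) in place of \<omega>(t).\<close>
  interpret q: holder_poisson a P "\<lambda>s. s powr (3/4)" 4
    by (intro holder_poisson.intro poisson_kernel_axioms controlled_growth_powr)
  define f where "f y = v (y, \<delta>)" for y
  define S where "S = A * \<omega> \<delta>"
  have S: "S \<ge> 0" using A pos[OF \<delta>] by (simp add: S_def)
  have f_bound: "norm (f y) \<le> S" for y using bound[OF \<delta>] by (simp add: f_def S_def)
  have f_cont: "continuous_on UNIV f" unfolding f_def
    by (rule continuous_on_compose2[OF smooth_on_continuous_on[OF v(1)]]) (use \<delta> in \<open>auto intro!: continuous_intros\<close>)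
  have f_dom: "norm (f y) \<le> (S / \<omega> 1) * \<omega> (1 + norm y)" for y
  proof -
    have "S / \<omega> 1 * \<omega> 1 \<le> S / \<omega> 1 * \<omega> (1 + norm y)"
      using pos[of 1] S by (intro mult_left_mono monoD) auto
    then show ?thesis using f_bound[of y] pos[of 1] by simp
  qed
  have f_dom': "norm (f y) \<le> S * (1 + norm y) powr (3/4)" for y
  proof -
    have "S * 1 \<le> S * (1 + norm y) powr (3/4)" using S by (intro mult_left_mono ge_one_powr_ge_zero) auto
    then show ?thesis using f_bound[of y] by simp
  qed
  define u where "u = poisson_integral P f"
  define V where "V x = v (x + (0, \<delta>)) - u x" for x
  obtain c where c: "c \<ge> 0" "\<And>x. x \<in> upper_half_space \<Longrightarrow> norm (u x) \<le> c * S"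
    using poisson_integral_bounded f_bound S unfolding u_def by blast
  have shift_mem: "z + (0, \<delta>) \<in> upper_half_space" if "z \<in> upper_half_space" for z
    using that \<delta> by (simp add: upper_half_space_iff)
  have vs: "smooth_on upper_half_space (\<lambda>x. v (x + (0, \<delta>)))" by (rule smooth_on_translate[OF v(1) shift_mem])
  have us: "smooth_on upper_half_space u" unfolding u_def by (rule smooth_on_poisson_integral[OF f_cont f_dom])
  have V_le: "norm (V z) \<le> A * \<omega> (snd z + \<delta>) + c * S" if "z \<in> upper_half_space" for z
  proof -
    have "norm (v (z + (0, \<delta>))) \<le> A * \<omega> (snd z + \<delta>)"
      using bound[of "snd z + \<delta>" "fst z"] that \<delta> by (simp add: plus_prod_def upper_half_space_iff)
    then show ?thesis unfolding V_def using c(2)[OF that] norm_triangle_ineq4[of "v (z + (0, \<delta>))" "u z"] by linarith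
  qed
  have "vanishing_solution a V"
    unfolding vanishing_solution_def
  proof (intro conjI ballI allI impI)
    show "smooth_on upper_half_space V" unfolding V_def by (rule smooth_on_diff[OF open_upper_half_space vs us])
    show "apply_system a V z = 0" if "z \<in> upper_half_space" for z
      unfolding V_def apply_system_diff[OF open_upper_half_space vs us that] apply_system_translate
      using v(2)[OF shift_mem[OF that]] apply_system_poisson_integral[OF f_cont f_dom that] by (simp add: u_def)
    fix R :: real assume R: "R > 0"
    \<comment> \<open>A compact convex box in the half-space, on which v is Lipschitz. It contains
      the shifted points of height t + \<delta> with t <= R. The radius R + 1 leaves room for
      comparing f at points of distance at most 1 from the ball of radius R.\<close>
    define T where "T = {z :: 'a \<times> real. norm (fst z) \<le> R + 1 \<and> \<delta> \<le> snd z \<and> snd z \<le> \<delta> + R}"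
    have T_eq: "T = cball 0 (R + 1) \<times> {\<delta>..\<delta> + R}" by (auto simp: T_def)
    have T: "compact T" "convex T" unfolding T_eq by (intro compact_Times convex_Times; simp)+
    have T_sub: "T \<subseteq> upper_half_space" using \<delta> by (auto simp: T_def upper_half_space_iff)
    have "\<forall>b\<in>Basis. \<exists>M\<ge>0. \<forall>z\<in>T. norm (partial_deriv b v z) \<le> M"
    proof
      fix b :: "'a \<times> real" assume b: "b \<in> Basis"
      have "continuous_on T (partial_deriv b v)"
        by (rule continuous_on_subset[OF smooth_on_continuous_on[OF smooth_on_partial_deriv[OF v(1) b]] T_sub])
      then have "bounded (partial_deriv b v ` T)" using T(1) by (intro compact_imp_bounded compact_continuous_image)
      then obtain M where "M > 0" "\<forall>y\<in>partial_deriv b v ` T. norm y \<le> M" unfolding bounded_pos by blast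
      then show "\<exists>M\<ge>0. \<forall>z\<in>T. norm (partial_deriv b v z) \<le> M" by (intro exI[of _ M]) auto
    qed
    from bchoice[OF this] obtain M where M: "\<And>b. b \<in> Basis \<Longrightarrow> M b \<ge> 0"
      "\<And>b z. b \<in> Basis \<Longrightarrow> z \<in> T \<Longrightarrow> norm (partial_deriv b v z) \<le> M b" by blast
    define L where "L = real DIM('a \<times> real) * (\<Sum>b\<in>Basis. M b)"
    have L0: "L \<ge> 0" unfolding L_def using M(1) by (intro mult_nonneg_nonneg sum_nonneg) auto
    have L: "norm (v y - v z) \<le> L * norm (y - z)" if "y \<in> T" "z \<in> T" for y z
      unfolding L_def
    proof (rule mean_value_partial[OF T(2) _ _ that])
      show "v differentiable at z" if "z \<in> T" for z using smooth_on_differentiable[OF v(1)] T_sub that by blast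
      show "norm (partial_deriv b v z) \<le> (\<Sum>b\<in>Basis. M b)" if "z \<in> T" "b \<in> Basis" for z b
        using M(2)[OF that(2,1)] member_le_sum[of b Basis M] M(1) that(2) by simp
    qed
    obtain c' where c': "c' \<ge> 0" and est: "\<And>f A B t x. continuous_on UNIV f \<Longrightarrow> (\<And>y. norm (f y) \<le> B * (1 + norm y) powr (3/4)) \<Longrightarrow> A \<ge> 0 \<Longrightarrow> t > 0 \<Longrightarrow>
      (\<And>y. norm (f y - f x) \<le> A * (t + norm (x - y)) powr (3/4)) \<Longrightarrow>
      norm (poisson_integral P f (x, t) - f x) \<le> c' * A * t powr (3/4)"
      using q.poisson_integral_estimates by blast
    \<comment> \<open>L serves |x - y| <= 1, where the distance is below its power 3/4; 2 S serves
      larger distances, where f is merely bounded.\<close>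
    define A' where "A' = L + 2 * S"
    have A': "A' \<ge> 0" using L0 S by (simp add: A'_def)
    have "norm (V z) \<le> (L * R powr (1/4) + c' * A') * snd z powr (3/4)" if z: "0 < snd z" "norm z \<le> R" for z
    proof -
      define x t where "x = fst z" and "t = snd z"
      have t: "0 < t" "t \<le> R" and x: "norm x \<le> R"
        using z norm_fst_le_norm[of z] norm_snd_le_norm[of z] by (auto simp: t_def x_def)
      have "norm (v (x, t + \<delta>) - v (x, \<delta>)) \<le> L * norm ((x, t + \<delta>) - (x, \<delta>))"
        using t x by (intro L) (auto simp: T_def)
      \<comment> \<open>The linear bound is traded for the power 3/4, the surplus t^(1/4) being
        bounded by R^(1/4).\<close>
      also have "\<dots> = L * (t powr (1/4) * t powr (3/4))"
        using t by (simp add: powr_add[symmetric])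
      also have "\<dots> \<le> L * (R powr (1/4) * t powr (3/4))"
        using t L0 by (intro mult_left_mono mult_right_mono powr_mono2) auto
      finally have 1: "norm (v (x, t + \<delta>) - f x) \<le> L * R powr (1/4) * t powr (3/4)" by (simp add: f_def mult.assoc)
      have 2: "norm (u (x, t) - f x) \<le> c' * A' * t powr (3/4)"
        unfolding u_def
      proof (rule est[OF f_cont f_dom' A' t(1)])
        fix y
        show "norm (f y - f x) \<le> A' * (t + norm (x - y)) powr (3/4)"
        proof (cases "norm (x - y) \<le> 1")
          case True
          have "norm y \<le> R + 1" using x True norm_triangle_ineq2[of y x] by (simp add: norm_minus_commute)
          then have "norm (f y - f x) \<le> L * norm ((y, \<delta>) - (x, \<delta>))"
            unfolding f_def using x R by (intro L) (auto simp: T_def)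
          also have "\<dots> = L * norm (x - y)" by (simp add: norm_minus_commute)
          also have "\<dots> \<le> L * norm (x - y) powr (3/4)"
          proof (cases "x = y")
            case False
            then have "norm (x - y) powr 1 \<le> norm (x - y) powr (3/4)" using True by (intro powr_mono') auto
            then show ?thesis using L0 False by (intro mult_left_mono) auto
          qed simp
          also have "\<dots> \<le> A' * (t + norm (x - y)) powr (3/4)"
            using L0 S t by (intro mult_mono powr_mono2) (auto simp: A'_def)
          finally show ?thesis .
        next
          case False
          have "norm (f y - f x) \<le> 2 * S * 1"
            using f_bound[of x] f_bound[of y] norm_triangle_ineq4[of "f y" "f x"] by linarith
          also have "\<dots> \<le> A' * (t + norm (x - y)) powr (3/4)"
            using False L0 S t by (intro mult_mono ge_one_powr_ge_zero) (auto simp: A'_def)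
          finally show ?thesis .
        qed
      qed
      have "V z = (v (x, t + \<delta>) - f x) - (u (x, t) - f x)" by (simp add: V_def x_def t_def plus_prod_def)
      then have "norm (V z) \<le> L * R powr (1/4) * t powr (3/4) + c' * A' * t powr (3/4)"
        using order_trans[OF norm_triangle_ineq4 add_mono[OF 1 2]] by simp
      then show ?thesis by (simp add: t_def distrib_right)
    qed
    then show "\<exists>B. \<forall>x. 0 < snd x \<longrightarrow> norm x \<le> R \<longrightarrow> norm (V x) \<le> B * snd x powr (3/4)" by blast
  qed
  then have "V x = 0"
  proof (rule liouville_half_space[OF ell _ _ _ x])
    show "norm (V z) \<le> (A * (C * \<omega> 1 * (1 + \<delta>)) + c * S) * (1 + snd z)" if "0 < snd z" for z
    proof -
      have "norm (V z) \<le> A * \<omega> (snd z + \<delta>) + c * S" using that by (intro V_le) (simp add: upper_half_space_iff)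
      also have "A * \<omega> (snd z + \<delta>) \<le> A * (C * \<omega> 1 * (1 + (snd z + \<delta>)))"
        using that \<delta> A by (intro mult_left_mono le_linear) auto
      also have "\<dots> \<le> A * (C * \<omega> 1 * ((1 + \<delta>) * (1 + snd z)))"
        using that \<delta> A pos[of 1] constant_nonneg
        by (intro mult_left_mono mult_nonneg_nonneg) (auto simp: algebra_simps)
      also have "c * S \<le> c * S * (1 + snd z)" using c(1) S that mult_left_mono[of 1 "1 + snd z" "c * S"] by simp
      finally show ?thesis by (simp add: algebra_simps)
    qed
    \<comment> \<open>For t >= \<delta> one has t + \<delta> <= 2 t, so doubling reduces the growth
      to \<omega>(t)/t, which tends to 0 by \<open>sublinear\<close>.\<close>
    show "((\<lambda>t. norm (V (0, t)) / t) \<longlongrightarrow> 0) at_top"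
    proof (rule Lim_null_comparison)
      show "\<forall>\<^sub>F t in at_top. norm (norm (V (0, t)) / t) \<le> A * (2 * C) * (\<omega> t / t) + c * S / t"
        using eventually_ge_at_top[of \<delta>]
      proof eventually_elim
        case (elim t)
        then have t: "t > 0" using \<delta> by linarith
        have "norm (V (0, t)) \<le> A * \<omega> (t + \<delta>) + c * S" using V_le[of "(0, t)"] t by simp
        also have "A * \<omega> (t + \<delta>) \<le> A * (2 * C * \<omega> t)"
          using A t \<delta> elim double_le[OF t] monoD[of "t + \<delta>" "2 * t"] by (intro mult_left_mono) auto
        finally have "norm (V (0, t)) / t \<le> (A * (2 * C * \<omega> t) + c * S) / t"
          using t by (intro divide_right_mono) auto
        then show ?case using t by (simp add: add_divide_distrib mult.assoc)
      qed
      have "((\<lambda>t. A * (2 * C) * (\<omega> t / t) + c * S * inverse t) \<longlongrightarrow> A * (2 * C) * 0 + c * S * 0) at_top"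
        by (intro tendsto_intros sublinear tendsto_inverse_0_at_top filterlim_ident)
      then show "((\<lambda>t. A * (2 * C) * (\<omega> t / t) + c * S / t) \<longlongrightarrow> 0) at_top" by (simp add: divide_inverse)
    qed
  qed
  then show ?thesis by (simp add: V_def u_def f_def[abs_def])
qed

text \<open>For small \<delta> the value at x is the Poisson integral, at the point \<delta> below
  x, of data of size at most A \<omega>(\<delta>). It does not depend on \<delta>, while its bound
  tends to 0.\<close>

lemma zero_trace_unique:
  fixes v :: "'a \<times> real \<Rightarrow> complex^'M"
  assumes ell: "strongly_elliptic a" and v: "smooth_on upper_half_space v" "\<And>x. x \<in> upper_half_space \<Longrightarrow> apply_system a v x = 0"
    and A: "A \<ge> 0"
    and hol: "\<And>x y. x \<in> upper_half_space \<Longrightarrow> y \<in> upper_half_space \<Longrightarrow> x \<noteq> y \<Longrightarrow> norm (v x - v y) \<le> A * \<omega> (norm (x - y))"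
    and lim: "\<And>x. (v \<longlongrightarrow> 0) (at (x, 0) within upper_half_space)"
    and \<omega>0: "(\<omega> \<longlongrightarrow> 0) (at_right 0)" and x: "x \<in> upper_half_space"
  shows "v x = 0"
proof -
  have bound: "norm (v (y, t)) \<le> A * \<omega> t" if "t > 0" for y t
    by (rule trace_zero_bound[OF A hol lim that])
  obtain c where c: "c \<ge> 0" "\<And>f S x. x \<in> upper_half_space \<Longrightarrow> S \<ge> 0 \<Longrightarrow> \<forall>y. norm (f y) \<le> S \<Longrightarrow> norm (poisson_integral P f x) \<le> c * S"
    using poisson_integral_bounded by blast
  have "\<forall>\<^sub>F \<delta> in at_right 0. \<delta> \<in> {0<..<snd x}"
    using x by (intro eventually_at_right_real) (simp add: upper_half_space_iff)
  then have "\<forall>\<^sub>F \<delta> in at_right 0. norm (v x) \<le> c * (A * \<omega> \<delta>)"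
  proof eventually_elim
    case (elim \<delta>)
    then have \<delta>: "0 < \<delta>" "\<delta> < snd x" by auto
    define y where "y = (fst x, snd x - \<delta>)"
    have y: "y \<in> upper_half_space" using \<delta> by (simp add: y_def)
    have "v x = v (y + (0, \<delta>))" by (simp add: y_def plus_prod_def)
    also have "\<dots> = poisson_integral P (\<lambda>y. v (y, \<delta>)) y"
      by (rule shifted_difference_vanishes[OF ell v A hol bound \<delta>(1) y])
    also have "norm \<dots> \<le> c * (A * \<omega> \<delta>)"
      using bound[OF \<delta>(1)] A pos[OF \<delta>(1)] by (intro c y) auto
    finally show ?case .
  qed
  moreover have "((\<lambda>\<delta>. c * (A * \<omega> \<delta>)) \<longlongrightarrow> c * (A * 0)) (at_right 0)" by (intro tendsto_intros \<omega>0)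
  ultimately have "norm (v x) \<le> c * (A * 0)" by (intro tendsto_lowerbound) auto
  then show ?thesis by simp
qed

section \<open>Well-posedness for data in the Hoelder space\<close>

context
  assumes \<omega>0: "(\<omega> \<longlongrightarrow> 0) (at_right 0)" and ell: "strongly_elliptic a"
begin

lemma dirichlet_unique:
  assumes v: "solves_holder_dirichlet a \<omega> f v" and w: "solves_holder_dirichlet a \<omega> f w" and x: "x \<in> upper_half_space"
  shows "v x = w x"
proof -
  define A where "A = enn2real (holder_seminorm \<omega> upper_half_space v) + enn2real (holder_seminorm \<omega> upper_half_space w)"
  have vs: "smooth_on upper_half_space v" "smooth_on upper_half_space w"
    using v w by (auto simp: solves_holder_dirichlet_def)
  have "v x - w x = 0"
  proof (rule zero_trace_unique[OF ell _ _ _ _ _ \<omega>0 x, of "\<lambda>x. v x - w x" A])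
    show "smooth_on upper_half_space (\<lambda>x. v x - w x)" by (rule smooth_on_diff[OF open_upper_half_space vs])
    show "apply_system a (\<lambda>x. v x - w x) y = 0" if "y \<in> upper_half_space" for y
      using apply_system_diff[OF open_upper_half_space vs that, of a] v w that by (simp add: solves_holder_dirichlet_def)
    show "A \<ge> 0" by (simp add: A_def)
    fix y z :: "'a \<times> real" assume yz: "y \<in> upper_half_space" "z \<in> upper_half_space" "y \<noteq> z"
    have "dist (v y) (v z) \<le> enn2real (holder_seminorm \<omega> upper_half_space v) * \<omega> (dist y z)"
      by (rule holder_seminormD[OF _ pos yz]) (use v in \<open>simp add: solves_holder_dirichlet_def\<close>)
    moreover have "dist (w y) (w z) \<le> enn2real (holder_seminorm \<omega> upper_half_space w) * \<omega> (dist y z)"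
      by (rule holder_seminormD[OF _ pos yz]) (use w in \<open>simp add: solves_holder_dirichlet_def\<close>)
    moreover have "norm (v y - w y - (v z - w z)) \<le> dist (v y) (v z) + dist (w y) (w z)"
      using norm_triangle_ineq4[of "v y - v z" "w y - w z"] by (simp add: dist_norm algebra_simps)
    ultimately show "norm (v y - w y - (v z - w z)) \<le> A * \<omega> (norm (y - z))"
      by (simp add: A_def distrib_right dist_norm)
  next
    fix y
    have "((\<lambda>x. v x - w x) \<longlongrightarrow> f y - f y) (at (y, 0) within upper_half_space)"
      by (intro tendsto_diff) (use v w in \<open>auto simp: solves_holder_dirichlet_def\<close>)
    then show "((\<lambda>x. v x - w x) \<longlongrightarrow> 0) (at (y, 0) within upper_half_space)" by simp
  qed
  then show ?thesis by simp
qed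

lemma holder_data:
  fixes f :: "'a \<Rightarrow> complex^'M"
  assumes "f \<in> holder_space \<omega> UNIV"
  defines "A \<equiv> enn2real (holder_seminorm \<omega> UNIV f)"
  shows "A \<ge> 0" "\<And>x y. x \<noteq> y \<Longrightarrow> norm (f x - f y) \<le> A * \<omega> (norm (x - y))" "continuous_on UNIV f"
    "\<And>y. norm (f y) \<le> (norm (f 0) / \<omega> 1 + A) * \<omega> (1 + norm y)" "ennreal A = holder_seminorm \<omega> UNIV f"
proof -
  have fin: "holder_seminorm \<omega> UNIV f < \<infinity>" using assms(1) by (simp add: holder_space_def)
  show A: "A \<ge> 0" by (simp add: A_def)
  show hol: "norm (f x - f y) \<le> A * \<omega> (norm (x - y))" if "x \<noteq> y" for x y
    using holder_seminormD[OF fin pos, of x y] that by (simp add: A_def dist_norm)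
  show "continuous_on UNIV f"
    by (rule holder_continuous_on[OF A \<omega>0]) (simp add: dist_norm hol)
  show "norm (f y) \<le> (norm (f 0) / \<omega> 1 + A) * \<omega> (1 + norm y)" for y by (rule holder_dominated[OF A hol])
  show "ennreal A = holder_seminorm \<omega> UNIV f"
    using fin by (simp add: A_def ennreal_enn2real_if top.not_eq_extremum)
qed

lemma poisson_extension_seminorm:
  "\<exists>c\<ge>0. \<forall>f\<in>holder_space \<omega> UNIV. \<forall>x y. x \<in> closure upper_half_space \<longrightarrow> y \<in> closure upper_half_space \<longrightarrow> x \<noteq> y \<longrightarrow>
     dist (poisson_extension f x) (poisson_extension f y) \<le> c * enn2real (holder_seminorm \<omega> UNIV f) * \<omega> (dist x y)"
proof -
  obtain c where c: "c \<ge> 0" "\<And>f A x y. A \<ge> 0 \<Longrightarrow> continuous_on UNIV f \<Longrightarrow> (\<forall>x y. x \<noteq> y \<longrightarrow> norm (f x - f y) \<le> A * \<omega> (norm (x - y))) \<Longrightarrow>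
     0 \<le> snd x \<Longrightarrow> 0 \<le> snd y \<Longrightarrow> x \<noteq> y \<Longrightarrow>
       norm (poisson_extension f x - poisson_extension f y) \<le> c * A * \<omega> (norm (x - y))"
    using poisson_extension_holder by blast
  show ?thesis
  proof (intro exI[of _ c] conjI ballI allI impI c(1))
    fix f :: "'a \<Rightarrow> complex^'M" and x y :: "'a \<times> real"
    assume "f \<in> holder_space \<omega> UNIV" "x \<in> closure upper_half_space" "y \<in> closure upper_half_space" "x \<noteq> y"
    then show "dist (poisson_extension f x) (poisson_extension f y) \<le> c * enn2real (holder_seminorm \<omega> UNIV f) * \<omega> (dist x y)"
      unfolding dist_norm closure_upper_half_space using holder_data[of f] by (intro c(2)) auto
  qed
qed

lemma poisson_extension_space:
  assumes f: "f \<in> holder_space \<omega> UNIV"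
  shows "poisson_extension f \<in> holder_space \<omega> (closure upper_half_space)"
    and "continuous_on (closure upper_half_space) (poisson_extension f)"
proof -
  obtain c where c: "c \<ge> 0" "\<And>x y. x \<in> closure upper_half_space \<Longrightarrow> y \<in> closure upper_half_space \<Longrightarrow> x \<noteq> y \<Longrightarrow>
     dist (poisson_extension f x) (poisson_extension f y) \<le> c * enn2real (holder_seminorm \<omega> UNIV f) * \<omega> (dist x y)"
    using poisson_extension_seminorm f by blast
  have A: "0 \<le> c * enn2real (holder_seminorm \<omega> UNIV f)" using c(1) by simp
  show "continuous_on (closure upper_half_space) (poisson_extension f)"
    by (rule holder_continuous_on[OF A \<omega>0 c(2)])
  have "holder_seminorm \<omega> (closure upper_half_space) (poisson_extension f) \<le> ennreal (c * enn2real (holder_seminorm \<omega> UNIV f))"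
    by (rule holder_seminorm_le) (rule A, rule pos, assumption, rule c(2), assumption+)
  then show "poisson_extension f \<in> holder_space \<omega> (closure upper_half_space)"
    unfolding holder_space_def using le_less_trans[OF _ ennreal_less_top] by auto
qed

lemma poisson_extension_eq: "x \<in> upper_half_space \<Longrightarrow> poisson_extension f x = poisson_integral P f x"
  by (simp add: poisson_extension_def upper_half_space_iff)

text \<open>The trace is read off from the continuity of \<open>poisson_extension\<close> on the
  closed half-space, where its boundary values are f by construction.\<close>

lemma poisson_integral_solves:
  assumes f: "f \<in> holder_space \<omega> UNIV"
  shows "solves_holder_dirichlet a \<omega> f (poisson_integral P f)"
  unfolding solves_holder_dirichlet_def
proof (intro conjI ballI allI)
  note data = holder_data[OF f]
  show "smooth_on upper_half_space (poisson_integral P f)" by (rule smooth_on_poisson_integral[OF data(3,4)])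
  show "apply_system a (poisson_integral P f) x = 0" if "x \<in> upper_half_space" for x
    by (rule apply_system_poisson_integral[OF data(3,4) that])
  have "holder_seminorm \<omega> upper_half_space (poisson_integral P f) = holder_seminorm \<omega> upper_half_space (poisson_extension f)"
    unfolding holder_seminorm_def by (rule SUP_cong) (auto simp: poisson_extension_eq)
  also have "\<dots> \<le> holder_seminorm \<omega> (closure upper_half_space) (poisson_extension f)"
    unfolding holder_seminorm_def by (rule SUP_subset_mono) (use closure_subset in auto)
  also have "\<dots> < \<infinity>" using poisson_extension_space(1)[OF f] by (simp add: holder_space_def)
  finally show "holder_seminorm \<omega> upper_half_space (poisson_integral P f) < \<infinity>" .
  fix x :: 'a
  have "(x, 0) \<in> closure upper_half_space" by (simp add: closure_upper_half_space)
  then have "(poisson_extension f \<longlongrightarrow> poisson_extension f (x, 0)) (at (x, 0) within closure upper_half_space)"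
    using poisson_extension_space(2)[OF f] by (simp add: continuous_on_def)
  then have "(poisson_extension f \<longlongrightarrow> f x) (at (x, 0) within upper_half_space)"
    using tendsto_within_subset[OF _ closure_subset] by (fastforce simp: poisson_extension_def)
  then show "(poisson_integral P f \<longlongrightarrow> f x) (at (x, 0) within upper_half_space)"
    by (rule Lim_transform_eventually) (auto simp: eventually_at_filter poisson_extension_eq)
qed

text \<open>The points (x, s) and (y, s) have the same distance as x and y, so letting s tend to 0
  loses no constant.\<close>

lemma data_seminorm_le:
  assumes u: "solves_holder_dirichlet a \<omega> f u"
  shows "holder_seminorm \<omega> UNIV f \<le> holder_seminorm \<omega> upper_half_space u"
proof -
  define A where "A = enn2real (holder_seminorm \<omega> upper_half_space u)"
  have fin: "holder_seminorm \<omega> upper_half_space u < \<infinity>" using u by (simp add: solves_holder_dirichlet_def)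
  have "holder_seminorm \<omega> UNIV f \<le> ennreal A"
  proof (rule holder_seminorm_le[OF _ pos])
    show "0 \<le> A" by (simp add: A_def)
    fix x y :: 'a assume "x \<noteq> y"
    have lim: "((\<lambda>s. u (z, s)) \<longlongrightarrow> f z) (at_right 0)" for z
      by (rule trace_along_normal) (use u in \<open>simp add: solves_holder_dirichlet_def\<close>)
    have "((\<lambda>s. dist (u (x, s)) (u (y, s))) \<longlongrightarrow> dist (f x) (f y)) (at_right 0)" by (intro tendsto_dist lim)
    moreover have "\<forall>\<^sub>F s in at_right 0. dist (u (x, s)) (u (y, s)) \<le> A * \<omega> (dist x y)"
      using eventually_at_right_less[of "0::real"]
    proof eventually_elim
      case (elim s)
      have "dist (u (x, s)) (u (y, s)) \<le> A * \<omega> (dist (x, s) (y, s))"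
        unfolding A_def by (rule holder_seminormD[OF fin pos]) (use elim \<open>x \<noteq> y\<close> in auto)
      then show ?case by (simp add: dist_Pair_Pair)
    qed
    ultimately show "dist (f x) (f y) \<le> A * \<omega> (dist x y)" by (intro tendsto_upperbound) auto
  qed
  also have "ennreal A = holder_seminorm \<omega> upper_half_space u"
    using fin by (simp add: A_def ennreal_enn2real_if top.not_eq_extremum)
  finally show ?thesis .
qed

text \<open>By uniqueness an arbitrary solution coincides with the Poisson extension, whose Hoelder
  bound has a constant independent of f.\<close>

lemma solution_seminorm_le:
  "\<exists>c\<ge>0. \<forall>f\<in>holder_space \<omega> UNIV. \<forall>u. solves_holder_dirichlet a \<omega> f u \<longrightarrow>
     holder_seminorm \<omega> upper_half_space u \<le> ennreal c * holder_seminorm \<omega> UNIV f"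
proof -
  obtain c where c: "c \<ge> 0" "\<And>f x y. f \<in> holder_space \<omega> UNIV \<Longrightarrow> x \<in> closure upper_half_space \<Longrightarrow> y \<in> closure upper_half_space \<Longrightarrow> x \<noteq> y \<Longrightarrow>
     dist (poisson_extension f x) (poisson_extension f y) \<le> c * enn2real (holder_seminorm \<omega> UNIV f) * \<omega> (dist x y)"
    using poisson_extension_seminorm by blast
  have "holder_seminorm \<omega> upper_half_space u \<le> ennreal c * holder_seminorm \<omega> UNIV f"
    if f: "f \<in> holder_space \<omega> UNIV" and u: "solves_holder_dirichlet a \<omega> f u" for f u
  proof -
    have eq: "u x = poisson_extension f x" if "x \<in> upper_half_space" for x
      using dirichlet_unique[OF u poisson_integral_solves[OF f] that] poisson_extension_eq[OF that] by simp
    have "holder_seminorm \<omega> upper_half_space u \<le> ennreal (c * enn2real (holder_seminorm \<omega> UNIV f))"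
    proof (rule holder_seminorm_le[OF _ pos])
      fix x y :: "'a \<times> real" assume xy: "x \<in> upper_half_space" "y \<in> upper_half_space" "x \<noteq> y"
      then have "x \<in> closure upper_half_space" "y \<in> closure upper_half_space" using closure_subset by blast+
      then show "dist (u x) (u y) \<le> c * enn2real (holder_seminorm \<omega> UNIV f) * \<omega> (dist x y)"
        unfolding eq[OF xy(1)] eq[OF xy(2)] using xy(3) by (rule c(2)[OF f])
    qed (use c(1) in simp_all)
    also have "\<dots> = ennreal c * holder_seminorm \<omega> UNIV f"
      using holder_data(5)[OF f] c(1) by (simp add: ennreal_mult)
    finally show ?thesis .
  qed
  with c(1) show ?thesis by blast
qed

end

end

theorem theorem6p1:
  fixes a :: "((real^'m::finite) \<times> real, 'M::finite) system"
    and P :: "real^'m \<Rightarrow> complex^'M^'M"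
    and \<omega> :: "real \<Rightarrow> real"
    and C\<^sub>\<omega> :: real
  assumes "strongly_elliptic a"
    and "is_poisson_kernel a P"
    and "growth_function \<omega>"
    and "C\<^sub>\<omega> \<ge> 1"
    and "\<And>t. t > 0 \<Longrightarrow>
           ennreal t * (\<integral>\<^sup>+s\<in>{t<..}. ennreal (\<omega> s / s * (1 / s)) \<partial>lborel) \<le> ennreal (C\<^sub>\<omega> * \<omega> t)"
  shows "(\<forall>f::real^'m \<Rightarrow> complex^'M. f \<in> holder_space \<omega> UNIV \<longrightarrow>
           (\<exists>u. solves_holder_dirichlet a \<omega> f u \<and>
                (\<forall>v. solves_holder_dirichlet a \<omega> f v \<longrightarrow> (\<forall>x\<in>upper_half_space. v x = u x)) \<and>
                (\<forall>x' t. t > 0 \<longrightarrow>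
                   integrable lborel (\<lambda>y'. kernel_dilate P t (x' - y') *v f y') \<and>
                   u (x', t) = matrix_convolution (kernel_dilate P t) f x') \<and>
                (\<exists>w\<in>holder_space \<omega> (closure upper_half_space).
                   continuous_on (closure upper_half_space) w \<and>
                   (\<forall>x\<in>upper_half_space. w x = u x) \<and>
                   (\<forall>x'. w (x', 0) = f x')))) \<and>
         (\<exists>C::real. C \<ge> 1 \<and>
           (\<forall>f\<in>holder_space \<omega> UNIV. \<forall>u. solves_holder_dirichlet a \<omega> f u \<longrightarrow>
              ennreal (inverse C) * holder_seminorm \<omega> UNIV f \<le> holder_seminorm \<omega> upper_half_space u \<and>
              holder_seminorm \<omega> upper_half_space u \<le> ennreal C * holder_seminorm \<omega> UNIV f))"
proof -
  have "controlled_growth \<omega> C\<^sub>\<omega>"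
    using assms(3,5) by unfold_locales (auto simp: growth_function_def)
  then interpret holder_poisson a P \<omega> C\<^sub>\<omega>
    using assms(2) by (intro holder_poisson.intro poisson_kernel.intro)
  have \<omega>0: "(\<omega> \<longlongrightarrow> 0) (at_right 0)"
    using assms(3) by (simp add: growth_function_def)
  note dirichlet = dirichlet_unique[OF \<omega>0 assms(1)] poisson_integral_solves[OF \<omega>0 assms(1)]
    poisson_extension_space[OF \<omega>0 assms(1)] holder_data[OF \<omega>0 assms(1)]
  have slice: "kernel_dilate P t (x' - y') = K (x' - y', t)" for t x' y'
    by (simp add: kernel_extension_def)
  show ?thesis
  proof (intro conjI allI impI)
    fix f :: "real^'m \<Rightarrow> complex^'M" assume f: "f \<in> holder_space \<omega> UNIV"
    show "\<exists>u. solves_holder_dirichlet a \<omega> f u \<and>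
        (\<forall>v. solves_holder_dirichlet a \<omega> f v \<longrightarrow> (\<forall>x\<in>upper_half_space. v x = u x)) \<and>
        (\<forall>x' t. t > 0 \<longrightarrow>
           integrable lborel (\<lambda>y'. kernel_dilate P t (x' - y') *v f y') \<and>
           u (x', t) = matrix_convolution (kernel_dilate P t) f x') \<and>
        (\<exists>w\<in>holder_space \<omega> (closure upper_half_space).
           continuous_on (closure upper_half_space) w \<and>
           (\<forall>x\<in>upper_half_space. w x = u x) \<and> (\<forall>x'. w (x', 0) = f x'))"
    proof (intro exI[of _ "poisson_integral P f"] conjI allI impI ballI)
      show "solves_holder_dirichlet a \<omega> f (poisson_integral P f)" by (rule dirichlet(2)[OF f])
      show "v x = poisson_integral P f x" if "solves_holder_dirichlet a \<omega> f v" "x \<in> upper_half_space" for v x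
        by (rule dirichlet(1)[OF that(1) dirichlet(2)[OF f] that(2)])
      show "integrable lborel (\<lambda>y'. kernel_dilate P t (x' - y') *v f y')" if "t > 0" for x' t
        unfolding slice using integrable_kernel_partial[OF dirichlet(7,8)[OF f], of "[]"] that by simp
      show "poisson_integral P f (x', t) = matrix_convolution (kernel_dilate P t) f x'" for x' t
        by (simp add: poisson_integral_def)
      show "\<exists>w\<in>holder_space \<omega> (closure upper_half_space).
           continuous_on (closure upper_half_space) w \<and>
           (\<forall>x\<in>upper_half_space. w x = poisson_integral P f x) \<and> (\<forall>x'. w (x', 0) = f x')"
        by (intro bexI[of _ "poisson_extension f"] conjI ballI allI dirichlet(3,4) f)
           (simp add: poisson_extension_def upper_half_space_iff, simp add: poisson_extension_def)
    qed
  next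
    obtain c where c: "c \<ge> 0" "\<And>f u. f \<in> holder_space \<omega> UNIV \<Longrightarrow> solves_holder_dirichlet a \<omega> f u \<Longrightarrow>
        holder_seminorm \<omega> upper_half_space u \<le> ennreal c * holder_seminorm \<omega> UNIV f"
      using solution_seminorm_le[OF \<omega>0 assms(1)] by blast
    \<comment> \<open>Only the upper estimate determines C: the lower one holds with constant 1, and
      C >= 1 keeps it valid.\<close>
    define C where "C = max 1 c"
    have C: "C \<ge> 1" "c \<le> C" by (simp_all add: C_def)
    show "\<exists>C\<ge>1. \<forall>f\<in>holder_space \<omega> UNIV. \<forall>u. solves_holder_dirichlet a \<omega> f u \<longrightarrow>
        ennreal (inverse C) * holder_seminorm \<omega> UNIV f \<le> holder_seminorm \<omega> upper_half_space u \<and>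
        holder_seminorm \<omega> upper_half_space u \<le> ennreal C * holder_seminorm \<omega> UNIV f"
    proof (intro exI[of _ C] conjI ballI allI impI C(1))
      fix f u assume f: "f \<in> holder_space \<omega> UNIV" and u: "solves_holder_dirichlet a \<omega> f u"
      have "ennreal (inverse C) * holder_seminorm \<omega> UNIV f \<le> 1 * holder_seminorm \<omega> UNIV f"
        using C(1) by (intro mult_right_mono) (auto simp: inverse_le_1_iff)
      then show "ennreal (inverse C) * holder_seminorm \<omega> UNIV f \<le> holder_seminorm \<omega> upper_half_space u"
        using data_seminorm_le[OF \<omega>0 assms(1) u] by simp
      show "holder_seminorm \<omega> upper_half_space u \<le> ennreal C * holder_seminorm \<omega> UNIV f"
        using C(2) by (intro order_trans[OF c(2)[OF f u]] mult_right_mono ennreal_leI) auto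
    qed
  qed
qed

end
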